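(* Let $n\ge3$ and let $A=(a_{ij})_{1\le i,j\le n}$ satisfy $a_{ij}=a_{ji}\ge0$ and $a_{ii}=0$ for $1\le i,j\le n$. Assume that there is a positive vector solution $\vec u\in\mathbb{R}^nU$ of the system $-\Delta u_i+\lambda u_i=\sum_{j=1}^na_{ij}u_iu_j^2$ in $\Omega$, $u_i\in H$, $1\le i\le n$. If $\det(A)>0$, then the Morse index of $\vec u$ equals $n-2-2l$ for some integer $l\ge0$. If $\det(A)<0$, then the Morse index of $\vec u$ equals $n-3-2l$ for some integer $l\ge0$.
   Context: $\Omega\subset\mathbb{R}^N$ is a domain, $N\le 3$, $\lambda>0$. $H=H^1_0(\Omega)$, except that if $\Omega=\mathbb{R}^N$ then $H$ is the subspace of radially symmetric functions in $H^1(\mathbb{R}^N)$; $\mathbf{H}=H^n$. $U\in H$ is a least energy positive solution of $\Delta u-\lambda u+u^3=0$ in $\Omega$, $u=0$ on $\partial\Omega$, and $\mathbb{R}^nU=\{\vec cU\mid \vec c\in\mathbb{R}^n\}$. A positive vector solution is a solution with $u_i>0$ in $\Omega$ for every $i$. With $I(\vec u)=\frac12\sum_{i=1}^n\int_\Omega(|\nabla u_i|^2+\lambda u_i^2)\,dx-\frac14\int_\Omega\sum_{i,j=1}^na_{ij}u_i^2u_j^2\,dx$ on $\mathbf{H}$, the Morse index of a solution $\vec u$ is the maximal dimension of a subspace $W\subset\mathbf{H}$ with $I''(\vec u)(\vec\phi,\vec\phi)<0$ for all $\vec\phi\in W\setminus\{0\}$. *)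

theory Defs
  imports "HOL-Analysis.Analysis" "HOL-Library.Function_Algebras" "HOL-Library.Extended_Nat"
begin

text \<open>Pointwise scalar multiplication makes functions into a real vector space, so that
  \<^const>\<open>subspace\<close>, \<^const>\<open>span\<close> and \<^const>\<open>dim\<close> apply to spaces of functions.\<close>

instantiation "fun" :: (type, real_vector) real_vector
begin

definition scaleR_fun_def: "r *\<^sub>R f = (\<lambda>x. r *\<^sub>R f x)"

instance
  by standard (simp_all add: scaleR_fun_def fun_eq_iff scaleR_add_left scaleR_add_right)

end


section \<open>Sobolev spaces\<close>

primrec Ck :: "nat \<Rightarrow> ('a::euclidean_space \<Rightarrow> real) \<Rightarrow> bool" where
  "Ck 0 f \<longleftrightarrow> continuous_on UNIV f"
| "Ck (Suc k) f \<longleftrightarrow> (\<forall>x. f differentiable (at x)) \<and>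
     (\<forall>b\<in>Basis. Ck k (\<lambda>x. frechet_derivative f (at x) b))"

definition test_function :: "'a::euclidean_space set \<Rightarrow> ('a \<Rightarrow> real) \<Rightarrow> bool" where
  "test_function \<Omega> \<phi> \<longleftrightarrow> (\<forall>k. Ck k \<phi>) \<and>
     compact (closure {x. \<phi> x \<noteq> 0}) \<and> closure {x. \<phi> x \<noteq> 0} \<subseteq> \<Omega>"

definition grad :: "('a::euclidean_space \<Rightarrow> real) \<Rightarrow> 'a \<Rightarrow> 'a" where
  "grad \<phi> x = (\<Sum>b\<in>Basis. frechet_derivative \<phi> (at x) b *\<^sub>R b)"

text \<open>Elements of Lebesgue and Sobolev spaces are represented by functions on the whole space
  that are measurable on \<open>\<Omega>\<close>; two of them represent the same element when they agree almost
  everywhere in \<open>\<Omega>\<close>, and the values outside \<open>\<Omega>\<close> are irrelevant.\<close>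

definition L2 :: "'a::euclidean_space set \<Rightarrow> ('a \<Rightarrow> 'b::euclidean_space) set" where
  "L2 \<Omega> = {f. f \<in> borel_measurable (lebesgue_on \<Omega>) \<and>
     integrable (lebesgue_on \<Omega>) (\<lambda>x. (norm (f x))\<^sup>2)}"

definition has_weak_gradient ::
    "'a::euclidean_space set \<Rightarrow> ('a \<Rightarrow> real) \<Rightarrow> ('a \<Rightarrow> 'a) \<Rightarrow> bool" where
  "has_weak_gradient \<Omega> u g \<longleftrightarrow> g \<in> L2 \<Omega> \<and>
     (\<forall>\<phi>. test_function \<Omega> \<phi> \<longrightarrow> (\<forall>b\<in>Basis.
        (LINT x|lebesgue_on \<Omega>. u x * (grad \<phi> x \<bullet> b)) =
        - (LINT x|lebesgue_on \<Omega>. (g x \<bullet> b) * \<phi> x)))"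

definition H1 :: "'a::euclidean_space set \<Rightarrow> ('a \<Rightarrow> real) set" where
  "H1 \<Omega> = {u \<in> L2 \<Omega>. \<exists>g. has_weak_gradient \<Omega> u g}"

text \<open>For \<open>u \<in> H1 \<Omega>\<close> the weak gradient is unique up to equality almost everywhere in \<open>\<Omega>\<close>.\<close>

definition wgrad :: "'a::euclidean_space set \<Rightarrow> ('a \<Rightarrow> real) \<Rightarrow> 'a \<Rightarrow> 'a" where
  "wgrad \<Omega> u = (SOME g. has_weak_gradient \<Omega> u g)"

definition H1_norm :: "'a::euclidean_space set \<Rightarrow> ('a \<Rightarrow> real) \<Rightarrow> real" where
  "H1_norm \<Omega> u = sqrt (LINT x|lebesgue_on \<Omega>. (norm (wgrad \<Omega> u x))\<^sup>2 + (u x)\<^sup>2)"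

definition H10 :: "'a::euclidean_space set \<Rightarrow> ('a \<Rightarrow> real) set" where
  "H10 \<Omega> = {u \<in> H1 \<Omega>. \<forall>\<epsilon>>0. \<exists>\<phi>. test_function \<Omega> \<phi> \<and> H1_norm \<Omega> (u - \<phi>) < \<epsilon>}"

definition radially_symmetric :: "('a::euclidean_space \<Rightarrow> real) \<Rightarrow> bool" where
  "radially_symmetric u \<longleftrightarrow> (\<exists>f. AE x in lebesgue. u x = f (norm x))"

definition H :: "'a::euclidean_space set \<Rightarrow> ('a \<Rightarrow> real) set" where
  "H \<Omega> = (if \<Omega> = UNIV then {u \<in> H1 UNIV. radially_symmetric u} else H10 \<Omega>)"

definition Hvec :: "'a::euclidean_space set \<Rightarrow> ('n::finite \<Rightarrow> 'a \<Rightarrow> real) set" where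
  "Hvec \<Omega> = {u. \<forall>i. u i \<in> H \<Omega>}"


section \<open>Solutions\<close>

text \<open>Weak (distributional) form of \<open>-\<Delta>u + lam u = f\<close> in \<open>\<Omega>\<close>.\<close>

definition weakly_solves ::
    "'a::euclidean_space set \<Rightarrow> real \<Rightarrow> ('a \<Rightarrow> real) \<Rightarrow> ('a \<Rightarrow> real) \<Rightarrow> bool" where
  "weakly_solves \<Omega> lam u f \<longleftrightarrow> (\<forall>\<phi>. test_function \<Omega> \<phi> \<longrightarrow>
     (LINT x|lebesgue_on \<Omega>. wgrad \<Omega> u x \<bullet> grad \<phi> x + lam * u x * \<phi> x) =
     (LINT x|lebesgue_on \<Omega>. f x * \<phi> x))"

definition scalar_energy :: "'a::euclidean_space set \<Rightarrow> real \<Rightarrow> ('a \<Rightarrow> real) \<Rightarrow> real" where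
  "scalar_energy \<Omega> lam v =
     1/2 * (LINT x|lebesgue_on \<Omega>. (norm (wgrad \<Omega> v x))\<^sup>2 + lam * (v x)\<^sup>2)
     - 1/4 * (LINT x|lebesgue_on \<Omega>. (v x)^4)"

text \<open>Nonzero elements \<open>v\<close> of \<open>H\<close> at which the derivative of the energy in direction \<open>v\<close>
  vanishes.\<close>

definition nehari :: "'a::euclidean_space set \<Rightarrow> real \<Rightarrow> ('a \<Rightarrow> real) set" where
  "nehari \<Omega> lam = {v \<in> H \<Omega>. \<not> (AE x in lebesgue_on \<Omega>. v x = 0) \<and>
     (LINT x|lebesgue_on \<Omega>. (norm (wgrad \<Omega> v x))\<^sup>2 + lam * (v x)\<^sup>2) =
     (LINT x|lebesgue_on \<Omega>. (v x)^4)}"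

text \<open>``Least energy'' is meant in the usual ground state sense: the energy attains its infimum
  over the Nehari manifold, which contains all nontrivial solutions.\<close>

definition least_energy_positive_solution ::
    "'a::euclidean_space set \<Rightarrow> real \<Rightarrow> ('a \<Rightarrow> real) \<Rightarrow> bool" where
  "least_energy_positive_solution \<Omega> lam U \<longleftrightarrow>
     U \<in> H \<Omega> \<and> weakly_solves \<Omega> lam U (\<lambda>x. (U x)^3) \<and>
     (AE x in lebesgue_on \<Omega>. U x > 0) \<and>
     (\<forall>v\<in>nehari \<Omega> lam. scalar_energy \<Omega> lam U \<le> scalar_energy \<Omega> lam v)"

definition vector_solution ::
    "'a::euclidean_space set \<Rightarrow> real \<Rightarrow> real^'n^'n \<Rightarrow> ('n \<Rightarrow> 'a \<Rightarrow> real) \<Rightarrow> bool" where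
  "vector_solution \<Omega> lam A u \<longleftrightarrow> u \<in> Hvec \<Omega> \<and>
     (\<forall>i. weakly_solves \<Omega> lam (u i) (\<lambda>x. \<Sum>j\<in>UNIV. A $ i $ j * u i x * (u j x)\<^sup>2))"

definition positive_vector_solution ::
    "'a::euclidean_space set \<Rightarrow> real \<Rightarrow> real^'n^'n \<Rightarrow> ('n \<Rightarrow> 'a \<Rightarrow> real) \<Rightarrow> bool" where
  "positive_vector_solution \<Omega> lam A u \<longleftrightarrow> vector_solution \<Omega> lam A u \<and>
     (\<forall>i. AE x in lebesgue_on \<Omega>. u i x > 0)"

text \<open>The space \<open>\<real>\<^sup>n U\<close>, as a set of elements of \<open>H\<^sup>n\<close> (equality almost everywhere).\<close>

definition multiples :: "'a::euclidean_space set \<Rightarrow> ('a \<Rightarrow> real) \<Rightarrow> ('n::finite \<Rightarrow> 'a \<Rightarrow> real) set" where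
  "multiples \<Omega> U = {u. \<exists>c::real^'n. \<forall>i. AE x in lebesgue_on \<Omega>. u i x = c $ i * U x}"


section \<open>Energy and Morse index\<close>

definition energy ::
    "'a::euclidean_space set \<Rightarrow> real \<Rightarrow> real^'n^'n \<Rightarrow> ('n::finite \<Rightarrow> 'a \<Rightarrow> real) \<Rightarrow> real" where
  "energy \<Omega> lam A u =
     1/2 * (\<Sum>i\<in>UNIV. (LINT x|lebesgue_on \<Omega>. (norm (wgrad \<Omega> (u i) x))\<^sup>2 + lam * (u i x)\<^sup>2))
     - 1/4 * (LINT x|lebesgue_on \<Omega>.
         (\<Sum>i\<in>UNIV. \<Sum>j\<in>UNIV. A $ i $ j * (u i x)\<^sup>2 * (u j x)\<^sup>2))"

text \<open>The diagonal value \<open>I''(u)(\<phi>,\<phi>)\<close>.  The energy is smooth on \<open>H\<^sup>n\<close>, so this value of the second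
  derivative is the second derivative along the line through \<open>u\<close> in direction \<open>\<phi>\<close>.\<close>

definition second_variation ::
    "'a::euclidean_space set \<Rightarrow> real \<Rightarrow> real^'n^'n \<Rightarrow>
     ('n::finite \<Rightarrow> 'a \<Rightarrow> real) \<Rightarrow> ('n \<Rightarrow> 'a \<Rightarrow> real) \<Rightarrow> real" where
  "second_variation \<Omega> lam A u \<phi> = deriv (deriv (\<lambda>t. energy \<Omega> lam A (u + t *\<^sub>R \<phi>))) 0"

text \<open>A subspace \<open>W\<close> as below contains no nonzero representative of the zero element of \<open>H\<^sup>n\<close>
  (the second variation is 0 there), so its dimension as a space of functions is its dimension
  in \<open>H\<^sup>n\<close>.  The value is \<open>\<infinity>\<close> if the dimensions are unbounded; only finite-dimensional \<open>W\<close> need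
  be considered, as \<^const>\<open>dim\<close> is 0 for infinite-dimensional spaces.\<close>

definition morse_index ::
    "'a::euclidean_space set \<Rightarrow> real \<Rightarrow> real^'n^'n \<Rightarrow> ('n::finite \<Rightarrow> 'a \<Rightarrow> real) \<Rightarrow> enat" where
  "morse_index \<Omega> lam A u = Sup {enat (dim W) | W.
     W \<subseteq> Hvec \<Omega> \<and> subspace W \<and> (\<exists>B. finite B \<and> W = span B) \<and>
     (\<forall>\<phi>\<in>W - {0}. second_variation \<Omega> lam A u \<phi> < 0)}"

end

theory Submission
  imports Defs
begin

text \<open>
  Writing \<open>u = c U\<close>, the system says \<open>\<Sum>\<^sub>j a\<^sub>i\<^sub>j c\<^sub>j\<^sup>2 = 1\<close>. Diagonalizing the symmetric matrix
  \<open>(a\<^sub>i\<^sub>j c\<^sub>i c\<^sub>j)\<close> with eigenvalues \<open>d\<^sub>k\<close> decouples the second variation into the forms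
  \<open>\<parallel>\<psi>\<^sub>k\<parallel>\<^sup>2 - (1 + 2 d\<^sub>k) \<integral> U\<^sup>2 \<psi>\<^sub>k\<^sup>2\<close>. Since \<open>U\<close> minimizes the energy on the Nehari manifold, it
  minimizes \<open>\<parallel>v\<parallel>\<^sup>4 / \<integral> v\<^sup>4\<close>; hence \<open>\<integral> U\<^sup>2 \<psi>\<^sup>2 \<le> \<parallel>\<psi>\<parallel>\<^sup>2\<close> for all \<open>\<psi>\<close>, and
  \<open>3 \<integral> U\<^sup>2 \<psi>\<^sup>2 \<le> \<parallel>\<psi>\<parallel>\<^sup>2\<close> if \<open>\<integral> U\<^sup>3 \<psi> = 0\<close>. All \<open>d\<^sub>k\<close> lie in \<open>[-1, 1]\<close>, so the \<open>k\<close>-th form has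
  index 1 if \<open>d\<^sub>k > 0\<close> and index 0 otherwise, and the Morse index is the number of positive
  eigenvalues. The sign of \<open>det A\<close> is the parity of the number of negative ones. There is at least
  one, because the trace is 0 while 1 is an eigenvalue (with eigenvector \<open>c\<close>), and for \<open>n \<ge> 3\<close> and
  an invertible matrix exactly one is impossible for the same reason.

  In dimension at most three the elements of \<open>H\<close> have integrable fourth powers, and test functions
  are dense in the Sobolev space of the whole space. This makes all integrals finite and allows
  testing the equation with \<open>U\<close> itself.
\<close>

section \<open>Smooth functions and test functions\<close>

text \<open>The numbers 1 and 3 in the two inequalities for \<open>U\<close> are thresholds for the
  weight in front of \<integral> U^2 \<psi>^2: with weight 1 the form is nonnegative everywhere,
  with weight 3 it is nonnegative off the single direction \<open>U\<close>. The weight 1 + 2 d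
  passes 1 exactly when the eigenvalue d passes 0, and it stays below 3 because d \<le> 1; this is
  why only the sign of each eigenvalue counts. The term 1 stems from the row sums of the system, the
  term 2 d from the mixed products u_i u_j \<phi>_i \<phi>_j. Two obstacles shape the analytic half.
  A Bochner integral is 0 when its integrand is not integrable, so expanding an energy is legitimate
  only once fourth powers are known to be integrable. The equations are given for test functions
  only, so the scalar one is carried to \<open>H\<close> by bounding its residual in the Sobolev
  norm; on the whole space \<open>H\<close> is defined by radial symmetry and not as a closure, and
  there density is obtained by cut-off and mollification.\<close>

lemma Ck_SucI:
  assumes "\<And>x. (f has_derivative (\<lambda>h. \<Sum>b\<in>Basis. (h \<bullet> b) * D b x)) (at x)"
    and "\<And>b. b \<in> Basis \<Longrightarrow> Ck k (D b)"
  shows "Ck (Suc k) f"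
proof -
  have "frechet_derivative f (at x) b = D b x" if "b \<in> Basis" for x b
  proof -
    have "frechet_derivative f (at x) b = (\<Sum>c\<in>Basis. (b \<bullet> c) * D c x)"
      using frechet_derivative_at[OF assms(1)[of x]] by metis
    also have "\<dots> = (\<Sum>c\<in>Basis. if c = b then D b x else 0)"
      using that by (intro sum.cong) (auto simp: inner_Basis)
    also have "\<dots> = D b x" using that by simp
    finally show ?thesis .
  qed
  then show ?thesis
    using assms by (auto simp: differentiable_def cong: ball_cong)
qed

lemma Ck_SucD:
  assumes "Ck (Suc k) f"
  shows "(f has_derivative (\<lambda>h. \<Sum>b\<in>Basis. (h \<bullet> b) * frechet_derivative f (at x) b)) (at x)"
    and "b \<in> Basis \<Longrightarrow> Ck k (\<lambda>x. frechet_derivative f (at x) b)"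
proof -
  have d: "(f has_derivative frechet_derivative f (at x)) (at x)"
    using assms frechet_derivative_works by auto
  then have l: "linear (frechet_derivative f (at x))"
    using has_derivative_linear by blast
  have "frechet_derivative f (at x) h = (\<Sum>b\<in>Basis. (h \<bullet> b) * frechet_derivative f (at x) b)" for h
    using linear_sum[OF l, of "\<lambda>b. (h \<bullet> b) *\<^sub>R b" Basis]
    by (simp add: linear_cmul[OF l] euclidean_representation)
  then show "(f has_derivative (\<lambda>h. \<Sum>b\<in>Basis. (h \<bullet> b) * frechet_derivative f (at x) b)) (at x)"
    by (intro has_derivative_eq_rhs[OF d] ext)
qed (use assms in auto)

lemma Ck_Suc_imp: "Ck (Suc k) f \<Longrightarrow> Ck k f"
proof (induction k arbitrary: f)
  case 0
  then have "\<And>x. isCont f x" by (auto intro: differentiable_imp_continuous_within)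
  then show ?case by (simp add: continuous_at_imp_continuous_on)
next
  case (Suc k)
  then show ?case by (metis Ck.simps(2))
qed

lemma Ck_continuous: "Ck k f \<Longrightarrow> continuous_on UNIV f"
proof (induction k)
  case (Suc k)
  from Ck_Suc_imp[OF Suc.prems] show ?case by (rule Suc.IH)
qed simp

lemma Ck_const: "Ck k (\<lambda>x::'a::euclidean_space. c)"
proof (induction k arbitrary: c)
  case (Suc k)
  show ?case by (rule Ck_SucI[where D="\<lambda>b x. 0"]) (use Suc in \<open>auto intro!: derivative_eq_intros\<close>)
qed auto

lemma Ck_add: "Ck k f \<Longrightarrow> Ck k g \<Longrightarrow> Ck k (\<lambda>x. f x + g x)"
proof (induction k arbitrary: f g)
  case (Suc k)
  note f = Ck_SucD[OF Suc.prems(1)] and g = Ck_SucD[OF Suc.prems(2)]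
  show ?case
    by (rule Ck_SucI[where D="\<lambda>b x. frechet_derivative f (at x) b + frechet_derivative g (at x) b"])
      (use f g Suc.IH in \<open>auto intro!: derivative_eq_intros simp: algebra_simps sum.distrib\<close>)
qed (auto intro: continuous_intros)

lemma Ck_mult: "Ck k f \<Longrightarrow> Ck k g \<Longrightarrow> Ck k (\<lambda>x. f x * g x)"
proof (induction k arbitrary: f g)
  case (Suc k)
  note f = Ck_SucD[OF Suc.prems(1)] and g = Ck_SucD[OF Suc.prems(2)]
  show ?case
    by (rule Ck_SucI[where D="\<lambda>b x. f x * frechet_derivative g (at x) b + frechet_derivative f (at x) b * g x"])
      (use f g in \<open>auto intro!: derivative_eq_intros Ck_add Suc.IH Suc.prems[THEN Ck_Suc_imp]
        simp del: Ck.simps simp: algebra_simps sum.distrib sum_distrib_left\<close>)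
qed (auto intro: continuous_intros)

lemma Ck_cmult: "Ck k f \<Longrightarrow> Ck k (\<lambda>x. c * f x)"
  by (rule Ck_mult[OF Ck_const])

lemma Ck_prod: "finite I \<Longrightarrow> (\<And>i. i \<in> I \<Longrightarrow> Ck k (f i)) \<Longrightarrow> Ck k (\<lambda>x. \<Prod>i\<in>I. f i x)"
  by (induction rule: finite_induct) (auto simp: Ck_const Ck_mult)

lemma Ck_affine: "Ck k f \<Longrightarrow> Ck k (\<lambda>x. f (a + c *\<^sub>R x))"
proof (induction k arbitrary: f)
  case (Suc k)
  have "((\<lambda>x. f (a + c *\<^sub>R x)) has_derivative (\<lambda>h. \<Sum>b\<in>Basis. (h \<bullet> b) *
       (c * frechet_derivative f (at (a + c *\<^sub>R x)) b))) (at x)" for x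
    by (rule has_derivative_eq_rhs, rule has_derivative_compose[of "\<lambda>x. a + c *\<^sub>R x" "\<lambda>h. c *\<^sub>R h" x UNIV f])
       (auto intro!: derivative_eq_intros Ck_SucD[OF Suc.prems] simp: sum_distrib_left algebra_simps)
  then show ?case
    by (rule Ck_SucI) (intro Ck_cmult Suc.IH Ck_SucD(2)[OF Suc.prems])
next
  case 0
  then show ?case
    by (simp add: continuous_on_compose2[of UNIV f UNIV "\<lambda>x. a + c *\<^sub>R x"] continuous_intros)
qed

text \<open>The powers of \<open>x\<close> make the family closed under differentiation, up to linear combinations.\<close>

definition flat_exp :: "nat \<Rightarrow> real \<Rightarrow> real" where
  "flat_exp n x = (if x > 0 then exp (- (1 / x)) / x ^ n else 0)"

text \<open>From the right, t = 1 / x turns the claim into t^n / exp t \<rightarrow> 0 at infinity;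
  from the left the function vanishes.\<close>

lemma flat_exp_at_0: "(flat_exp n \<longlongrightarrow> 0) (at 0)"
proof -
  have "((\<lambda>x. (1 / x) ^ n / exp (1 / x)) \<longlongrightarrow> (0::real)) (at_right 0)"
    by (rule filterlim_compose[OF tendsto_power_div_exp_0, of "\<lambda>x. 1 / x"])
      (use filterlim_inverse_at_top_right in \<open>simp add: inverse_eq_divide\<close>)
  then have "(flat_exp n \<longlongrightarrow> 0) (at_right 0)"
    by (rule Lim_transform_eventually)
      (auto simp: flat_exp_def eventually_at_filter exp_minus field_simps)
  moreover have "(flat_exp n \<longlongrightarrow> 0) (at_left 0)"
    by (rule Lim_transform_eventually[OF tendsto_const])
      (auto simp: flat_exp_def eventually_at_filter)
  ultimately show ?thesis by (simp add: filterlim_split_at)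
qed

lemma flat_exp_deriv: "(flat_exp n has_real_derivative (flat_exp (n + 2) x - n * flat_exp (n + 1) x)) (at x)"
proof (cases x "0::real" rule: linorder_cases)
  case less
  have "((\<lambda>_. 0) has_real_derivative 0) (at x)" by simp
  then have "(flat_exp n has_real_derivative 0) (at x)"
    by (rule has_field_derivative_transform_within_open[where S="{..<0}"])
       (use less in \<open>auto simp: flat_exp_def\<close>)
  then show ?thesis using less by (simp add: flat_exp_def)
next
  case equal
  \<comment> \<open>At 0 the difference quotient is \<open>flat_exp (Suc n)\<close> itself, whose
    limit is already known.\<close>
  have "((\<lambda>h. (flat_exp n (0 + h) - flat_exp n 0) / h) \<longlongrightarrow> 0) (at 0)"
    by (rule Lim_transform_eventually[OF flat_exp_at_0[of "Suc n"]])
       (auto simp: flat_exp_def eventually_at_filter field_simps)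
  then show ?thesis by (simp add: equal DERIV_def flat_exp_def)
next
  case greater
  have "((\<lambda>x. exp (- (1 / x)) / x ^ n) has_real_derivative (flat_exp (n + 2) x - n * flat_exp (n + 1) x)) (at x)"
    by (rule derivative_eq_intros refl | use greater in force)+
       (use greater in \<open>cases n; simp add: flat_exp_def field_simps power_add power2_eq_square\<close>)
  then show ?thesis
    by (rule has_field_derivative_transform_within_open[where S="{0<..}"])
       (use greater in \<open>auto simp: flat_exp_def\<close>)
qed

lemma Ck_flat_exp: "Ck k (\<lambda>x::'a::euclidean_space. flat_exp n (x \<bullet> v + c))"
proof (induction k arbitrary: n)
  case 0
  have "continuous_on UNIV (flat_exp n)"
    by (meson DERIV_isCont continuous_at_imp_continuous_on flat_exp_deriv)
  then show ?case
    by (simp add: continuous_on_compose2[of UNIV "flat_exp n" UNIV "\<lambda>x. x \<bullet> v + c"] continuous_intros)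
next
  case (Suc k)
  let ?d = "\<lambda>x. flat_exp (n + 2) (x \<bullet> v + c) + - real n * flat_exp (n + 1) (x \<bullet> v + c)"
  have "((\<lambda>x. flat_exp n (x \<bullet> v + c)) has_derivative (\<lambda>h. \<Sum>b\<in>Basis. (h \<bullet> b) * ((b \<bullet> v) * ?d x))) (at x)" for x
  proof (rule has_derivative_eq_rhs)
    show "((\<lambda>x. flat_exp n (x \<bullet> v + c)) has_derivative (\<lambda>h. ?d x * (h \<bullet> v))) (at x)"
      by (rule has_derivative_compose[of "\<lambda>x. x \<bullet> v + c" "\<lambda>h. h \<bullet> v" x UNIV "flat_exp n"])
         (use flat_exp_deriv[of n "x \<bullet> v + c"] in \<open>auto intro!: derivative_eq_intros simp: has_field_derivative_def\<close>)
    have *: "y * (h \<bullet> v) = (\<Sum>b\<in>Basis. (h \<bullet> b) * ((b \<bullet> v) * y))" for h y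
      by (subst euclidean_inner) (simp add: sum_distrib_left mult_ac inner_commute)
    show "(\<lambda>h. ?d x * (h \<bullet> v)) = (\<lambda>h. \<Sum>b\<in>Basis. (h \<bullet> b) * ((b \<bullet> v) * ?d x))"
      by (rule ext) (rule *)
  qed
  then show ?case
    by (rule Ck_SucI) (intro Ck_cmult Ck_add Suc.IH)
qed

text \<open>The factor \<open>Suc m\<close> steepens the profile, so that the bumps stay between 0
  and 1 and converge pointwise to the indicator of the open box as m grows.\<close>

definition box_bump :: "nat \<Rightarrow> 'a::euclidean_space \<Rightarrow> 'a \<Rightarrow> 'a \<Rightarrow> real" where
  "box_bump m l u x = (\<Prod>b\<in>Basis. flat_exp 0 (real (Suc m) * ((x - l) \<bullet> b)) * flat_exp 0 (real (Suc m) * ((u - x) \<bullet> b)))"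

lemma flat_exp_0: "flat_exp 0 x \<ge> 0" "flat_exp 0 x \<le> 1" "flat_exp 0 x > 0 \<longleftrightarrow> x > 0" "flat_exp 0 x = 0 \<longleftrightarrow> x \<le> 0"
  by (auto simp: flat_exp_def)

lemma Ck_box_bump: "Ck k (box_bump m l u)"
proof -
  have "Ck k (\<lambda>x. \<Prod>b\<in>Basis. flat_exp 0 (x \<bullet> (real (Suc m) *\<^sub>R b) + - real (Suc m) * (l \<bullet> b)) *
      flat_exp 0 (x \<bullet> (- real (Suc m) *\<^sub>R b) + real (Suc m) * (u \<bullet> b)))"
    by (intro Ck_prod Ck_mult Ck_flat_exp finite_Basis)
  then show ?thesis
    unfolding box_bump_def[abs_def] by (simp add: algebra_simps inner_diff_left)
qed

lemma box_bump_bounds: "0 \<le> box_bump m l u x" "box_bump m l u x \<le> 1"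
  unfolding box_bump_def by (auto intro!: prod_nonneg prod_le_1 mult_le_one simp: flat_exp_0)

lemma box_bump_pos: "box_bump m l u x > 0 \<longleftrightarrow> x \<in> box l u"
proof -
  have "box_bump m l u x = 0 \<longleftrightarrow> x \<notin> box l u"
    unfolding box_bump_def
    by (auto simp: flat_exp_0 box_def mult_le_0_iff inner_diff_left not_less simp del: of_nat_Suc)
  then show ?thesis using box_bump_bounds(1)[of m l u x] by linarith
qed

lemma box_bump_zero: "x \<notin> box l u \<Longrightarrow> box_bump m l u x = 0"
  using box_bump_pos[of m l u x] box_bump_bounds(1)[of m l u x] by linarith

lemma box_bump_tendsto: "(\<lambda>m. box_bump m l u x) \<longlonglongrightarrow> indicator (box l u) x"
proof (cases "x \<in> box l u")
  case True
  have f: "(\<lambda>m. flat_exp 0 (real (Suc m) * y)) \<longlonglongrightarrow> 1" if "y > 0" for y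
  proof -
    have "(\<lambda>m. exp (- (1 / real (Suc m)) * (1 / y))) \<longlonglongrightarrow> exp (- 0 * (1 / y))"
      by (intro tendsto_intros LIMSEQ_Suc lim_1_over_n)
    then show ?thesis using that by (simp add: flat_exp_def mult.commute)
  qed
  have "(\<lambda>m. box_bump m l u x) \<longlonglongrightarrow> (\<Prod>b\<in>(Basis::'a set). 1 * 1)"
    unfolding box_bump_def
    by (intro tendsto_prod tendsto_mult f) (use True in \<open>auto simp: box_def inner_diff_left\<close>)
  then show ?thesis using True by simp
next
  case False
  then show ?thesis by (simp add: box_bump_zero)
qed

section \<open>Test functions and their gradients\<close>

lemma test_functionI:
  assumes "\<And>k. Ck k \<phi>" "compact K" "K \<subseteq> \<Omega>" "\<And>x. x \<notin> K \<Longrightarrow> \<phi> x = 0"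
  shows "test_function \<Omega> \<phi>"
proof -
  have "closure {x. \<phi> x \<noteq> 0} \<subseteq> K"
    by (rule closure_minimal) (use assms compact_imp_closed in auto)
  moreover have "compact (K \<inter> closure {x. \<phi> x \<noteq> 0})"
    using assms(2) by (intro compact_Int_closed closed_closure)
  ultimately show ?thesis
    using assms(1,3) unfolding test_function_def by (simp add: inf_absorb2) 
qed

lemma test_function_supp:
  assumes "test_function \<Omega> \<phi>"
  shows "\<exists>K. compact K \<and> K \<subseteq> \<Omega> \<and> (\<forall>x. x \<notin> K \<longrightarrow> \<phi> x = 0 \<and> grad \<phi> x = 0)"
proof -
  define K where "K = closure {x. \<phi> x \<noteq> 0}"
  have K: "compact K" "K \<subseteq> \<Omega>" using assms by (auto simp: test_function_def K_def)
  have z: "\<phi> x = 0" if "x \<notin> K" for x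
    using that closure_subset[of "{x. \<phi> x \<noteq> 0}"] by (auto simp: K_def)
  have "open (- K)" by (simp add: K_def open_Compl)
  have "grad \<phi> x = 0" if "x \<notin> K" for x
  proof -
    have "(\<phi> has_derivative (\<lambda>h. 0)) (at x)"
      by (rule has_derivative_transform_within_open[OF _ \<open>open (- K)\<close>, where f="\<lambda>_. 0"])
         (use that z in auto)
    then have "frechet_derivative \<phi> (at x) = (\<lambda>h. 0)"
      by (metis frechet_derivative_at)
    then show ?thesis by (simp add: grad_def)
  qed
  then show ?thesis using K z by blast
qed

lemma test_box_bump: assumes "cbox l u \<subseteq> \<Omega>" shows "test_function \<Omega> (box_bump m l u)"
proof (rule test_functionI[OF Ck_box_bump compact_cbox assms])
  fix x assume "x \<notin> cbox l u"
  then have "x \<notin> box l u" using box_subset_cbox by blast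
  then show "box_bump m l u x = 0" by (rule box_bump_zero)
qed

lemma test_function_Ck: "test_function \<Omega> \<phi> \<Longrightarrow> Ck k \<phi>"
  by (simp add: test_function_def)

lemma test_function_add:
  assumes "test_function \<Omega> f" "test_function \<Omega> g"
  shows "test_function \<Omega> (\<lambda>x. f x + g x)"
proof -
  obtain K where "compact K" "K \<subseteq> \<Omega>" "\<And>x. x \<notin> K \<Longrightarrow> f x = 0"
    using test_function_supp[OF assms(1)] by blast
  moreover obtain L where "compact L" "L \<subseteq> \<Omega>" "\<And>x. x \<notin> L \<Longrightarrow> g x = 0"
    using test_function_supp[OF assms(2)] by blast
  ultimately show ?thesis
    by (intro test_functionI[where K="K \<union> L"] Ck_add assms[THEN test_function_Ck]) auto
qed

lemma test_function_mult:
  assumes "test_function \<Omega> f" "\<And>k. Ck k g"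
  shows "test_function \<Omega> (\<lambda>x. f x * g x)"
proof -
  obtain K where "compact K" "K \<subseteq> \<Omega>" "\<And>x. x \<notin> K \<Longrightarrow> f x = 0"
    using test_function_supp[OF assms(1)] by blast
  then show ?thesis
    by (intro test_functionI[where K="K"] Ck_mult test_function_Ck[OF assms(1)] assms(2)) auto
qed

lemma test_function_cmult: "test_function \<Omega> f \<Longrightarrow> test_function \<Omega> (\<lambda>x. c * f x)"
  using test_function_mult[of \<Omega> f "\<lambda>_. c"] by (simp add: Ck_const mult.commute)

lemma grad_inner: "b \<in> Basis \<Longrightarrow> grad \<phi> x \<bullet> b = frechet_derivative \<phi> (at x) b"
  unfolding grad_def by (simp add: inner_sum_left inner_Basis if_distrib cong: if_cong)

lemma has_derivative_grad:
  assumes "Ck (Suc 0) \<phi>" shows "(\<phi> has_derivative (\<lambda>h. h \<bullet> grad \<phi> x)) (at x)"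
  using Ck_SucD(1)[OF assms, of x] unfolding grad_def by (simp add: inner_sum_right mult.commute)

lemma grad_eqI:
  assumes "(\<phi> has_derivative (\<lambda>h. h \<bullet> g)) (at x)" shows "grad \<phi> x = g"
proof (rule euclidean_eqI)
  fix b :: 'a assume b: "b \<in> Basis"
  have "frechet_derivative \<phi> (at x) b = b \<bullet> g" by (metis assms frechet_derivative_at)
  then show "grad \<phi> x \<bullet> b = g \<bullet> b" by (simp only: grad_inner[OF b] inner_commute[of g])
qed

lemma grad_mult:
  "Ck (Suc 0) f \<Longrightarrow> Ck (Suc 0) g \<Longrightarrow> grad (\<lambda>x. f x * g x) x = f x *\<^sub>R grad g x + g x *\<^sub>R grad f x"
  by (rule grad_eqI)
     (auto intro!: derivative_eq_intros has_derivative_grad simp: inner_add_right algebra_simps)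

lemma grad_affine: "Ck (Suc 0) f \<Longrightarrow> grad (\<lambda>x. f (a + c *\<^sub>R x)) x = c *\<^sub>R grad f (a + c *\<^sub>R x)"
  by (rule grad_eqI, rule has_derivative_eq_rhs,
      rule has_derivative_compose[of "\<lambda>x. a + c *\<^sub>R x" "\<lambda>h. c *\<^sub>R h" x UNIV f])
     (auto intro!: derivative_eq_intros has_derivative_grad)

lemma Ck_grad: "\<lbrakk>\<And>k. Ck k f; b \<in> Basis\<rbrakk> \<Longrightarrow> Ck k (\<lambda>x. grad f x \<bullet> b)"
  using Ck_SucD(2)[of k f b] by (simp add: grad_inner)

lemma continuous_grad: assumes "\<And>k. Ck k f" shows "continuous_on UNIV (grad f)"
proof -
  have "continuous_on UNIV (\<lambda>x. \<Sum>b\<in>Basis. (grad f x \<bullet> b) *\<^sub>R b)"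
    by (intro continuous_on_sum continuous_on_scaleR continuous_on_const Ck_continuous[of 0] Ck_grad assms)
  then show ?thesis by (simp add: euclidean_representation)
qed

lemma test_function_grad:
  assumes "test_function \<Omega> f" "b \<in> Basis" shows "test_function \<Omega> (\<lambda>x. grad f x \<bullet> b)"
proof -
  obtain K where "compact K" "K \<subseteq> \<Omega>" "\<And>x. x \<notin> K \<Longrightarrow> grad f x = 0"
    using test_function_supp[OF assms(1)] by blast
  then show ?thesis
    by (intro test_functionI[where K="K"] Ck_grad test_function_Ck[OF assms(1)] assms) auto
qed

lemma test_function_mono: "test_function \<Omega> f \<Longrightarrow> \<Omega> \<subseteq> \<Omega>' \<Longrightarrow> test_function \<Omega>' f"
  by (auto simp: test_function_def)

lemma test_function_bounded:
  assumes "test_function \<Omega> \<phi>"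
  shows "\<exists>C\<ge>0. \<forall>x. \<bar>\<phi> x\<bar> \<le> C \<and> norm (grad \<phi> x) \<le> C"
proof -
  obtain K where K: "compact K" "\<And>x. x \<notin> K \<Longrightarrow> \<phi> x = 0 \<and> grad \<phi> x = 0"
    using test_function_supp[OF assms] by blast
  have c: "continuous_on K \<phi>" "continuous_on K (grad \<phi>)"
    using test_function_Ck[OF assms]
    by (auto intro: continuous_on_subset[OF Ck_continuous] continuous_on_subset[OF continuous_grad])
  obtain B where B: "\<forall>y\<in>\<phi> ` K. norm y \<le> B"
    using compact_imp_bounded[OF compact_continuous_image[OF c(1) K(1)]] unfolding bounded_iff by blast
  obtain C where C: "\<forall>y\<in>grad \<phi> ` K. norm y \<le> C"
    using compact_imp_bounded[OF compact_continuous_image[OF c(2) K(1)]] unfolding bounded_iff by blast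
  have "\<bar>\<phi> x\<bar> \<le> max 0 (max B C) \<and> norm (grad \<phi> x) \<le> max 0 (max B C)" for x
    using K(2)[of x] B C by (cases "x \<in> K") (auto simp: le_max_iff_disj)
  then show ?thesis by (intro exI[of _ "max 0 (max B C)"]) auto
qed

section \<open>Weak gradients\<close>

text \<open>The positive and negative parts are densities of two finite measures that agree on
  boxes. Boxes form an intersection-stable generator of the Borel sets, so the measures coincide,
  and hence their densities do almost everywhere.\<close>

lemma integral_box_zero_AE:
  fixes f :: "'a::euclidean_space \<Rightarrow> real"
  assumes f: "integrable lborel f" and z: "\<And>a b. (LINT x|lborel. f x * indicator (box a b) x) = 0"
  shows "AE x in lborel. f x = 0"
proof -
  note [measurable] = borel_measurable_integrable[OF f]
  \<comment> \<open>\<open>ennreal\<close> sends negative numbers to 0, so these are the positive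
    and the negative part of \<open>f\<close>.\<close>
  let ?p = "\<lambda>x. ennreal (f x)" and ?n = "\<lambda>x. ennreal (- f x)"
  let ?E = "range (\<lambda>(a, b). box a b :: 'a set)"
  have fi: "integrable lborel (\<lambda>x. max 0 (f x))" "integrable lborel (\<lambda>x. max 0 (- f x))"
    using f by auto
  have m0: "ennreal (max 0 y) = ennreal y" for y :: real by (auto simp: max_def ennreal_neg)
  have eqb: "emeasure (density lborel ?p) (box a b) = emeasure (density lborel ?n) (box a b)" for a b
  proof -
    have i: "integrable lborel (\<lambda>x. max 0 (f x) * indicator (box a b) x)"
      "integrable lborel (\<lambda>x. max 0 (- f x) * indicator (box a b) x)"
      by (auto intro!: integrable_real_mult_indicator fi)
    have "(LINT x|lborel. max 0 (f x) * indicator (box a b) x) -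
       (LINT x|lborel. max 0 (- f x) * indicator (box a b) x) = (LINT x|lborel. f x * indicator (box a b) x)"
      by (subst Bochner_Integration.integral_diff[OF i, symmetric], rule Bochner_Integration.integral_cong)
         (auto simp: max_def indicator_def)
    then have eq: "(LINT x|lborel. max 0 (f x) * indicator (box a b) x) = (LINT x|lborel. max 0 (- f x) * indicator (box a b) x)"
      using z by simp
    have "emeasure (density lborel ?p) (box a b) = (\<integral>\<^sup>+x. ennreal (max 0 (f x) * indicator (box a b) x) \<partial>lborel)"
      by (subst emeasure_density) (auto intro!: nn_integral_cong simp: m0 indicator_def)
    also have "\<dots> = ennreal (LINT x|lborel. max 0 (f x) * indicator (box a b) x)"
      by (rule nn_integral_eq_integral[OF i(1)]) auto
    also have "\<dots> = (\<integral>\<^sup>+x. ennreal (max 0 (- f x) * indicator (box a b) x) \<partial>lborel)"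
      unfolding eq by (rule nn_integral_eq_integral[OF i(2), symmetric]) auto
    also have "\<dots> = emeasure (density lborel ?n) (box a b)"
      by (subst emeasure_density) (auto intro!: nn_integral_cong simp: m0 indicator_def)
    finally show ?thesis .
  qed
  have fin: "(\<integral>\<^sup>+x. ?p x \<partial>lborel) \<noteq> \<infinity>" "(\<integral>\<^sup>+x. ?n x \<partial>lborel) \<noteq> \<infinity>"
    using f by (auto simp: real_integrable_def)
  have "density lborel ?p = density lborel ?n"
  proof (rule measure_eqI_generator_eq[of ?E UNIV _ _ "\<lambda>n::nat. box (- (real n *\<^sub>R One)) (real n *\<^sub>R One)"])
    show "Int_stable ?E" by (auto simp: Int_stable_def box_Int_box)
    show "range (\<lambda>n::nat. box (- (real n *\<^sub>R One)) (real n *\<^sub>R One)) \<subseteq> ?E" by auto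
    show "(\<Union>i. box (- (real i *\<^sub>R One)) (real i *\<^sub>R One)) = (UNIV :: 'a set)"
      by (rule UN_box_eq_UNIV)
    show "sets (density lborel ?p) = sigma_sets UNIV ?E" "sets (density lborel ?n) = sigma_sets UNIV ?E"
      by (simp_all add: borel_eq_box)
    fix i :: nat
    have "emeasure (density lborel ?p) (box (- (real i *\<^sub>R One)) (real i *\<^sub>R One)) \<le> (\<integral>\<^sup>+x. ?p x \<partial>lborel)"
      by (subst emeasure_density) (auto intro!: nn_integral_mono simp: indicator_def)
    then show "emeasure (density lborel ?p) (box (- (real i *\<^sub>R One)) (real i *\<^sub>R One)) \<noteq> \<infinity>"
      using fin(1) by (auto simp: top_unique)
  qed (use eqb in auto)
  then have "AE x in lborel. ?p x = ?n x"
    by (subst (asm) finite_density_unique) (use fin in auto)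
  then show ?thesis
  proof eventually_elim
    case (elim x)
    then show ?case by (cases "f x" "0::real" rule: linorder_cases) (simp_all add: ennreal_neg)
  qed
qed

text \<open>A Borel representative reduces this to the preceding lemma.\<close>

lemma lebesgue_box_zero_AE:
  fixes f :: "'a::euclidean_space \<Rightarrow> real"
  assumes f: "integrable lebesgue f" and z: "\<And>a b. (LINT x|lebesgue. f x * indicator (box a b) x) = 0"
  shows "AE x in lebesgue. f x = 0"
proof -
  obtain g where g: "g \<in> borel_measurable lborel" and ae: "AE x in lborel. f x = g x"
    using completion_ex_borel_measurable_real[OF borel_measurable_integrable[OF f]] by blast
  note [measurable] = g borel_measurable_integrable[OF f]
  have ae': "AE x in lebesgue. f x = g x" using ae by (rule AE_completion)
  have mg: "g \<in> borel_measurable lebesgue" by (rule measurable_completion[OF g])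
  have "integrable lebesgue g"
    using integrable_cong_AE[OF _ mg ae'] f by auto
  then have "integrable lborel g" using g by (simp add: integrable_completion)
  moreover have "(LINT x|lborel. g x * indicator (box a b) x) = 0" for a b
  proof -
    have "(LINT x|lborel. g x * indicator (box a b) x) = (LINT x|lebesgue. g x * indicator (box a b) x)"
      by (rule integral_completion[symmetric]) measurable
    also have "\<dots> = (LINT x|lebesgue. f x * indicator (box a b) x)"
    proof (rule integral_cong_AE)
      have b: "indicator (box a b) \<in> borel_measurable (lebesgue :: 'a measure)"
        by (intro borel_measurable_indicator) auto
      show "(\<lambda>x. g x * indicator (box a b) x) \<in> borel_measurable lebesgue"
        by (rule borel_measurable_times[OF mg b])
      show "(\<lambda>x. f x * indicator (box a b) x) \<in> borel_measurable lebesgue"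
        by (rule borel_measurable_times[OF borel_measurable_integrable[OF f] b])
    qed (use ae' in auto)
    finally show ?thesis using z by simp
  qed
  ultimately have "AE x in lborel. g x = 0" by (rule integral_box_zero_AE)
  from AE_completion[OF this] ae' show ?thesis by eventually_elim simp
qed

section \<open>Square integrable functions\<close>

lemma L2_measurable: "f \<in> L2 \<Omega> \<Longrightarrow> f \<in> borel_measurable (lebesgue_on \<Omega>)"
  by (simp add: L2_def)

lemma sqint_inner:
  fixes f g :: "'a \<Rightarrow> 'b::euclidean_space"
  assumes "f \<in> borel_measurable M" "g \<in> borel_measurable M"
    "integrable M (\<lambda>x. (norm (f x))\<^sup>2)" "integrable M (\<lambda>x. (norm (g x))\<^sup>2)"
  shows "integrable M (\<lambda>x. f x \<bullet> g x)"
proof (rule Bochner_Integration.integrable_bound)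
  show "integrable M (\<lambda>x. (norm (f x))\<^sup>2 + (norm (g x))\<^sup>2)" using assms by auto
  have "\<bar>f x \<bullet> g x\<bar> \<le> (norm (f x))\<^sup>2 + (norm (g x))\<^sup>2" for x
    using Cauchy_Schwarz_ineq2[of "f x" "g x"] sum_squares_bound[of "norm (f x)" "norm (g x)"]
    by (simp add: power2_eq_square)
  then show "AE x in M. norm (f x \<bullet> g x) \<le> norm ((norm (f x))\<^sup>2 + (norm (g x))\<^sup>2)" by auto
qed (use assms in measurable)

lemma L2_inner: "f \<in> L2 \<Omega> \<Longrightarrow> g \<in> L2 \<Omega> \<Longrightarrow> integrable (lebesgue_on \<Omega>) (\<lambda>x. f x \<bullet> g x)"
  unfolding L2_def by (auto intro: sqint_inner)

lemma L2_mult: "f \<in> L2 \<Omega> \<Longrightarrow> g \<in> L2 \<Omega> \<Longrightarrow> integrable (lebesgue_on \<Omega>) (\<lambda>x. f x * (g x :: real))"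
  using L2_inner[of f \<Omega> g] by simp

lemma L2_add: assumes "f \<in> L2 \<Omega>" "g \<in> L2 \<Omega>" shows "(\<lambda>x. f x + g x) \<in> L2 \<Omega>"
proof -
  have "(\<lambda>x. (norm (f x + g x))\<^sup>2) = (\<lambda>x. (norm (f x))\<^sup>2 + (norm (g x))\<^sup>2 + 2 * (f x \<bullet> g x))"
    by (auto simp: power2_norm_eq_inner inner_add_left inner_add_right inner_commute)
  then show ?thesis using assms L2_inner[OF assms] by (auto simp: L2_def)
qed

lemma L2_scaleR: "f \<in> L2 \<Omega> \<Longrightarrow> (\<lambda>x. c *\<^sub>R f x) \<in> L2 \<Omega>"
  by (auto simp: L2_def power_mult_distrib)

lemma L2_cmult: "f \<in> L2 \<Omega> \<Longrightarrow> (\<lambda>x. c * f x :: real) \<in> L2 \<Omega>"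
  using L2_scaleR[of f \<Omega> c] by simp

lemma L2_diff: assumes "f \<in> L2 \<Omega>" "g \<in> L2 \<Omega>" shows "(\<lambda>x. f x - g x) \<in> L2 \<Omega>"
  using L2_add[OF assms(1) L2_scaleR[OF assms(2), of "-1"]] by simp

lemma L2_bounded_mult:
  fixes f :: "'a::euclidean_space \<Rightarrow> real" and g :: "'a \<Rightarrow> 'b::euclidean_space"
  assumes "f \<in> L2 \<Omega>" "g \<in> borel_measurable (lebesgue_on \<Omega>)" "\<And>x. norm (g x) \<le> C"
  shows "(\<lambda>x. f x *\<^sub>R g x) \<in> L2 \<Omega>"
proof -
  have "integrable (lebesgue_on \<Omega>) (\<lambda>x. (norm (f x *\<^sub>R g x))\<^sup>2)"
  proof (rule Bochner_Integration.integrable_bound)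
    show "integrable (lebesgue_on \<Omega>) (\<lambda>x. C\<^sup>2 * (norm (f x))\<^sup>2)" using assms by (simp add: L2_def)
    have "(norm (f x *\<^sub>R g x))\<^sup>2 \<le> C\<^sup>2 * (norm (f x))\<^sup>2" for x
      using mult_right_mono[OF power_mono[OF assms(3)[of x] norm_ge_zero, of 2], of "(norm (f x))\<^sup>2"]
      by (simp add: power_mult_distrib mult.commute)
    then show "AE x in lebesgue_on \<Omega>. norm ((norm (f x *\<^sub>R g x))\<^sup>2) \<le> norm (C\<^sup>2 * (norm (f x))\<^sup>2)"
      by (intro AE_I2) simp
  qed (use assms in \<open>auto simp: L2_def\<close>)
  then show ?thesis using assms by (auto simp: L2_def)
qed

lemma borel_measurable_lebesgue_onI:
  "f \<in> borel_measurable borel \<Longrightarrow> f \<in> borel_measurable (lebesgue_on \<Omega>)"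
  by (intro measurable_restrict_space1 measurable_completion) simp

lemma continuous_measurable_lebesgue_on:
  fixes f :: "'a::euclidean_space \<Rightarrow> 'b::euclidean_space"
  shows "continuous_on UNIV f \<Longrightarrow> f \<in> borel_measurable (lebesgue_on \<Omega>)"
  by (intro borel_measurable_lebesgue_onI borel_measurable_continuous_onI)

lemma integrable_lebesgue_on_indicator:
  assumes "open \<Omega>" "S \<in> lmeasurable"
  shows "integrable (lebesgue_on \<Omega>) (indicator S :: _ \<Rightarrow> real)"
proof -
  have "integrable lebesgue (\<lambda>x. indicator \<Omega> x *\<^sub>R indicator S x :: real)"
    using fmeasurable_Int_fmeasurable[OF assms(2), of \<Omega>] assms(1)
    by (simp add: indicator_inter_arith[symmetric] lmeasurable_iff_integrable[symmetric] Int_commute)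
  then show ?thesis using assms by (subst integrable_restrict_space) auto
qed

lemma L2_compact_support:
  fixes f :: "'a::euclidean_space \<Rightarrow> 'b::euclidean_space"
  assumes "open \<Omega>" "f \<in> borel_measurable (lebesgue_on \<Omega>)" "\<And>x. norm (f x) \<le> C" "compact K" "\<And>x. x \<notin> K \<Longrightarrow> f x = 0"
  shows "f \<in> L2 \<Omega>"
proof -
  have "integrable (lebesgue_on \<Omega>) (\<lambda>x. (norm (f x))\<^sup>2)"
  proof (rule Bochner_Integration.integrable_bound)
    show "integrable (lebesgue_on \<Omega>) (\<lambda>x. C\<^sup>2 * indicator K x)"
      using integrable_lebesgue_on_indicator[OF assms(1) lmeasurable_compact[OF assms(4)]] by auto
    have "(norm (f x))\<^sup>2 \<le> C\<^sup>2 * indicator K x" for x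
      using assms(5)[of x] power_mono[OF assms(3)[of x] norm_ge_zero, of 2] by (cases "x \<in> K") auto
    then show "AE x in lebesgue_on \<Omega>. norm ((norm (f x))\<^sup>2) \<le> norm (C\<^sup>2 * indicator K x)"
      by auto
  qed (use assms in auto)
  then show ?thesis using assms by (auto simp: L2_def)
qed

lemma test_function_L2:
  assumes "open \<Omega>" "test_function \<Omega>' \<phi>" shows "\<phi> \<in> L2 \<Omega>" "grad \<phi> \<in> L2 \<Omega>"
proof -
  obtain K where K: "compact K" "\<And>x. x \<notin> K \<Longrightarrow> \<phi> x = 0 \<and> grad \<phi> x = 0"
    using test_function_supp[OF assms(2)] by blast
  obtain C where C: "\<And>x. \<bar>\<phi> x\<bar> \<le> C \<and> norm (grad \<phi> x) \<le> C"
    using test_function_bounded[OF assms(2)] by blast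
  note Ck = test_function_Ck[OF assms(2)]
  show "\<phi> \<in> L2 \<Omega>"
    by (rule L2_compact_support[OF assms(1) _ _ K(1)])
       (use C K in \<open>auto intro!: continuous_measurable_lebesgue_on Ck_continuous[OF Ck]\<close>)
  show "grad \<phi> \<in> L2 \<Omega>"
    by (rule L2_compact_support[OF assms(1) _ _ K(1)])
       (use C K in \<open>auto intro!: continuous_measurable_lebesgue_on continuous_grad[OF Ck]\<close>)
qed

text \<open>Box bumps are test functions that converge to indicators, so h integrates to 0 over
  every open box whose closed box lies in \<Omega>. Countably many closed boxes exhaust
  \<Omega>.\<close>

lemma fundamental_lemma_calculus_of_variations:
  fixes h :: "'a::euclidean_space \<Rightarrow> real"
  assumes \<Omega>: "open \<Omega>" and h: "h \<in> L2 \<Omega>"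
    and z: "\<And>\<phi>. test_function \<Omega> \<phi> \<Longrightarrow> (LINT x|lebesgue_on \<Omega>. h x * \<phi> x) = 0"
  shows "AE x in lebesgue_on \<Omega>. h x = 0"
proof -
  have hm: "h \<in> borel_measurable (lebesgue_on \<Omega>)" using h by (simp add: L2_def)
  have S: "\<Omega> \<in> sets lebesgue" using \<Omega> by auto
  \<comment> \<open>Square integrability implies integrability on sets of finite measure; this
    supplies the dominating functions below.\<close>
  have hi: "integrable (lebesgue_on \<Omega>) (\<lambda>x. h x * indicator A x)" if "A \<in> lmeasurable" for A
  proof -
    have "A \<inter> \<Omega> \<in> sets (lebesgue_on \<Omega>)"
      using that S by (subst sets_restrict_space_iff) (auto simp: fmeasurable_def)
    have "indicator A \<in> borel_measurable (lebesgue_on \<Omega>)"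
      using that by (intro measurable_restrict_space1) (auto simp: fmeasurable_def)
    then have "(indicator A :: 'a \<Rightarrow> real) \<in> L2 \<Omega>"
      using integrable_lebesgue_on_indicator[OF \<Omega> that]
      by (simp add: L2_def power2_eq_square indicator_times_eq_if[symmetric] indicator_inter_arith[symmetric])
    then show ?thesis by (rule L2_mult[OF h])
  qed
  have bz: "(LINT x|lebesgue_on \<Omega>. h x * indicator (box l u) x) = 0" if "cbox l u \<subseteq> \<Omega>" for l u
  proof -
    have "(\<lambda>m. LINT x|lebesgue_on \<Omega>. h x * box_bump m l u x) \<longlonglongrightarrow>
       (LINT x|lebesgue_on \<Omega>. h x * indicator (box l u) x)"
    proof (rule integral_dominated_convergence[where w="\<lambda>x. \<bar>h x * indicator (box l u) x\<bar>"])
      show "(\<lambda>x. h x * indicator (box l u) x) \<in> borel_measurable (lebesgue_on \<Omega>)"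
        "integrable (lebesgue_on \<Omega>) (\<lambda>x. \<bar>h x * indicator (box l u) x\<bar>)"
        using hi[of "box l u"] by auto
      show "(\<lambda>x. h x * box_bump m l u x) \<in> borel_measurable (lebesgue_on \<Omega>)" for m
        by (intro borel_measurable_times[OF hm] continuous_measurable_lebesgue_on Ck_continuous[OF Ck_box_bump])
      show "AE x in lebesgue_on \<Omega>. (\<lambda>m. h x * box_bump m l u x) \<longlonglongrightarrow> h x * indicator (box l u) x"
        by (intro AE_I2 tendsto_mult tendsto_const box_bump_tendsto)
      show "AE x in lebesgue_on \<Omega>. norm (h x * box_bump m l u x) \<le> \<bar>h x * indicator (box l u) x\<bar>" for m
        using box_bump_bounds[of m l u] box_bump_zero[of _ l u m]
        by (intro AE_I2) (auto simp: abs_mult indicator_def mult_left_le)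
    qed
    then show ?thesis using z[OF test_box_bump[OF that]] by (simp add: LIMSEQ_const_iff)
  qed
  \<comment> \<open>Cutting h off to one box gives an integrable function on the whole space whose
    integrals over all boxes vanish, since intersections of boxes are boxes.\<close>
  have main: "AE x in lebesgue_on \<Omega>. x \<in> cbox l u \<longrightarrow> h x = 0" if sub: "cbox l u \<subseteq> \<Omega>" for l u
  proof -
    define f where "f x = indicator \<Omega> x *\<^sub>R (h x * indicator (box l u) x)" for x
    have "integrable lebesgue f"
      unfolding f_def using hi[of "box l u"] S
      by (subst integrable_restrict_space[symmetric]) auto
    moreover have "(LINT x|lebesgue. f x * indicator (box a b) x) = 0" for a b
    proof -
      obtain c d where cd: "box l u \<inter> box a b = box c d" by (rule that[OF box_Int_box])
      have "(LINT x|lebesgue. f x * indicator (box a b) x) =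
         (LINT x|lebesgue_on \<Omega>. h x * indicator (box c d) x)"
        unfolding f_def cd[symmetric] using S
        by (subst integral_restrict_space) (auto simp: indicator_inter_arith mult_ac intro!: Bochner_Integration.integral_cong)
      also have "\<dots> = 0"
      \<comment> \<open>Only for a nonempty open box is \<open>cbox c d\<close> its closure, and
        hence inside \<open>cbox l u\<close>; an empty one contributes 0.\<close>
      proof (cases "box c d = {}")
        case False
        then have "cbox c d \<subseteq> cbox l u"
          using cd box_subset_cbox[of l u] closure_minimal[of "box c d" "cbox l u"] by auto
        then show ?thesis using bz sub by blast
      qed simp
      finally show ?thesis .
    qed
    ultimately have "AE x in lebesgue. f x = 0" by (rule lebesgue_box_zero_AE)
    \<comment> \<open>The covering of \<Omega> consists of closed boxes, so the null boundary has to
      be discarded.\<close>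
    moreover have "AE x in lebesgue. x \<notin> cbox l u - box l u"
      using AE_not_in negligible_frontier_interval[of l u] unfolding negligible_iff_null_sets by blast
    ultimately have "AE x in lebesgue. x \<in> cbox l u \<longrightarrow> h x = 0"
      by eventually_elim (use sub in \<open>auto simp: f_def indicator_def split: if_splits\<close>)
    then have "AE x in lebesgue. x \<in> \<Omega> \<longrightarrow> (x \<in> cbox l u \<longrightarrow> h x = 0)"
      by eventually_elim simp
    then show ?thesis using S by (subst AE_restrict_space_iff) auto
  qed
  obtain D where D: "countable D" "\<And>X. X \<in> D \<Longrightarrow> \<exists>a b. X = cbox a b" "\<Union>D = \<Omega>"
    by (rule open_countable_Union_open_cbox[OF \<Omega>]) blast
  have "AE x in lebesgue_on \<Omega>. \<forall>X\<in>D. x \<in> X \<longrightarrow> h x = 0"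
  proof (subst AE_ball_countable[OF D(1)], intro ballI)
    fix X assume "X \<in> D"
    then obtain a b where "X = cbox a b" "X \<subseteq> \<Omega>" using D by blast
    then show "AE x in lebesgue_on \<Omega>. x \<in> X \<longrightarrow> h x = 0" using main by blast
  qed
  moreover have "AE x in lebesgue_on \<Omega>. x \<in> \<Omega>" by (rule AE_I2) (simp add: space_restrict_space)
  ultimately show ?thesis
    by eventually_elim (use D in blast)
qed

text \<open>No sign of c is assumed: c < 0 is refuted by a large t, c = 0 forces b = 0, and
  otherwise t = - b / c is the minimum. It serves the Cauchy-Schwarz inequalities for the energy
  form and for real integrals, and the eigenvector property of a maximizer.\<close>

lemma quadratic_nonneg_discriminant:
  fixes a b c :: real
  assumes "\<And>t. a + 2 * b * t + c * t\<^sup>2 \<ge> 0"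
  shows "b\<^sup>2 \<le> a * c"
proof (cases "c = 0")
  case True
  have "b = 0"
  proof (rule ccontr)
    assume "b \<noteq> 0"
    then have "a + 2 * b * (- (a + 1) / (2 * b)) = - 1" by (simp add: field_simps)
    then show False using assms[of "- (a + 1) / (2 * b)"] True by simp
  qed
  then show ?thesis using True by simp
next
  case False
  have "c \<ge> 0"
  proof (rule ccontr)
    assume "\<not> c \<ge> 0"
    \<comment> \<open>Large enough for the quadratic term to outweigh both the constant and the
      linear one.\<close>
    define t where "t = (2 * \<bar>b\<bar> + \<bar>a\<bar> + 1) / (- c) + 1"
    have t: "t \<ge> 1" "- c * t \<ge> 2 * \<bar>b\<bar> + \<bar>a\<bar> + 1"
      using \<open>\<not> c \<ge> 0\<close> by (auto simp: t_def field_simps)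
    have "2 * (\<bar>b\<bar> * t) + \<bar>a\<bar> * t + t \<le> - (c * t\<^sup>2)"
      using mult_right_mono[OF t(2), of t] t(1) by (simp add: algebra_simps power2_eq_square)
    moreover have "b * t \<le> \<bar>b\<bar> * t" "\<bar>a\<bar> * 1 \<le> \<bar>a\<bar> * t"
      using mult_right_mono[of b "\<bar>b\<bar>" t] mult_left_mono[of 1 t "\<bar>a\<bar>"] t(1) by auto
    moreover have "a + 2 * (b * t) + c * t\<^sup>2 \<ge> 0" using assms[of t] by (simp add: mult.assoc)
    ultimately show False using t(1) abs_ge_self[of a] by linarith
  qed
  with False have c: "c > 0" by simp
  have "a + 2 * b * (- b / c) + c * (- b / c)\<^sup>2 = a - b\<^sup>2 / c"
    using c by (simp add: power2_eq_square field_simps)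
  then have "b\<^sup>2 / c \<le> a" using assms[of "- b / c"] by simp
  then show ?thesis using c by (simp add: field_simps)
qed

section \<open>Algebra of weak gradients\<close>

lemma has_weak_gradient_L2: "has_weak_gradient \<Omega> u g \<Longrightarrow> g \<in> L2 \<Omega>"
  by (simp add: has_weak_gradient_def)

lemma has_weak_gradientD:
  "has_weak_gradient \<Omega> u g \<Longrightarrow> test_function \<Omega> \<phi> \<Longrightarrow> b \<in> Basis \<Longrightarrow>
   (LINT x|lebesgue_on \<Omega>. u x * (grad \<phi> x \<bullet> b)) = - (LINT x|lebesgue_on \<Omega>. (g x \<bullet> b) * \<phi> x)"
  by (simp add: has_weak_gradient_def)

lemma L2_inner_const: "f \<in> L2 \<Omega> \<Longrightarrow> (\<lambda>x. f x \<bullet> b) \<in> L2 \<Omega>" for b :: "'b::euclidean_space"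
proof -
  assume f: "f \<in> L2 \<Omega>"
  have "integrable (lebesgue_on \<Omega>) (\<lambda>x. (norm (f x \<bullet> b))\<^sup>2)"
  proof (rule Bochner_Integration.integrable_bound)
    show "integrable (lebesgue_on \<Omega>) (\<lambda>x. (norm (f x))\<^sup>2 * (norm b)\<^sup>2)" using f by (simp add: L2_def)
    have "(norm (f x \<bullet> b))\<^sup>2 \<le> (norm (f x))\<^sup>2 * (norm b)\<^sup>2" for x
      using power_mono[OF Cauchy_Schwarz_ineq2[of "f x" b], of 2] by (simp add: power_mult_distrib)
    then show "AE x in lebesgue_on \<Omega>. norm ((norm (f x \<bullet> b))\<^sup>2) \<le> norm ((norm (f x))\<^sup>2 * (norm b)\<^sup>2)"
      by (intro AE_I2) simp
  qed (use f in \<open>auto simp: L2_def\<close>)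
  then show ?thesis using f by (auto simp: L2_def)
qed

text \<open>Each component of the difference is annihilated by all test functions. This makes the
  choice in \<open>wgrad\<close> harmless.\<close>

lemma weak_gradient_unique:
  assumes \<Omega>: "open \<Omega>" and g: "has_weak_gradient \<Omega> u g" and g': "has_weak_gradient \<Omega> u g'"
  shows "AE x in lebesgue_on \<Omega>. g x = g' x"
proof -
  note L = g[THEN has_weak_gradient_L2] g'[THEN has_weak_gradient_L2]
  have "AE x in lebesgue_on \<Omega>. g x \<bullet> b - g' x \<bullet> b = 0" if b: "b \<in> Basis" for b
  proof (rule fundamental_lemma_calculus_of_variations[OF \<Omega>])
    show "(\<lambda>x. g x \<bullet> b - g' x \<bullet> b) \<in> L2 \<Omega>" by (intro L2_diff L2_inner_const L)
    fix \<phi> assume \<phi>: "test_function \<Omega> \<phi>"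
    note \<phi>2 = test_function_L2(1)[OF \<Omega> \<phi>]
    have i: "integrable (lebesgue_on \<Omega>) (\<lambda>x. (g x \<bullet> b) * \<phi> x)" "integrable (lebesgue_on \<Omega>) (\<lambda>x. (g' x \<bullet> b) * \<phi> x)"
      by (intro L2_mult L2_inner_const L \<phi>2)+
    have "(LINT x|lebesgue_on \<Omega>. u x * (grad \<phi> x \<bullet> b)) = - (LINT x|lebesgue_on \<Omega>. (g x \<bullet> b) * \<phi> x)"
      "(LINT x|lebesgue_on \<Omega>. u x * (grad \<phi> x \<bullet> b)) = - (LINT x|lebesgue_on \<Omega>. (g' x \<bullet> b) * \<phi> x)"
      by (rule has_weak_gradientD[OF g \<phi> b], rule has_weak_gradientD[OF g' \<phi> b])
    then have "(LINT x|lebesgue_on \<Omega>. (g x \<bullet> b) * \<phi> x) = (LINT x|lebesgue_on \<Omega>. (g' x \<bullet> b) * \<phi> x)"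
      by simp
    then show "(LINT x|lebesgue_on \<Omega>. (g x \<bullet> b - g' x \<bullet> b) * \<phi> x) = 0"
      using i by (simp add: left_diff_distrib)
  qed
  then have "AE x in lebesgue_on \<Omega>. \<forall>b\<in>Basis. g x \<bullet> b - g' x \<bullet> b = 0"
    by (subst AE_ball_countable) (auto intro: countable_finite)
  then show ?thesis
  proof eventually_elim
    case (elim x)
    show ?case by (rule euclidean_eqI) (use elim in simp)
  qed
qed

lemma has_weak_gradient_add:
  assumes \<Omega>: "open \<Omega>" and "u \<in> L2 \<Omega>" "v \<in> L2 \<Omega>" "has_weak_gradient \<Omega> u g" "has_weak_gradient \<Omega> v k"
  shows "has_weak_gradient \<Omega> (\<lambda>x. u x + v x) (\<lambda>x. g x + k x)"
  unfolding has_weak_gradient_def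
proof (intro conjI allI impI ballI)
  note L = assms(4,5)[THEN has_weak_gradient_L2]
  show "(\<lambda>x. g x + k x) \<in> L2 \<Omega>" by (intro L2_add L)
  fix \<phi> b assume \<phi>: "test_function \<Omega> \<phi>" and b: "b \<in> (Basis :: 'a set)"
  note \<phi>2 = test_function_L2[OF \<Omega> \<phi>]
  have i: "integrable (lebesgue_on \<Omega>) (\<lambda>x. (g x \<bullet> b) * \<phi> x)" "integrable (lebesgue_on \<Omega>) (\<lambda>x. (k x \<bullet> b) * \<phi> x)"
    "integrable (lebesgue_on \<Omega>) (\<lambda>x. u x * (grad \<phi> x \<bullet> b))" "integrable (lebesgue_on \<Omega>) (\<lambda>x. v x * (grad \<phi> x \<bullet> b))"
    by (intro L2_mult L2_inner_const L \<phi>2 assms)+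
  have "(LINT x|lebesgue_on \<Omega>. u x * (grad \<phi> x \<bullet> b)) = - (LINT x|lebesgue_on \<Omega>. (g x \<bullet> b) * \<phi> x)"
    "(LINT x|lebesgue_on \<Omega>. v x * (grad \<phi> x \<bullet> b)) = - (LINT x|lebesgue_on \<Omega>. (k x \<bullet> b) * \<phi> x)"
    by (rule has_weak_gradientD[OF assms(4) \<phi> b], rule has_weak_gradientD[OF assms(5) \<phi> b])
  then show "(LINT x|lebesgue_on \<Omega>. (u x + v x) * (grad \<phi> x \<bullet> b)) = - (LINT x|lebesgue_on \<Omega>. ((g x + k x) \<bullet> b) * \<phi> x)"
    using i by (simp add: inner_add_left distrib_right)
qed

lemma has_weak_gradient_cmult:
  assumes "has_weak_gradient \<Omega> u g"
  shows "has_weak_gradient \<Omega> (\<lambda>x. c * u x) (\<lambda>x. c *\<^sub>R g x)"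
  using assms unfolding has_weak_gradient_def
  by (auto simp: L2_scaleR mult.assoc)

text \<open>Stated as an equality of predicates, so that the choice operator in \<open>wgrad\<close>
  returns the very same function for both arguments.\<close>

lemma has_weak_gradient_cong:
  assumes "AE x in lebesgue_on \<Omega>. u x = v x" "u \<in> borel_measurable (lebesgue_on \<Omega>)" "v \<in> borel_measurable (lebesgue_on \<Omega>)"
  shows "has_weak_gradient \<Omega> u = has_weak_gradient \<Omega> v"
proof -
  have "(LINT x|lebesgue_on \<Omega>. u x * (grad \<phi> x \<bullet> b)) = (LINT x|lebesgue_on \<Omega>. v x * (grad \<phi> x \<bullet> b))"
    if "test_function \<Omega> \<phi>" for \<phi> b
    by (rule integral_cong_AE)
       (use assms continuous_measurable_lebesgue_on[OF continuous_grad[OF test_function_Ck[OF that]]] in auto)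
  then show ?thesis unfolding has_weak_gradient_def by (auto simp: fun_eq_iff)
qed

lemma wgrad: "u \<in> H1 \<Omega> \<Longrightarrow> has_weak_gradient \<Omega> u (wgrad \<Omega> u)"
  unfolding H1_def wgrad_def by (auto intro: someI[of "has_weak_gradient \<Omega> u"])

lemma wgrad_L2: "u \<in> H1 \<Omega> \<Longrightarrow> wgrad \<Omega> u \<in> L2 \<Omega>"
  using wgrad has_weak_gradient_L2 by blast

lemma H1_L2: "u \<in> H1 \<Omega> \<Longrightarrow> u \<in> L2 \<Omega>"
  by (simp add: H1_def)

lemma H1I: "u \<in> L2 \<Omega> \<Longrightarrow> has_weak_gradient \<Omega> u g \<Longrightarrow> u \<in> H1 \<Omega>"
  by (auto simp: H1_def)

lemma wgrad_eqI: "open \<Omega> \<Longrightarrow> u \<in> L2 \<Omega> \<Longrightarrow> has_weak_gradient \<Omega> u g \<Longrightarrow> AE x in lebesgue_on \<Omega>. wgrad \<Omega> u x = g x"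
  by (rule weak_gradient_unique[OF _ wgrad[OF H1I]])

lemma H1_add: "open \<Omega> \<Longrightarrow> u \<in> H1 \<Omega> \<Longrightarrow> v \<in> H1 \<Omega> \<Longrightarrow> (\<lambda>x. u x + v x) \<in> H1 \<Omega>"
  by (rule H1I[OF L2_add has_weak_gradient_add[OF _ _ _ wgrad wgrad]]) (auto simp: H1_L2)

lemma H1_cmult: "u \<in> H1 \<Omega> \<Longrightarrow> (\<lambda>x. c * u x) \<in> H1 \<Omega>"
  by (rule H1I[OF L2_cmult has_weak_gradient_cmult[OF wgrad]]) (auto simp: H1_L2)

lemma wgrad_add: "open \<Omega> \<Longrightarrow> u \<in> H1 \<Omega> \<Longrightarrow> v \<in> H1 \<Omega> \<Longrightarrow>
   AE x in lebesgue_on \<Omega>. wgrad \<Omega> (\<lambda>x. u x + v x) x = wgrad \<Omega> u x + wgrad \<Omega> v x"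
  by (rule wgrad_eqI[OF _ L2_add has_weak_gradient_add[OF _ _ _ wgrad wgrad]]) (auto simp: H1_L2)

lemma wgrad_cmult: "open \<Omega> \<Longrightarrow> u \<in> H1 \<Omega> \<Longrightarrow>
   AE x in lebesgue_on \<Omega>. wgrad \<Omega> (\<lambda>x. c * u x) x = c *\<^sub>R wgrad \<Omega> u x"
  by (rule wgrad_eqI[OF _ L2_cmult has_weak_gradient_cmult[OF wgrad]]) (auto simp: H1_L2)

section \<open>Integration by parts for test functions\<close>

lemma lebesgue_integral_translation:
  fixes f :: "'a::euclidean_space \<Rightarrow> real"
  assumes "f \<in> borel_measurable borel"
  shows "(LINT x|lborel. f (c + x)) = (LINT x|lborel. f x)"
  by (subst (2) lborel_distr_plus[symmetric, of c], subst integral_distr) (use assms in auto)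

lemma lebesgue_on_test_integral:
  fixes f :: "'a::euclidean_space \<Rightarrow> real"
  assumes "open \<Omega>" "continuous_on UNIV f" "\<And>x. x \<notin> \<Omega> \<Longrightarrow> f x = 0"
  shows "(LINT x|lebesgue_on \<Omega>. f x) = (LINT x|lborel. f x)"
proof -
  have "(LINT x|lebesgue_on \<Omega>. f x) = (LINT x|lebesgue. indicator \<Omega> x *\<^sub>R f x)"
    using assms(1) by (subst integral_restrict_space) auto
  also have "\<dots> = (LINT x|lebesgue. f x)"
    using assms(3) by (intro Bochner_Integration.integral_cong) (auto simp: indicator_def)
  also have "\<dots> = (LINT x|lborel. f x)"
    using assms(2) by (intro integral_completion) (auto intro: borel_measurable_continuous_onI)
  finally show ?thesis .
qed

lemma integrable_continuous_compact_support:
  fixes f :: "'a::euclidean_space \<Rightarrow> real"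
  assumes "continuous_on UNIV f" "compact K" "\<And>x. x \<notin> K \<Longrightarrow> f x = 0"
  shows "integrable lborel f"
proof -
  have "integrable lborel (\<lambda>x. indicator K x *\<^sub>R f x)"
    by (rule borel_integrable_compact[OF assms(2)]) (use assms(1) continuous_on_subset in blast)
  also have "(\<lambda>x. indicator K x *\<^sub>R f x) = f"
    by (intro ext) (auto simp: indicator_def intro: assms(3))
  finally show ?thesis .
qed

text \<open>Difference quotients integrate to 0 by translation invariance, and dominated convergence
  passes to the derivative.\<close>

lemma test_function_integral_derivative:
  assumes \<phi>: "test_function UNIV \<phi>" and b: "b \<in> Basis"
  shows "(LINT x|lborel. grad \<phi> x \<bullet> b) = 0"
proof -
  obtain K where K: "compact K" "\<And>x. x \<notin> K \<Longrightarrow> \<phi> x = 0 \<and> grad \<phi> x = 0"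
    using test_function_supp[OF \<phi>] by blast
  obtain C where C: "C \<ge> 0" "\<And>x. \<bar>\<phi> x\<bar> \<le> C \<and> norm (grad \<phi> x) \<le> C"
    using test_function_bounded[OF \<phi>] by blast
  have c: "continuous_on UNIV \<phi>" "continuous_on UNIV (grad \<phi>)"
    using test_function_Ck[OF \<phi>] by (auto intro: Ck_continuous continuous_grad)
  obtain R where R: "\<And>x. x \<in> K \<Longrightarrow> norm x \<le> R" using compact_imp_bounded[OF K(1)] bounded_iff by blast
  define h where "h n = inverse (real (Suc n))" for n
  have h: "0 < h n" "h n \<le> 1" for n by (auto simp: h_def field_simps)
  have h0: "h \<longlonglongrightarrow> 0" unfolding h_def by (rule LIMSEQ_inverse_real_of_nat)
  define q where "q n x = (\<phi> (h n *\<^sub>R b + x) - \<phi> x) / h n" for n x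
  have der: "((\<lambda>t. \<phi> (t *\<^sub>R b + x)) has_real_derivative (grad \<phi> (t *\<^sub>R b + x) \<bullet> b)) (at t)" for t x
    unfolding has_field_derivative_def
    by (rule has_derivative_eq_rhs, rule has_derivative_compose[of "\<lambda>t. t *\<^sub>R b + x" "\<lambda>s. s *\<^sub>R b" t UNIV \<phi>])
       (auto intro!: derivative_eq_intros has_derivative_grad test_function_Ck[OF \<phi>] simp: inner_commute mult.commute)
  have i\<phi>: "integrable lborel \<phi>" by (rule integrable_continuous_compact_support[OF c(1) K(1)]) (use K in auto)
  have qm: "continuous_on UNIV (q n)" for n
    unfolding q_def by (intro continuous_intros continuous_on_compose2[OF c(1)]) (auto simp: h less_imp_neq[OF h(1), symmetric])
  have z: "(LINT x|lborel. q n x) = 0" for n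
  proof -
    have "integrable lborel (\<lambda>x. \<phi> (h n *\<^sub>R b + x))"
    proof (rule integrable_continuous_compact_support[where K="(\<lambda>x. x - h n *\<^sub>R b) ` K"])
      show "continuous_on UNIV (\<lambda>x. \<phi> (h n *\<^sub>R b + x))"
        by (intro continuous_on_compose2[OF c(1)] continuous_intros) auto
      show "compact ((\<lambda>x. x - h n *\<^sub>R b) ` K)" by (intro compact_translation_subtract K)
      fix x assume x: "x \<notin> (\<lambda>x. x - h n *\<^sub>R b) ` K"
      have "h n *\<^sub>R b + x \<notin> K"
      proof
        assume "h n *\<^sub>R b + x \<in> K"
        then have "(h n *\<^sub>R b + x) - h n *\<^sub>R b \<in> (\<lambda>x. x - h n *\<^sub>R b) ` K" by (rule imageI)
        with x show False by simp
      qed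
      then show "\<phi> (h n *\<^sub>R b + x) = 0" using K(2) by blast
    qed
    then show ?thesis
      using lebesgue_integral_translation[of \<phi> "h n *\<^sub>R b"] i\<phi> c(1)
      by (simp add: q_def borel_measurable_continuous_onI)
  qed
  have "(\<lambda>n. LINT x|lborel. q n x) \<longlonglongrightarrow> (LINT x|lborel. grad \<phi> x \<bullet> b)"
  \<comment> \<open>The mean value theorem bounds the quotients by C; since the steps are at most 1,
    their supports stay within distance 1 of the support of \<phi>.\<close>
  proof (rule integral_dominated_convergence[where w="\<lambda>x. C * indicator (cball 0 (R + 1)) x"])
    show "(\<lambda>x. grad \<phi> x \<bullet> b) \<in> borel_measurable lborel"
      using c by (auto intro!: borel_measurable_continuous_onI continuous_intros)
    show "q n \<in> borel_measurable lborel" for n using qm by (simp add: borel_measurable_continuous_onI)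
    show "integrable lborel (\<lambda>x. C * indicator (cball 0 (R + 1)) (x::'a))"
      by (intro integrable_mult_right integrable_real_indicator) (use emeasure_lborel_cball_finite[of "0::'a" "R + 1"] in auto)
    show "AE x in lborel. (\<lambda>n. q n x) \<longlonglongrightarrow> grad \<phi> x \<bullet> b"
    proof (rule AE_I2)
      fix x
      have "filterlim h (at 0) sequentially"
        using h0 h(1) by (auto simp: filterlim_at less_imp_neq[symmetric])
      moreover have "((\<lambda>t. (\<phi> (t *\<^sub>R b + x) - \<phi> x) / t) \<longlongrightarrow> grad \<phi> x \<bullet> b) (at 0)"
        using der[of x 0] by (simp add: DERIV_def)
      ultimately show "(\<lambda>n. q n x) \<longlonglongrightarrow> grad \<phi> x \<bullet> b"
        unfolding q_def by (rule filterlim_compose[rotated])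
    qed
    show "AE x in lborel. norm (q n x) \<le> C * indicator (cball 0 (R + 1)) x" for n
    proof (rule AE_I2)
      fix x
      show "norm (q n x) \<le> C * indicator (cball 0 (R + 1)) x"
      proof (cases "x \<in> cball 0 (R + 1)")
        case True
        obtain t where "\<phi> (h n *\<^sub>R b + x) - \<phi> (0 *\<^sub>R b + x) = (h n - 0) * (grad \<phi> (t *\<^sub>R b + x) \<bullet> b)"
          using MVT2[OF h(1)[of n] der[of x]] by blast
        then have "q n x = grad \<phi> (t *\<^sub>R b + x) \<bullet> b" using h(1)[of n] by (simp add: q_def)
        also have "\<bar>\<dots>\<bar> \<le> C"
          using Cauchy_Schwarz_ineq2[of "grad \<phi> (t *\<^sub>R b + x)" b] C(2)[of "t *\<^sub>R b + x"] b by (simp add: norm_Basis)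
        finally show ?thesis using True by simp
      next
        case False
        then have x: "norm x > R + 1" by simp
        have "norm x \<le> norm (h n *\<^sub>R b + x) + norm (h n *\<^sub>R b)"
          using norm_triangle_ineq4[of "h n *\<^sub>R b + x" "h n *\<^sub>R b"] by simp
        also have "norm (h n *\<^sub>R b) \<le> 1" using h[of n] b by (simp add: norm_Basis)
        finally have "norm (h n *\<^sub>R b + x) > R" using x by simp
        then have "x \<notin> K" "h n *\<^sub>R b + x \<notin> K" using R[of x] R[of "h n *\<^sub>R b + x"] x norm_ge_zero[of x] by auto
        then show ?thesis using K(2) False by (simp add: q_def)
      qed
    qed
  qed
  then show ?thesis by (simp add: z LIMSEQ_const_iff)
qed

text \<open>The derivative of the product \<open>\<psi> x * \<phi> x\<close> integrates to 0. Only
  \<phi> has its support in \<Omega>; \<psi> may reach beyond it.\<close>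

lemma has_weak_gradient_test:
  assumes \<Omega>: "open \<Omega>" and \<psi>: "test_function UNIV \<psi>"
  shows "has_weak_gradient \<Omega> \<psi> (grad \<psi>)"
  unfolding has_weak_gradient_def
proof (intro conjI allI impI ballI)
  show "grad \<psi> \<in> L2 \<Omega>" by (rule test_function_L2(2)[OF \<Omega> \<psi>])
  fix \<phi> b assume \<phi>: "test_function \<Omega> \<phi>" and b: "b \<in> (Basis :: 'a set)"
  obtain K where K: "K \<subseteq> \<Omega>" "compact K" "\<And>x. x \<notin> K \<Longrightarrow> \<phi> x = 0 \<and> grad \<phi> x = 0"
    using test_function_supp[OF \<phi>] by blast
  note Ck = test_function_Ck[OF \<psi>] test_function_Ck[OF \<phi>]
  have c: "continuous_on UNIV (\<lambda>x. \<psi> x * (grad \<phi> x \<bullet> b))" "continuous_on UNIV (\<lambda>x. (grad \<psi> x \<bullet> b) * \<phi> x)"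
    using Ck_continuous[OF Ck(1)] Ck_continuous[OF Ck(2)] continuous_grad[OF Ck(1)] continuous_grad[OF Ck(2)]
    by (auto intro!: continuous_intros)
  have i: "integrable lborel (\<lambda>x. \<psi> x * (grad \<phi> x \<bullet> b))" "integrable lborel (\<lambda>x. (grad \<psi> x \<bullet> b) * \<phi> x)"
    by (rule integrable_continuous_compact_support[OF _ K(2)], use c K in auto)+
  have "test_function UNIV (\<lambda>x. \<psi> x * \<phi> x)"
    by (rule test_function_mult[OF \<psi> Ck(2)])
  from test_function_integral_derivative[OF this b]
  have "(LINT x|lborel. \<psi> x * (grad \<phi> x \<bullet> b) + (grad \<psi> x \<bullet> b) * \<phi> x) = 0"
    by (simp only: grad_mult[OF Ck] inner_add_left inner_scaleR_left mult.commute[of "\<phi> _"])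
  then have "(LINT x|lborel. \<psi> x * (grad \<phi> x \<bullet> b)) + (LINT x|lborel. (grad \<psi> x \<bullet> b) * \<phi> x) = 0"
    using i by simp
  moreover have "x \<notin> \<Omega> \<Longrightarrow> \<phi> x = 0 \<and> grad \<phi> x = 0" for x using K by blast
  ultimately show "(LINT x|lebesgue_on \<Omega>. \<psi> x * (grad \<phi> x \<bullet> b)) = - (LINT x|lebesgue_on \<Omega>. (grad \<psi> x \<bullet> b) * \<phi> x)"
    by (subst (1 2) lebesgue_on_test_integral[OF \<Omega>]) (use c in auto)
qed

lemma test_function_H1: assumes "open \<Omega>" "test_function \<Omega> \<phi>" shows "\<phi> \<in> H1 \<Omega>"
  by (rule H1I[OF test_function_L2(1)[OF assms]
        has_weak_gradient_test[OF assms(1) test_function_mono[OF assms(2) subset_UNIV]]])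

lemma wgrad_test:
  assumes "open \<Omega>" "test_function \<Omega> \<phi>"
  shows "AE x in lebesgue_on \<Omega>. wgrad \<Omega> \<phi> x = grad \<phi> x"
  by (rule wgrad_eqI[OF assms(1) test_function_L2(1)[OF assms]
        has_weak_gradient_test[OF assms(1) test_function_mono[OF assms(2) subset_UNIV]]])

text \<open>The inner product behind the quadratic part of the energy. With \<open>lam = 1\<close>
  its diagonal is the squared \<open>H1_norm\<close>, so one set of lemmas serves both.\<close>

definition energy_form :: "'a::euclidean_space set \<Rightarrow> real \<Rightarrow> ('a \<Rightarrow> real) \<Rightarrow> ('a \<Rightarrow> real) \<Rightarrow> real" where
  "energy_form \<Omega> lam u v = (LINT x|lebesgue_on \<Omega>. wgrad \<Omega> u x \<bullet> wgrad \<Omega> v x + lam * (u x * v x))"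

lemma energy_form_integrable:
  assumes "u \<in> H1 \<Omega>" "v \<in> H1 \<Omega>"
  shows "integrable (lebesgue_on \<Omega>) (\<lambda>x. wgrad \<Omega> u x \<bullet> wgrad \<Omega> v x + lam * (u x * v x))"
  by (intro Bochner_Integration.integrable_add integrable_mult_right L2_inner L2_mult wgrad_L2 H1_L2 assms)

lemma H1_measurable:
  assumes "u \<in> H1 \<Omega>"
  shows "u \<in> borel_measurable (lebesgue_on \<Omega>)" "wgrad \<Omega> u \<in> borel_measurable (lebesgue_on \<Omega>)"
  using wgrad_L2[OF assms] H1_L2[OF assms] by (auto simp: L2_def)

lemma energy_form_commute: "energy_form \<Omega> lam u v = energy_form \<Omega> lam v u"
  by (simp add: energy_form_def inner_commute mult.commute)

lemma energy_form_self: "energy_form \<Omega> lam u u = (LINT x|lebesgue_on \<Omega>. (norm (wgrad \<Omega> u x))\<^sup>2 + lam * (u x)\<^sup>2)"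
  by (simp add: energy_form_def power2_norm_eq_inner power2_eq_square[of "u _"])

lemma energy_form_nonneg: "lam \<ge> 0 \<Longrightarrow> energy_form \<Omega> lam u u \<ge> 0"
  unfolding energy_form_self by (intro integral_nonneg_AE AE_I2) auto

lemma energy_form_add_left:
  assumes "open \<Omega>" "u \<in> H1 \<Omega>" "v \<in> H1 \<Omega>" "w \<in> H1 \<Omega>"
  shows "energy_form \<Omega> lam (\<lambda>x. u x + v x) w = energy_form \<Omega> lam u w + energy_form \<Omega> lam v w"
proof -
  note uv = H1_add[OF assms(1-3)]
  have "energy_form \<Omega> lam (\<lambda>x. u x + v x) w = (LINT x|lebesgue_on \<Omega>.
      (wgrad \<Omega> u x \<bullet> wgrad \<Omega> w x + lam * (u x * w x)) + (wgrad \<Omega> v x \<bullet> wgrad \<Omega> w x + lam * (v x * w x)))"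
    unfolding energy_form_def
  proof (rule integral_cong_AE)
    show "AE x in lebesgue_on \<Omega>. wgrad \<Omega> (\<lambda>x. u x + v x) x \<bullet> wgrad \<Omega> w x + lam * ((u x + v x) * w x) =
      (wgrad \<Omega> u x \<bullet> wgrad \<Omega> w x + lam * (u x * w x)) + (wgrad \<Omega> v x \<bullet> wgrad \<Omega> w x + lam * (v x * w x))"
      using wgrad_add[OF assms(1-3)] by eventually_elim (simp add: inner_add_left algebra_simps)
  qed (use H1_measurable[OF uv] H1_measurable[OF assms(2)] H1_measurable[OF assms(3)] H1_measurable[OF assms(4)] in measurable)
  also have "\<dots> = energy_form \<Omega> lam u w + energy_form \<Omega> lam v w"
    unfolding energy_form_def by (intro Bochner_Integration.integral_add energy_form_integrable assms)
  finally show ?thesis .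
qed

lemma energy_form_cmult_left:
  assumes "open \<Omega>" "u \<in> H1 \<Omega>" "w \<in> H1 \<Omega>"
  shows "energy_form \<Omega> lam (\<lambda>x. c * u x) w = c * energy_form \<Omega> lam u w"
proof -
  note cu = H1_cmult[OF assms(2), of c]
  have "energy_form \<Omega> lam (\<lambda>x. c * u x) w = (LINT x|lebesgue_on \<Omega>. c * (wgrad \<Omega> u x \<bullet> wgrad \<Omega> w x + lam * (u x * w x)))"
    unfolding energy_form_def
  proof (rule integral_cong_AE)
    show "AE x in lebesgue_on \<Omega>. wgrad \<Omega> (\<lambda>x. c * u x) x \<bullet> wgrad \<Omega> w x + lam * (c * u x * w x) =
      c * (wgrad \<Omega> u x \<bullet> wgrad \<Omega> w x + lam * (u x * w x))"
      using wgrad_cmult[OF assms(1,2), of c] by eventually_elim (simp add: algebra_simps)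
  qed (use H1_measurable[OF cu] H1_measurable[OF assms(2)] H1_measurable[OF assms(3)] in measurable)
  then show ?thesis by (simp add: energy_form_def)
qed

lemma energy_form_add_right:
  assumes "open \<Omega>" "u \<in> H1 \<Omega>" "v \<in> H1 \<Omega>" "w \<in> H1 \<Omega>"
  shows "energy_form \<Omega> lam w (\<lambda>x. u x + v x) = energy_form \<Omega> lam w u + energy_form \<Omega> lam w v"
  using energy_form_add_left[OF assms] by (simp add: energy_form_commute)

lemma energy_form_cmult_right:
  assumes "open \<Omega>" "u \<in> H1 \<Omega>" "w \<in> H1 \<Omega>"
  shows "energy_form \<Omega> lam w (\<lambda>x. c * u x) = c * energy_form \<Omega> lam w u"
  using energy_form_cmult_left[OF assms] by (simp add: energy_form_commute)

text \<open>This expansion is the source of the Cauchy-Schwarz inequality, of the second variation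
  and of the minimality argument for \<open>U\<close>.\<close>

lemma energy_form_line:
  assumes "open \<Omega>" "u \<in> H1 \<Omega>" "v \<in> H1 \<Omega>"
  shows "energy_form \<Omega> lam (\<lambda>x. u x + t * v x) (\<lambda>x. u x + t * v x) =
    energy_form \<Omega> lam u u + 2 * energy_form \<Omega> lam u v * t + energy_form \<Omega> lam v v * t\<^sup>2"
  using assms H1_cmult[OF assms(3), of t]
  by (simp add: energy_form_add_left energy_form_add_right energy_form_cmult_left energy_form_cmult_right H1_add energy_form_commute[of \<Omega> lam v u]
      power2_eq_square algebra_simps)

lemma energy_form_Cauchy_Schwarz:
  assumes "open \<Omega>" "u \<in> H1 \<Omega>" "v \<in> H1 \<Omega>" "lam \<ge> 0"
  shows "(energy_form \<Omega> lam u v)\<^sup>2 \<le> energy_form \<Omega> lam u u * energy_form \<Omega> lam v v"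
  by (rule quadratic_nonneg_discriminant) (simp add: energy_form_line[OF assms(1-3), symmetric] energy_form_nonneg assms(4))

text \<open>The parallelogram law with the norm of the difference dropped: a triangle inequality for
  squared norms, without square roots.\<close>

lemma energy_form_add_le:
  assumes "open \<Omega>" "u \<in> H1 \<Omega>" "v \<in> H1 \<Omega>" "lam \<ge> 0"
  shows "energy_form \<Omega> lam (\<lambda>x. u x + v x) (\<lambda>x. u x + v x) \<le> 2 * energy_form \<Omega> lam u u + 2 * energy_form \<Omega> lam v v"
proof -
  have "energy_form \<Omega> lam (\<lambda>x. u x + -1 * v x) (\<lambda>x. u x + -1 * v x) \<ge> 0"
    by (rule energy_form_nonneg[OF assms(4)])
  then show ?thesis using energy_form_line[OF assms(1-3), of lam 1] energy_form_line[OF assms(1-3), of lam "-1"]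
    by simp
qed

lemma energy_form_cong:
  assumes "open \<Omega>" "u \<in> H1 \<Omega>" "u' \<in> H1 \<Omega>" "v \<in> H1 \<Omega>" "AE x in lebesgue_on \<Omega>. u x = u' x"
  shows "energy_form \<Omega> lam u v = energy_form \<Omega> lam u' v"
proof -
  have "wgrad \<Omega> u = wgrad \<Omega> u'"
    using has_weak_gradient_cong[OF assms(5)] assms(2,3) by (simp add: wgrad_def H1_measurable)
  then show ?thesis
    unfolding energy_form_def
  proof (intro integral_cong_AE)
    show "AE x in lebesgue_on \<Omega>. wgrad \<Omega> u x \<bullet> wgrad \<Omega> v x + lam * (u x * v x) =
       wgrad \<Omega> u' x \<bullet> wgrad \<Omega> v x + lam * (u' x * v x)"
      using assms(5) by eventually_elim (simp add: \<open>wgrad \<Omega> u = wgrad \<Omega> u'\<close>)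
  qed (use H1_measurable[OF assms(2)] H1_measurable[OF assms(3)] H1_measurable[OF assms(4)] in auto)
qed

section \<open>The closure of the test functions in the Sobolev norm\<close>

lemma H1_norm_energy_form: "H1_norm \<Omega> u = sqrt (energy_form \<Omega> 1 u u)"
  by (simp add: H1_norm_def energy_form_self)

lemma H1_diff: "open \<Omega> \<Longrightarrow> u \<in> H1 \<Omega> \<Longrightarrow> v \<in> H1 \<Omega> \<Longrightarrow> (\<lambda>x. u x - v x) \<in> H1 \<Omega>"
  using H1_add[of \<Omega> u "\<lambda>x. -1 * v x"] H1_cmult[of v \<Omega> "-1"] by simp

text \<open>Membership in the closure of the test functions, phrased with squared norms. Both
  branches of the definition of \<open>H\<close> lead to it: the closure \<open>H10\<close>
  directly, the radial functions on the whole space through density.\<close>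

definition approximable :: "'a::euclidean_space set \<Rightarrow> ('a \<Rightarrow> real) \<Rightarrow> bool" where
  "approximable \<Omega> u \<longleftrightarrow> u \<in> H1 \<Omega> \<and> (\<forall>\<epsilon>>0. \<exists>\<phi>. test_function \<Omega> \<phi> \<and>
     energy_form \<Omega> 1 (\<lambda>x. u x - \<phi> x) (\<lambda>x. u x - \<phi> x) < \<epsilon>)"

lemma approximable_H1: "approximable \<Omega> u \<Longrightarrow> u \<in> H1 \<Omega>"
  by (simp add: approximable_def)

lemma H10_eq_approximable: "H10 \<Omega> = {u. approximable \<Omega> u}"
proof -
  have "(\<forall>\<epsilon>>0. \<exists>\<phi>. test_function \<Omega> \<phi> \<and> H1_norm \<Omega> (u - \<phi>) < \<epsilon>) \<longleftrightarrow>
    (\<forall>\<epsilon>>0. \<exists>\<phi>. test_function \<Omega> \<phi> \<and> energy_form \<Omega> 1 (\<lambda>x. u x - \<phi> x) (\<lambda>x. u x - \<phi> x) < \<epsilon>)"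
    (is "?l \<longleftrightarrow> ?r") for u :: "'a \<Rightarrow> real"
  proof
    assume l: ?l
    show ?r
    proof (intro allI impI)
      fix \<epsilon> :: real assume "\<epsilon> > 0"
      then obtain \<phi> where "test_function \<Omega> \<phi>" "H1_norm \<Omega> (u - \<phi>) < sqrt \<epsilon>" using l real_sqrt_gt_zero by blast
      then show "\<exists>\<phi>. test_function \<Omega> \<phi> \<and> energy_form \<Omega> 1 (\<lambda>x. u x - \<phi> x) (\<lambda>x. u x - \<phi> x) < \<epsilon>"
        by (intro exI[of _ \<phi>]) (simp add: H1_norm_energy_form fun_diff_def)
    qed
  next
    assume r: ?r
    show ?l
    proof (intro allI impI)
      fix \<epsilon> :: real assume e: "\<epsilon> > 0"
      then obtain \<phi> where "test_function \<Omega> \<phi>" "energy_form \<Omega> 1 (\<lambda>x. u x - \<phi> x) (\<lambda>x. u x - \<phi> x) < \<epsilon>\<^sup>2"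
        using r zero_less_power by blast
      then show "\<exists>\<phi>. test_function \<Omega> \<phi> \<and> H1_norm \<Omega> (u - \<phi>) < \<epsilon>"
        using e by (intro exI[of _ \<phi>]) (simp add: H1_norm_energy_form fun_diff_def real_less_lsqrt)
    qed
  qed
  then show ?thesis by (auto simp: H10_def approximable_def)
qed

lemma approximable_add:
  assumes "open \<Omega>" "approximable \<Omega> u" "approximable \<Omega> v"
  shows "approximable \<Omega> (\<lambda>x. u x + v x)"
  unfolding approximable_def
proof (intro conjI allI impI)
  note H = assms(2,3)[THEN approximable_H1]
  show "(\<lambda>x. u x + v x) \<in> H1 \<Omega>" by (intro H1_add assms(1) H)
  fix \<epsilon> :: real assume e: "\<epsilon> > 0"
  obtain \<phi> where \<phi>: "test_function \<Omega> \<phi>" "energy_form \<Omega> 1 (\<lambda>x. u x - \<phi> x) (\<lambda>x. u x - \<phi> x) < \<epsilon> / 4"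
    using assms(2) e unfolding approximable_def by (meson divide_pos_pos zero_less_numeral)
  obtain \<psi> where \<psi>: "test_function \<Omega> \<psi>" "energy_form \<Omega> 1 (\<lambda>x. v x - \<psi> x) (\<lambda>x. v x - \<psi> x) < \<epsilon> / 4"
    using assms(3) e unfolding approximable_def by (meson divide_pos_pos zero_less_numeral)
  have "energy_form \<Omega> 1 (\<lambda>x. (u x - \<phi> x) + (v x - \<psi> x)) (\<lambda>x. (u x - \<phi> x) + (v x - \<psi> x)) < \<epsilon>"
    using energy_form_add_le[OF assms(1) H1_diff[OF assms(1) H(1) test_function_H1[OF assms(1) \<phi>(1)]]
       H1_diff[OF assms(1) H(2) test_function_H1[OF assms(1) \<psi>(1)]], of 1] \<phi>(2) \<psi>(2) by simp
  moreover have "(\<lambda>x. (u x - \<phi> x) + (v x - \<psi> x)) = (\<lambda>x. u x + v x - (\<phi> x + \<psi> x))" by auto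
  ultimately show "\<exists>\<phi>. test_function \<Omega> \<phi> \<and> energy_form \<Omega> 1 (\<lambda>x. u x + v x - \<phi> x) (\<lambda>x. u x + v x - \<phi> x) < \<epsilon>"
    using test_function_add[OF \<phi>(1) \<psi>(1)] by (intro exI[of _ "\<lambda>x. \<phi> x + \<psi> x"]) simp
qed

lemma approximable_cmult:
  assumes "open \<Omega>" "approximable \<Omega> u"
  shows "approximable \<Omega> (\<lambda>x. c * u x)"
  unfolding approximable_def
proof (intro conjI allI impI)
  note H = assms(2)[THEN approximable_H1]
  show "(\<lambda>x. c * u x) \<in> H1 \<Omega>" by (rule H1_cmult[OF H])
  fix \<epsilon> :: real assume e: "\<epsilon> > 0"
  have "\<epsilon> / (c\<^sup>2 + 1) > 0" using e by (simp add: add_nonneg_pos)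
  then obtain \<phi> where \<phi>: "test_function \<Omega> \<phi>" "energy_form \<Omega> 1 (\<lambda>x. u x - \<phi> x) (\<lambda>x. u x - \<phi> x) < \<epsilon> / (c\<^sup>2 + 1)"
    using assms(2) unfolding approximable_def by blast
  note D = H1_diff[OF assms(1) H test_function_H1[OF assms(1) \<phi>(1)]]
  have "(\<lambda>x. c * u x - c * \<phi> x) = (\<lambda>x. c * (u x - \<phi> x))" by (simp add: algebra_simps)
  then have "energy_form \<Omega> 1 (\<lambda>x. c * u x - c * \<phi> x) (\<lambda>x. c * u x - c * \<phi> x) = c\<^sup>2 * energy_form \<Omega> 1 (\<lambda>x. u x - \<phi> x) (\<lambda>x. u x - \<phi> x)"
    using energy_form_cmult_left[OF assms(1) D H1_cmult[OF D], of 1 c c] energy_form_cmult_right[OF assms(1) D D, of 1 c]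
    by (simp add: power2_eq_square)
  also have "\<dots> \<le> (c\<^sup>2 + 1) * energy_form \<Omega> 1 (\<lambda>x. u x - \<phi> x) (\<lambda>x. u x - \<phi> x)"
    by (intro mult_right_mono energy_form_nonneg) auto
  also have "\<dots> < \<epsilon>" using \<phi>(2) by (simp add: pos_less_divide_eq add_nonneg_pos mult.commute)
  finally show "\<exists>\<phi>. test_function \<Omega> \<phi> \<and> energy_form \<Omega> 1 (\<lambda>x. c * u x - \<phi> x) (\<lambda>x. c * u x - \<phi> x) < \<epsilon>"
    using test_function_cmult[OF \<phi>(1), of c] by blast
qed

section \<open>The Sobolev inequality in dimensions at most three\<close>

lemma nn_integral_iterated_1:
  fixes F :: "'a::euclidean_space \<Rightarrow> ennreal"
  assumes B: "(Basis :: 'a set) = {a}" and [measurable]: "F \<in> borel_measurable borel"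
  shows "(\<integral>\<^sup>+x. F x \<partial>lborel) = (\<integral>\<^sup>+s. F (s *\<^sub>R a) \<partial>lborel)"
proof -
  interpret product_sigma_finite "\<lambda>_::'a. lborel :: real measure" ..
  show ?thesis
    by (subst lborel_eq, subst nn_integral_distr)
       (simp_all add: B product_nn_integral_singleton[of "\<lambda>s. F (s *\<^sub>R a)"])
qed

lemma nn_integral_iterated_2:
  fixes F :: "'a::euclidean_space \<Rightarrow> ennreal"
  assumes B: "(Basis :: 'a set) = {a, b}" "a \<noteq> b" and [measurable]: "F \<in> borel_measurable borel"
  shows "(\<integral>\<^sup>+x. F x \<partial>lborel) = (\<integral>\<^sup>+t. \<integral>\<^sup>+s. F (s *\<^sub>R a + t *\<^sub>R b) \<partial>lborel \<partial>lborel)"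
proof -
  interpret product_sigma_finite "\<lambda>_::'a. lborel :: real measure" ..
  have "(\<integral>\<^sup>+x. F x \<partial>lborel) = (\<integral>\<^sup>+f. F (f a *\<^sub>R a + f b *\<^sub>R b) \<partial>Pi\<^sub>M {a, b} (\<lambda>_. lborel))"
    by (subst lborel_eq, subst nn_integral_distr) (simp_all add: B)
  also have "\<dots> = (\<integral>\<^sup>+f. \<integral>\<^sup>+s. F (s *\<^sub>R a + f b *\<^sub>R b) \<partial>lborel \<partial>Pi\<^sub>M {b} (\<lambda>_. lborel))"
    by (subst product_nn_integral_insert) (use B(2) in auto)
  also have "\<dots> = (\<integral>\<^sup>+t. \<integral>\<^sup>+s. F (s *\<^sub>R a + t *\<^sub>R b) \<partial>lborel \<partial>lborel)"
    by (subst product_nn_integral_singleton[of "\<lambda>t. \<integral>\<^sup>+s. F (s *\<^sub>R a + t *\<^sub>R b) \<partial>lborel"]) simp_all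
  finally show ?thesis .
qed

lemma nn_integral_iterated_3:
  fixes F :: "'a::euclidean_space \<Rightarrow> ennreal"
  assumes B: "(Basis :: 'a set) = {a, b, c}" "a \<noteq> b" "a \<noteq> c" "b \<noteq> c" and [measurable]: "F \<in> borel_measurable borel"
  shows "(\<integral>\<^sup>+x. F x \<partial>lborel) = (\<integral>\<^sup>+r. \<integral>\<^sup>+t. \<integral>\<^sup>+s. F (s *\<^sub>R a + t *\<^sub>R b + r *\<^sub>R c) \<partial>lborel \<partial>lborel \<partial>lborel)"
proof -
  interpret product_sigma_finite "\<lambda>_::'a. lborel :: real measure" ..
  have "(\<integral>\<^sup>+x. F x \<partial>lborel) = (\<integral>\<^sup>+f. F (f a *\<^sub>R a + f b *\<^sub>R b + f c *\<^sub>R c) \<partial>Pi\<^sub>M {a, b, c} (\<lambda>_. lborel))"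
    by (subst lborel_eq, subst nn_integral_distr) (simp_all add: B add.assoc)
  also have "\<dots> = (\<integral>\<^sup>+f. \<integral>\<^sup>+s. F (s *\<^sub>R a + f b *\<^sub>R b + f c *\<^sub>R c) \<partial>lborel \<partial>Pi\<^sub>M {b, c} (\<lambda>_. lborel))"
    by (subst product_nn_integral_insert) (use B(2-4) in auto)
  also have "\<dots> = (\<integral>\<^sup>+f. \<integral>\<^sup>+t. \<integral>\<^sup>+s. F (s *\<^sub>R a + t *\<^sub>R b + f c *\<^sub>R c) \<partial>lborel \<partial>lborel \<partial>Pi\<^sub>M {c} (\<lambda>_. lborel))"
    by (subst product_nn_integral_insert) (use B(2-4) in auto)
  also have "\<dots> = (\<integral>\<^sup>+r. \<integral>\<^sup>+t. \<integral>\<^sup>+s. F (s *\<^sub>R a + t *\<^sub>R b + r *\<^sub>R c) \<partial>lborel \<partial>lborel \<partial>lborel)"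
    by (subst product_nn_integral_singleton[of "\<lambda>r. \<integral>\<^sup>+t. \<integral>\<^sup>+s. F (s *\<^sub>R a + t *\<^sub>R b + r *\<^sub>R c) \<partial>lborel \<partial>lborel"]) simp_all
  finally show ?thesis .
qed

text \<open>The square of \<phi> is the integral of its derivative along the line from a point where
  \<phi> vanishes. The bound no longer depends on t, which makes the integration of products of
  slices possible.\<close>

lemma test_function_slice:
  fixes \<phi> :: "'a::euclidean_space \<Rightarrow> real"
  assumes \<phi>: "test_function UNIV \<phi>" and b: "b \<in> Basis"
  shows "ennreal ((\<phi> (t *\<^sub>R b + y))\<^sup>2) \<le>
    (\<integral>\<^sup>+s. ennreal (2 * \<bar>\<phi> (s *\<^sub>R b + y)\<bar> * norm (grad \<phi> (s *\<^sub>R b + y))) \<partial>lborel)"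
proof -
  obtain K where K: "compact K" "\<And>x. x \<notin> K \<Longrightarrow> \<phi> x = 0 \<and> grad \<phi> x = 0"
    using test_function_supp[OF \<phi>] by blast
  obtain R where R: "\<And>x. x \<in> K \<Longrightarrow> norm x \<le> R" using compact_imp_bounded[OF K(1)] bounded_iff by blast
  \<comment> \<open>To the left of t and so far out that \<open>a *\<^sub>R b + y\<close> lies
    outside the support.\<close>
  define a where "a = min t (- (\<bar>R\<bar> + norm y + 1))"
  define f where "f s = 2 * \<phi> (s *\<^sub>R b + y) * (grad \<phi> (s *\<^sub>R b + y) \<bullet> b)" for s
  have c: "continuous_on UNIV \<phi>" "continuous_on UNIV (grad \<phi>)"
    using test_function_Ck[OF \<phi>] by (auto intro: Ck_continuous continuous_grad)
  have cs: "continuous_on UNIV (\<lambda>s. \<phi> (s *\<^sub>R b + y))" "continuous_on UNIV (\<lambda>s. grad \<phi> (s *\<^sub>R b + y))"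
    by (intro continuous_on_compose2[OF c(1)] continuous_on_compose2[OF c(2)] continuous_intros subset_UNIV)+
  have cf: "continuous_on UNIV f" unfolding f_def by (intro continuous_intros cs)
  have der: "((\<lambda>s. \<phi> (s *\<^sub>R b + y)) has_real_derivative (grad \<phi> (s *\<^sub>R b + y) \<bullet> b)) (at s)" for s
    unfolding has_field_derivative_def
    by (rule has_derivative_eq_rhs, rule has_derivative_compose[of "\<lambda>t. t *\<^sub>R b + y" "\<lambda>s. s *\<^sub>R b" s UNIV \<phi>])
       (auto intro!: derivative_eq_intros has_derivative_grad test_function_Ck[OF \<phi>] simp: inner_commute mult.commute)
  have "\<phi> (a *\<^sub>R b + y) = 0"
  proof -
    have "\<bar>a\<bar> \<ge> \<bar>R\<bar> + norm y + 1" by (auto simp: a_def)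
    moreover have "\<bar>a\<bar> \<le> norm (a *\<^sub>R b + y) + norm y"
      using norm_triangle_ineq4[of "a *\<^sub>R b + y" y] b by (simp add: norm_Basis)
    ultimately have "norm (a *\<^sub>R b + y) > R" by linarith
    then show ?thesis using R[of "a *\<^sub>R b + y"] K(2)[of "a *\<^sub>R b + y"] by (meson not_le)
  qed
  moreover have "(LBINT s. f s * indicator {a..t} s) = (\<phi> (t *\<^sub>R b + y))\<^sup>2 - (\<phi> (a *\<^sub>R b + y))\<^sup>2"
  proof (rule integral_FTC_Icc_real)
    show "a \<le> t" by (simp add: a_def)
    show "((\<lambda>s. (\<phi> (s *\<^sub>R b + y))\<^sup>2) has_real_derivative f s) (at s)" for s
      by (rule derivative_eq_intros der refl)+ (simp add: f_def)
    show "isCont f s" for s using cf by (simp add: continuous_on_eq_continuous_at)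
  qed
  ultimately have "ennreal ((\<phi> (t *\<^sub>R b + y))\<^sup>2) = ennreal (LBINT s. f s * indicator {a..t} s)" by simp
  also have "\<dots> \<le> ennreal (norm (LBINT s. f s * indicator {a..t} s))" by (intro ennreal_leI) simp
  also have "\<dots> \<le> (\<integral>\<^sup>+s. ennreal (norm (f s * indicator {a..t} s)) \<partial>lborel)"
    by (rule integral_norm_bound_ennreal)
       (use borel_integrable_atLeastAtMost[of a t f] cf in \<open>auto simp: continuous_on_eq_continuous_at mult.commute\<close>)
  also have "\<dots> \<le> (\<integral>\<^sup>+s. ennreal (2 * \<bar>\<phi> (s *\<^sub>R b + y)\<bar> * norm (grad \<phi> (s *\<^sub>R b + y))) \<partial>lborel)"
  proof (intro nn_integral_mono ennreal_leI)
    fix s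
    have "\<bar>grad \<phi> (s *\<^sub>R b + y) \<bullet> b\<bar> \<le> norm (grad \<phi> (s *\<^sub>R b + y))"
      using Cauchy_Schwarz_ineq2[of "grad \<phi> (s *\<^sub>R b + y)" b] b by (simp add: norm_Basis)
    then show "norm (f s * indicator {a..t} s) \<le> 2 * \<bar>\<phi> (s *\<^sub>R b + y)\<bar> * norm (grad \<phi> (s *\<^sub>R b + y))"
      by (auto simp: f_def indicator_def abs_mult mult_left_mono)
  qed
  finally show ?thesis .
qed

text \<open>Ladyzhenskaya's argument: one factor of \<open>h\<^sup>2\<close> is bounded independently of \<open>s\<close>, the other
  independently of \<open>t\<close>.\<close>

lemma ladyzhenskaya_2d:
  fixes h k :: "real \<Rightarrow> real \<Rightarrow> ennreal"
  assumes [measurable]: "case_prod h \<in> borel_measurable (lborel \<Otimes>\<^sub>M lborel)" "case_prod k \<in> borel_measurable (lborel \<Otimes>\<^sub>M lborel)"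
    and "\<And>s t. h s t \<le> (\<integral>\<^sup>+s. k s t \<partial>lborel)" "\<And>s t. h s t \<le> (\<integral>\<^sup>+t. k s t \<partial>lborel)"
  shows "(\<integral>\<^sup>+t. \<integral>\<^sup>+s. (h s t)\<^sup>2 \<partial>lborel \<partial>lborel) \<le> (\<integral>\<^sup>+t. \<integral>\<^sup>+s. k s t \<partial>lborel \<partial>lborel)\<^sup>2"
proof -
  have "(\<integral>\<^sup>+t. \<integral>\<^sup>+s. (h s t)\<^sup>2 \<partial>lborel \<partial>lborel) \<le>
     (\<integral>\<^sup>+t. \<integral>\<^sup>+s. (\<integral>\<^sup>+s. k s t \<partial>lborel) * (\<integral>\<^sup>+t. k s t \<partial>lborel) \<partial>lborel \<partial>lborel)"
    unfolding power2_eq_square by (intro nn_integral_mono mult_mono assms) auto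
  also have "\<dots> = (\<integral>\<^sup>+t. \<integral>\<^sup>+s. k s t \<partial>lborel \<partial>lborel) * (\<integral>\<^sup>+s. \<integral>\<^sup>+t. k s t \<partial>lborel \<partial>lborel)"
    by (simp add: nn_integral_cmult nn_integral_multc)
  also have "(\<integral>\<^sup>+s. \<integral>\<^sup>+t. k s t \<partial>lborel \<partial>lborel) = (\<integral>\<^sup>+t. \<integral>\<^sup>+s. k s t \<partial>lborel \<partial>lborel)"
    by (rule lborel_pair.Fubini'[symmetric]) measurable
  finally show ?thesis by (simp add: power2_eq_square)
qed

lemma Cauchy_Schwarz_nn_integral_2d:
  fixes h k :: "real \<Rightarrow> real \<Rightarrow> ennreal"
  assumes [measurable]: "case_prod h \<in> borel_measurable (lborel \<Otimes>\<^sub>M lborel)" "case_prod k \<in> borel_measurable (lborel \<Otimes>\<^sub>M lborel)"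
  shows "(\<integral>\<^sup>+t. \<integral>\<^sup>+s. h s t * k s t \<partial>lborel \<partial>lborel)\<^sup>2 \<le>
    (\<integral>\<^sup>+t. \<integral>\<^sup>+s. (h s t)\<^sup>2 \<partial>lborel \<partial>lborel) * (\<integral>\<^sup>+t. \<integral>\<^sup>+s. (k s t)\<^sup>2 \<partial>lborel \<partial>lborel)"
proof -
  have *: "(\<integral>\<^sup>+t. \<integral>\<^sup>+s. f s t \<partial>lborel \<partial>lborel) = integral\<^sup>N (lborel \<Otimes>\<^sub>M lborel) (case_prod f)"
    if "case_prod f \<in> borel_measurable (lborel \<Otimes>\<^sub>M lborel)" for f :: "real \<Rightarrow> real \<Rightarrow> ennreal"
    using lborel_pair.nn_integral_snd[OF that] by simp
  show ?thesis
    using Cauchy_Schwarz_nn_integral[OF assms]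
    by (subst (1 2 3) *) (auto simp: case_prod_unfold)
qed

text \<open>With h = \<phi>^2 and k = 2 |\<phi>| |\<nabla>\<phi>|, slicing bounds h by line
  integrals of k, and both k and h lie below the density of the squared Sobolev norm N. In dimension
  one this gives h \<le> N, in dimension two Ladyzhenskaya's inequality; both yield N^2. The
  constant 4 is the square of the 2 in k and appears only in dimension three. Working in
  \<open>ennreal\<close> makes finiteness questions disappear.\<close>

lemma sobolev_test_function:
  fixes \<phi> :: "'a::euclidean_space \<Rightarrow> real"
  assumes D: "DIM('a) \<le> 3" and \<phi>: "test_function UNIV \<phi>"
  shows "(\<integral>\<^sup>+x. ennreal ((\<phi> x)^4) \<partial>lborel) \<le> 4 * (\<integral>\<^sup>+x. ennreal ((norm (grad \<phi> x))\<^sup>2 + (\<phi> x)\<^sup>2) \<partial>lborel)\<^sup>2"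
proof -
  have c: "continuous_on UNIV \<phi>" "continuous_on UNIV (grad \<phi>)"
    using test_function_Ck[OF \<phi>] by (auto intro: Ck_continuous continuous_grad)
  note [measurable] = borel_measurable_continuous_onI[OF c(1)] borel_measurable_continuous_onI[OF c(2)]
  define N where "N = (\<integral>\<^sup>+x. ennreal ((norm (grad \<phi> x))\<^sup>2 + (\<phi> x)\<^sup>2) \<partial>lborel)"
  define h where "h x = ennreal ((\<phi> x)\<^sup>2)" for x
  define k where "k x = ennreal (2 * \<bar>\<phi> x\<bar> * norm (grad \<phi> x))" for x
  have [measurable]: "h \<in> borel_measurable borel" "k \<in> borel_measurable borel"
    unfolding h_def[abs_def] k_def[abs_def] by measurable
  have h2: "(h x)\<^sup>2 = ennreal ((\<phi> x)^4)" for x by (simp add: h_def ennreal_power flip: power_mult)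
  have slice: "h (t *\<^sub>R b + y) \<le> (\<integral>\<^sup>+s. k (s *\<^sub>R b + y) \<partial>lborel)" if "b \<in> Basis" for b y t
    unfolding h_def k_def by (rule test_function_slice[OF \<phi> that])
  have kN: "k x \<le> ennreal ((norm (grad \<phi> x))\<^sup>2 + (\<phi> x)\<^sup>2)" for x
    unfolding k_def using sum_squares_bound[of "\<bar>\<phi> x\<bar>" "norm (grad \<phi> x)"] by (intro ennreal_leI) simp
  have hN: "h x \<le> ennreal ((norm (grad \<phi> x))\<^sup>2 + (\<phi> x)\<^sup>2)" for x
    unfolding h_def by (intro ennreal_leI) simp
  have KN: "(\<integral>\<^sup>+x. k x \<partial>lborel) \<le> N" "(\<integral>\<^sup>+x. h x \<partial>lborel) \<le> N"
    unfolding N_def by (intro nn_integral_mono kN hN)+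
  have goal: "(\<integral>\<^sup>+x. (h x)\<^sup>2 \<partial>lborel) \<le> 4 * N\<^sup>2"
  proof -
    have "DIM('a) = 1 \<or> DIM('a) = 2 \<or> DIM('a) = 3" using D DIM_positive[where 'a='a] by linarith
    then consider a where "(Basis :: 'a set) = {a}" | a b where "(Basis :: 'a set) = {a, b}" "a \<noteq> b"
      | a b c where "(Basis :: 'a set) = {a, b, c}" "a \<noteq> b" "a \<noteq> c" "b \<noteq> c"
      by (auto simp: card_1_singleton_iff card_2_iff card_3_iff)
    then show ?thesis
    proof cases
      case (1 a)
      have "h (s *\<^sub>R a) \<le> N" for s
      proof -
        have "a \<in> Basis" by (simp add: 1)
        from slice[OF this, of s 0] have "h (s *\<^sub>R a) \<le> (\<integral>\<^sup>+x. k x \<partial>lborel)"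
          by (simp add: nn_integral_iterated_1[OF 1])
        then show ?thesis using KN(1) by (rule order_trans)
      qed
      then have "(\<integral>\<^sup>+s. (h (s *\<^sub>R a))\<^sup>2 \<partial>lborel) \<le> (\<integral>\<^sup>+s. N * h (s *\<^sub>R a) \<partial>lborel)"
        unfolding power2_eq_square by (intro nn_integral_mono mult_right_mono) auto
      also have "\<dots> = N * (\<integral>\<^sup>+x. h x \<partial>lborel)"
        by (simp add: nn_integral_cmult nn_integral_iterated_1[OF 1])
      also have "\<dots> \<le> N * N" by (intro mult_left_mono KN) simp
      also have "\<dots> \<le> 4 * N\<^sup>2"
        using mult_right_mono[of 1 4 "N\<^sup>2"] by (simp add: power2_eq_square)
      finally show ?thesis by (simp add: nn_integral_iterated_1[OF 1])
    next
      case (2 a b)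
      have bas: "a \<in> Basis" "b \<in> Basis" by (auto simp: 2)
      have "(\<integral>\<^sup>+t. \<integral>\<^sup>+s. (h (s *\<^sub>R a + t *\<^sub>R b))\<^sup>2 \<partial>lborel \<partial>lborel) \<le>
         (\<integral>\<^sup>+t. \<integral>\<^sup>+s. k (s *\<^sub>R a + t *\<^sub>R b) \<partial>lborel \<partial>lborel)\<^sup>2"
      proof (rule ladyzhenskaya_2d)
        show "h (s *\<^sub>R a + t *\<^sub>R b) \<le> (\<integral>\<^sup>+s. k (s *\<^sub>R a + t *\<^sub>R b) \<partial>lborel)" for s t
          by (rule slice) (simp add: 2)
        show "h (s *\<^sub>R a + t *\<^sub>R b) \<le> (\<integral>\<^sup>+t. k (s *\<^sub>R a + t *\<^sub>R b) \<partial>lborel)" for s t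
          using slice[OF bas(2), of t "s *\<^sub>R a"] by (simp add: add.commute)
      qed measurable
      also have "\<dots> = (\<integral>\<^sup>+x. k x \<partial>lborel)\<^sup>2" by (simp add: nn_integral_iterated_2[OF 2])
      also have "\<dots> \<le> N\<^sup>2" by (intro power_mono KN) simp
      also have "\<dots> \<le> 4 * N\<^sup>2" using mult_right_mono[of 1 4 "N\<^sup>2"] by simp
      finally show ?thesis by (simp add: nn_integral_iterated_2[OF 2])
    next
      \<comment> \<open>On each plane \<open>r = const\<close> use the two-dimensional argument; the integral of \<open>h\<close> over the plane
        is bounded by slicing in the direction \<open>c\<close>.\<close>
      case (3 a b c)
      have bas: "a \<in> Basis" "b \<in> Basis" "c \<in> Basis" by (auto simp: 3)
      let ?p = "\<lambda>s t r. s *\<^sub>R a + t *\<^sub>R b + r *\<^sub>R c"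
      define G where "G x = ennreal ((norm (grad \<phi> x))\<^sup>2)" for x
      have [measurable]: "G \<in> borel_measurable borel" unfolding G_def[abs_def] by measurable
      have m: "(\<integral>\<^sup>+t. \<integral>\<^sup>+s. h (?p s t r) \<partial>lborel \<partial>lborel) \<le> N" for r
      proof -
        have "(\<integral>\<^sup>+t. \<integral>\<^sup>+s. h (?p s t r) \<partial>lborel \<partial>lborel) \<le>
          (\<integral>\<^sup>+t. \<integral>\<^sup>+s. \<integral>\<^sup>+r. k (?p s t r) \<partial>lborel \<partial>lborel \<partial>lborel)"
        proof (intro nn_integral_mono)
          fix t s show "h (?p s t r) \<le> (\<integral>\<^sup>+r. k (?p s t r) \<partial>lborel)"
            using slice[OF bas(3), of r "s *\<^sub>R a + t *\<^sub>R b"] by (simp add: add.commute)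
        qed
        also have "\<dots> = (\<integral>\<^sup>+t. \<integral>\<^sup>+r. \<integral>\<^sup>+s. k (?p s t r) \<partial>lborel \<partial>lborel \<partial>lborel)"
          by (intro nn_integral_cong lborel_pair.Fubini') measurable
        also have "\<dots> = (\<integral>\<^sup>+r. \<integral>\<^sup>+t. \<integral>\<^sup>+s. k (?p s t r) \<partial>lborel \<partial>lborel \<partial>lborel)"
          by (intro lborel_pair.Fubini') measurable
        also have "\<dots> = (\<integral>\<^sup>+x. k x \<partial>lborel)" by (simp add: nn_integral_iterated_3[OF 3])
        finally show ?thesis using KN(1) by (rule order_trans)
      qed
      have "(\<integral>\<^sup>+t. \<integral>\<^sup>+s. (h (?p s t r))\<^sup>2 \<partial>lborel \<partial>lborel) \<le>
          4 * N * (\<integral>\<^sup>+t. \<integral>\<^sup>+s. G (?p s t r) \<partial>lborel \<partial>lborel)" for r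
      proof -
        have "(\<integral>\<^sup>+t. \<integral>\<^sup>+s. (h (?p s t r))\<^sup>2 \<partial>lborel \<partial>lborel) \<le>
           (\<integral>\<^sup>+t. \<integral>\<^sup>+s. k (?p s t r) \<partial>lborel \<partial>lborel)\<^sup>2"
        proof (rule ladyzhenskaya_2d)
          show "h (?p s t r) \<le> (\<integral>\<^sup>+s. k (?p s t r) \<partial>lborel)" for s t
            using slice[OF bas(1), of s "t *\<^sub>R b + r *\<^sub>R c"] by (simp add: add.assoc)
          show "h (?p s t r) \<le> (\<integral>\<^sup>+t. k (?p s t r) \<partial>lborel)" for s t
            using slice[OF bas(2), of t "s *\<^sub>R a + r *\<^sub>R c"] by (simp add: add_ac)
        qed measurable
        \<comment> \<open>Cauchy-Schwarz on the plane separates \<phi> from its gradient: the factor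
          with \<phi> is bounded by \<open>m\<close> uniformly in r, and only the gradient remains
          to be integrated over r.\<close>
        also have "(\<lambda>t. \<integral>\<^sup>+s. k (?p s t r) \<partial>lborel) =
          (\<lambda>t. \<integral>\<^sup>+s. ennreal (2 * \<bar>\<phi> (?p s t r)\<bar>) * ennreal (norm (grad \<phi> (?p s t r))) \<partial>lborel)"
          by (simp add: k_def ennreal_mult)
        also have "(\<integral>\<^sup>+t. \<integral>\<^sup>+s. ennreal (2 * \<bar>\<phi> (?p s t r)\<bar>) * ennreal (norm (grad \<phi> (?p s t r))) \<partial>lborel \<partial>lborel)\<^sup>2
           \<le> (\<integral>\<^sup>+t. \<integral>\<^sup>+s. (ennreal (2 * \<bar>\<phi> (?p s t r)\<bar>))\<^sup>2 \<partial>lborel \<partial>lborel) *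
             (\<integral>\<^sup>+t. \<integral>\<^sup>+s. (ennreal (norm (grad \<phi> (?p s t r))))\<^sup>2 \<partial>lborel \<partial>lborel)"
          by (rule Cauchy_Schwarz_nn_integral_2d) measurable
        also have "\<dots> = (4 * (\<integral>\<^sup>+t. \<integral>\<^sup>+s. h (?p s t r) \<partial>lborel \<partial>lborel)) *
             (\<integral>\<^sup>+t. \<integral>\<^sup>+s. G (?p s t r) \<partial>lborel \<partial>lborel)"
        proof -
          have "(ennreal (2 * \<bar>\<phi> x\<bar>))\<^sup>2 = 4 * h x" for x
            by (simp add: h_def ennreal_power power_mult_distrib ennreal_mult)
          then show ?thesis by (simp add: G_def ennreal_power nn_integral_cmult)
        qed
        also have "\<dots> \<le> 4 * N * (\<integral>\<^sup>+t. \<integral>\<^sup>+s. G (?p s t r) \<partial>lborel \<partial>lborel)"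
          by (intro mult_right_mono mult_left_mono m) auto
        finally show ?thesis .
      qed
      then have "(\<integral>\<^sup>+r. \<integral>\<^sup>+t. \<integral>\<^sup>+s. (h (?p s t r))\<^sup>2 \<partial>lborel \<partial>lborel \<partial>lborel) \<le>
         (\<integral>\<^sup>+r. 4 * N * (\<integral>\<^sup>+t. \<integral>\<^sup>+s. G (?p s t r) \<partial>lborel \<partial>lborel) \<partial>lborel)"
        by (intro nn_integral_mono)
      also have "\<dots> = 4 * N * (\<integral>\<^sup>+x. G x \<partial>lborel)"
        by (simp add: nn_integral_cmult nn_integral_iterated_3[OF 3])
      also have "\<dots> \<le> 4 * N * N"
        unfolding N_def G_def by (intro mult_left_mono nn_integral_mono ennreal_leI) auto
      also have "\<dots> = 4 * N\<^sup>2" by (simp add: power2_eq_square mult.assoc)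
      finally show ?thesis by (simp add: nn_integral_iterated_3[OF 3])
    qed
  qed
  then show ?thesis by (simp add: h2 N_def)
qed

section \<open>Density of test functions in the Sobolev space of the whole space\<close>

definition shift_dist :: "('a::euclidean_space \<Rightarrow> real) \<Rightarrow> 'a \<Rightarrow> ennreal" where
  "shift_dist f z = (\<integral>\<^sup>+x. ennreal ((f (x - z) - f x)\<^sup>2) \<partial>lborel)"

definition L2_shift_continuous :: "('a::euclidean_space \<Rightarrow> real) \<Rightarrow> bool" where
  "L2_shift_continuous f \<longleftrightarrow> (\<forall>\<epsilon>>0. \<exists>\<delta>>0. \<forall>z. norm z < \<delta> \<longrightarrow> shift_dist f z \<le> ennreal \<epsilon>)"

lemma nn_integral_translation:
  fixes f :: "'a::euclidean_space \<Rightarrow> ennreal"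
  assumes "f \<in> borel_measurable borel"
  shows "(\<integral>\<^sup>+x. f (x - z) \<partial>lborel) = (\<integral>\<^sup>+x. f x \<partial>lborel)"
proof -
  have "(\<integral>\<^sup>+x. f x \<partial>lborel) = (\<integral>\<^sup>+x. f x \<partial>distr lborel borel ((+) (- z)))"
    by (simp add: lborel_distr_plus)
  also have "\<dots> = (\<integral>\<^sup>+x. f (x - z) \<partial>lborel)"
    by (subst nn_integral_distr) (use assms in auto)
  finally show ?thesis by simp
qed

lemma shift_dist_add_le:
  fixes f g :: "'a::euclidean_space \<Rightarrow> real"
  assumes [measurable]: "f \<in> borel_measurable borel" "g \<in> borel_measurable borel"
  shows "shift_dist (\<lambda>x. f x + g x) z \<le> 2 * shift_dist f z + 2 * shift_dist g z"
proof -
  have "shift_dist (\<lambda>x. f x + g x) z \<le>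
     (\<integral>\<^sup>+x. 2 * ennreal ((f (x - z) - f x)\<^sup>2) + 2 * ennreal ((g (x - z) - g x)\<^sup>2) \<partial>lborel)"
    unfolding shift_dist_def
  proof (intro nn_integral_mono)
    fix x
    have "(f (x - z) + g (x - z) - (f x + g x))\<^sup>2 \<le> 2 * (f (x - z) - f x)\<^sup>2 + 2 * (g (x - z) - g x)\<^sup>2"
      using sum_squares_bound[of "f (x - z) - f x" "g (x - z) - g x"]
      by (simp add: power2_eq_square algebra_simps)
    then show "ennreal ((f (x - z) + g (x - z) - (f x + g x))\<^sup>2) \<le>
       2 * ennreal ((f (x - z) - f x)\<^sup>2) + 2 * ennreal ((g (x - z) - g x)\<^sup>2)"
      by (auto simp: ennreal_mult[symmetric] ennreal_plus[symmetric] simp del: ennreal_plus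
          simp flip: ennreal_numeral intro!: ennreal_leI)
  qed
  also have "\<dots> = 2 * shift_dist f z + 2 * shift_dist g z"
    unfolding shift_dist_def by (subst nn_integral_add) (auto simp: nn_integral_cmult)
  finally show ?thesis .
qed

lemma L2_shift_continuous_add:
  fixes f g :: "'a::euclidean_space \<Rightarrow> real"
  assumes "f \<in> borel_measurable borel" "g \<in> borel_measurable borel"
    and f: "L2_shift_continuous f" and g: "L2_shift_continuous g"
  shows "L2_shift_continuous (\<lambda>x. f x + g x)"
  unfolding L2_shift_continuous_def
proof (intro allI impI)
  fix \<epsilon> :: real assume "\<epsilon> > 0"
  then have e: "\<epsilon> / 4 > 0" by simp
  obtain a where a: "a > 0" "\<And>z. norm z < a \<Longrightarrow> shift_dist f z \<le> ennreal (\<epsilon> / 4)"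
    using f e unfolding L2_shift_continuous_def by blast
  obtain b where b: "b > 0" "\<And>z. norm z < b \<Longrightarrow> shift_dist g z \<le> ennreal (\<epsilon> / 4)"
    using g e unfolding L2_shift_continuous_def by blast
  have "shift_dist (\<lambda>x. f x + g x) z \<le> ennreal \<epsilon>" if "norm z < min a b" for z
  proof -
    have "shift_dist (\<lambda>x. f x + g x) z \<le> 2 * shift_dist f z + 2 * shift_dist g z"
      by (rule shift_dist_add_le[OF assms(1,2)])
    also have "\<dots> \<le> 2 * ennreal (\<epsilon> / 4) + 2 * ennreal (\<epsilon> / 4)"
      using a(2)[of z] b(2)[of z] that by (intro add_mono mult_left_mono) auto
    also have "\<dots> = ennreal \<epsilon>"
      using e by (simp add: ennreal_plus[symmetric] ennreal_mult[symmetric] del: ennreal_plus flip: ennreal_numeral)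
    finally show ?thesis .
  qed
  then show "\<exists>\<delta>>0. \<forall>z. norm z < \<delta> \<longrightarrow> shift_dist (\<lambda>x. f x + g x) z \<le> ennreal \<epsilon>"
    using a(1) b(1) by (intro exI[of _ "min a b"]) auto
qed

lemma L2_shift_continuous_cmult:
  fixes f :: "'a::euclidean_space \<Rightarrow> real"
  assumes [measurable]: "f \<in> borel_measurable borel" and f: "L2_shift_continuous f"
  shows "L2_shift_continuous (\<lambda>x. c * f x)"
  unfolding L2_shift_continuous_def
proof (intro allI impI)
  fix \<epsilon> :: real assume "\<epsilon> > 0"
  then have e: "\<epsilon> / (c\<^sup>2 + 1) > 0" by (simp add: add_nonneg_pos)
  obtain a where a: "a > 0" "\<And>z. norm z < a \<Longrightarrow> shift_dist f z \<le> ennreal (\<epsilon> / (c\<^sup>2 + 1))"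
    using f e unfolding L2_shift_continuous_def by blast
  have "shift_dist (\<lambda>x. c * f x) z \<le> ennreal \<epsilon>" if "norm z < a" for z
  proof -
    have "shift_dist (\<lambda>x. c * f x) z = ennreal (c\<^sup>2) * shift_dist f z"
      unfolding shift_dist_def
      by (subst nn_integral_cmult[symmetric])
         (auto simp: ennreal_mult[symmetric] power_mult_distrib[symmetric] right_diff_distrib)
    also have "\<dots> \<le> ennreal (c\<^sup>2) * ennreal (\<epsilon> / (c\<^sup>2 + 1))"
      using a(2)[OF that] by (intro mult_left_mono) auto
    also have "\<dots> = ennreal (c\<^sup>2 * (\<epsilon> / (c\<^sup>2 + 1)))" using e by (subst ennreal_mult) auto
    also have "\<dots> \<le> ennreal \<epsilon>"
      using \<open>\<epsilon> > 0\<close> pos_divide_le_eq[of "c\<^sup>2 + 1" "c\<^sup>2 * \<epsilon>" \<epsilon>]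
      by (intro ennreal_leI) (simp add: add_nonneg_pos distrib_left mult.commute)
    finally show ?thesis .
  qed
  then show "\<exists>\<delta>>0. \<forall>z. norm z < \<delta> \<longrightarrow> shift_dist (\<lambda>x. c * f x) z \<le> ennreal \<epsilon>"
    using a(1) by blast
qed

text \<open>The constant is 2 + 2, the translate having the same norm as the function.\<close>

lemma shift_dist_le_norm:
  fixes f :: "'a::euclidean_space \<Rightarrow> real"
  assumes [measurable]: "f \<in> borel_measurable borel"
  shows "shift_dist f z \<le> 4 * (\<integral>\<^sup>+x. ennreal ((f x)\<^sup>2) \<partial>lborel)"
proof -
  have "shift_dist f z \<le> (\<integral>\<^sup>+x. 2 * ennreal ((f (x - z))\<^sup>2) + 2 * ennreal ((f x)\<^sup>2) \<partial>lborel)"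
    unfolding shift_dist_def
  proof (intro nn_integral_mono)
    fix x
    have "(f (x - z) - f x)\<^sup>2 \<le> 2 * (f (x - z))\<^sup>2 + 2 * (f x)\<^sup>2"
      using sum_squares_bound[of "f (x - z)" "- f x"] by (simp add: power2_eq_square algebra_simps)
    then show "ennreal ((f (x - z) - f x)\<^sup>2) \<le> 2 * ennreal ((f (x - z))\<^sup>2) + 2 * ennreal ((f x)\<^sup>2)"
      by (auto simp: ennreal_mult[symmetric] ennreal_plus[symmetric] simp del: ennreal_plus
          simp flip: ennreal_numeral intro!: ennreal_leI)
  qed
  also have "\<dots> = 2 * (\<integral>\<^sup>+x. ennreal ((f (x - z))\<^sup>2) \<partial>lborel) + 2 * (\<integral>\<^sup>+x. ennreal ((f x)\<^sup>2) \<partial>lborel)"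
    by (subst nn_integral_add) (auto simp: nn_integral_cmult)
  also have "(\<integral>\<^sup>+x. ennreal ((f (x - z))\<^sup>2) \<partial>lborel) = (\<integral>\<^sup>+x. ennreal ((f x)\<^sup>2) \<partial>lborel)"
    by (rule nn_integral_translation) measurable
  also have "2 * (\<integral>\<^sup>+x. ennreal ((f x)\<^sup>2) \<partial>lborel) + 2 * (\<integral>\<^sup>+x. ennreal ((f x)\<^sup>2) \<partial>lborel) =
     4 * (\<integral>\<^sup>+x. ennreal ((f x)\<^sup>2) \<partial>lborel)"
    by (simp add: distrib_right[symmetric])
  finally show ?thesis .
qed

text \<open>A fixed close approximant carries its continuity over. The value
  \<open>\<epsilon> / 16\<close> accounts for the factor 2 of \<open>shift_dist_add_le\<close> and
  the factor 4 of \<open>shift_dist_le_norm\<close>, which leaves half of \<epsilon> for the error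
  and half for the approximant.\<close>

lemma L2_shift_continuous_lim:
  fixes f :: "'a::euclidean_space \<Rightarrow> real"
  assumes [measurable]: "f \<in> borel_measurable borel" "\<And>i::nat. g i \<in> borel_measurable borel"
    and g: "\<And>i. L2_shift_continuous (g i)"
    and lim: "(\<lambda>i. \<integral>\<^sup>+x. ennreal ((f x - g i x)\<^sup>2) \<partial>lborel) \<longlonglongrightarrow> 0"
  shows "L2_shift_continuous f"
  unfolding L2_shift_continuous_def
proof (intro allI impI)
  fix \<epsilon> :: real assume e: "\<epsilon> > 0"
  have "\<forall>\<^sub>F i in sequentially. (\<integral>\<^sup>+x. ennreal ((f x - g i x)\<^sup>2) \<partial>lborel) < ennreal (\<epsilon> / 16)"
    using order_tendstoD(2)[OF lim, of "ennreal (\<epsilon> / 16)"] e by simp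
  then obtain i where i: "(\<integral>\<^sup>+x. ennreal ((f x - g i x)\<^sup>2) \<partial>lborel) < ennreal (\<epsilon> / 16)"
    by (auto simp: eventually_sequentially)
  obtain b where b: "b > 0" "\<And>z. norm z < b \<Longrightarrow> shift_dist (g i) z \<le> ennreal (\<epsilon> / 4)"
    using g[of i] e unfolding L2_shift_continuous_def by (meson divide_pos_pos zero_less_numeral)
  have "shift_dist f z \<le> ennreal \<epsilon>" if "norm z < b" for z
  proof -
    have "shift_dist f z = shift_dist (\<lambda>x. (f x - g i x) + g i x) z" by simp
    also have "\<dots> \<le> 2 * shift_dist (\<lambda>x. f x - g i x) z + 2 * shift_dist (g i) z"
      by (rule shift_dist_add_le) measurable
    also have "\<dots> \<le> 2 * (4 * ennreal (\<epsilon> / 16)) + 2 * ennreal (\<epsilon> / 4)"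
    proof (intro add_mono mult_left_mono b(2)[OF that])
      have "shift_dist (\<lambda>x. f x - g i x) z \<le> 4 * (\<integral>\<^sup>+x. ennreal ((f x - g i x)\<^sup>2) \<partial>lborel)"
        by (rule shift_dist_le_norm) measurable
      also have "\<dots> \<le> 4 * ennreal (\<epsilon> / 16)" using i by (intro mult_left_mono) auto
      finally show "shift_dist (\<lambda>x. f x - g i x) z \<le> 4 * ennreal (\<epsilon> / 16)" .
    qed auto
    also have "\<dots> = ennreal \<epsilon>"
      using e by (simp add: ennreal_plus[symmetric] ennreal_mult[symmetric] del: ennreal_plus flip: ennreal_numeral)
    finally show ?thesis .
  qed
  then show "\<exists>\<delta>>0. \<forall>z. norm z < \<delta> \<longrightarrow> shift_dist f z \<le> ennreal \<epsilon>"
    using b(1) by blast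
qed

text \<open>Outer regularity of the complement yields a closed subset of S with small defect;
  intersecting it with a large ball makes it compact, and finite measure makes the part lost outside
  the ball small.\<close>

lemma inner_compact_lborel:
  fixes S :: "'a::euclidean_space set"
  assumes S: "S \<in> sets borel" "emeasure lborel S < \<infinity>" and e: "(\<epsilon>::real) > 0"
  shows "\<exists>K. compact K \<and> K \<subseteq> S \<and> emeasure lborel (S - K) < ennreal \<epsilon>"
proof -
  have "- S \<in> sets borel" using S(1) by auto
  then obtain U where U: "open U" "- S \<subseteq> U" "emeasure lborel (U - - S) < ennreal (\<epsilon> / 2)"
    using outer_regular_lborel[of "- S" "\<epsilon> / 2"] e by auto
  define T where "T n = - U \<inter> cball 0 (real n)" for n
  have T: "compact (T n)" "T n \<subseteq> S" for n
    using U(1,2) by (auto simp: T_def closed_Compl intro: closed_Int_compact)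
  have b: "U \<in> sets borel" using U(1) by auto
  have fin: "emeasure lborel (S - cball 0 (real n)) \<noteq> \<infinity>" for n
    using emeasure_mono[of "S - cball 0 (real n)" S lborel] S by auto
  have "(\<lambda>n. emeasure lborel (S - cball 0 (real n))) \<longlonglongrightarrow> emeasure lborel (\<Inter>n. S - cball 0 (real n))"
    by (rule Lim_emeasure_decseq) (use S fin in \<open>auto simp: decseq_def\<close>)
  also have "(\<Inter>n. S - cball 0 (real n)) = {}"
    using real_arch_simple by auto
  finally have "\<forall>\<^sub>F n in sequentially. emeasure lborel (S - cball 0 (real n)) < ennreal (\<epsilon> / 2)"
    using e by (intro order_tendstoD(2)[of _ 0]) auto
  then obtain n where n: "emeasure lborel (S - cball 0 (real n)) < ennreal (\<epsilon> / 2)"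
    by (auto simp: eventually_sequentially)
  have "emeasure lborel (S - T n) \<le> emeasure lborel ((U - - S) \<union> (S - cball 0 (real n)))"
    by (rule emeasure_mono) (use S b in \<open>auto simp: T_def\<close>)
  also have "\<dots> \<le> emeasure lborel (U - - S) + emeasure lborel (S - cball 0 (real n))"
    by (rule emeasure_subadditive) (use S b in auto)
  also have "\<dots> < ennreal (\<epsilon> / 2) + ennreal (\<epsilon> / 2)"
    using U(3) n by (rule add_strict_mono)
  also have "\<dots> = ennreal \<epsilon>" using e by (simp add: ennreal_plus[symmetric] del: ennreal_plus)
  finally show ?thesis using T by blast
qed

text \<open>Choose a compact K and an open U with K \<subseteq> S \<subseteq> U and U - K small. If
  z is shorter than the distance kept between K and the complement of U, then x and x - z can differ
  in membership of S only when one of them lies in U - K.\<close>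

lemma L2_shift_continuous_indicator:
  fixes S :: "'a::euclidean_space set"
  assumes S: "S \<in> sets borel" "emeasure lborel S < \<infinity>"
  shows "L2_shift_continuous (indicator S)"
  unfolding L2_shift_continuous_def
proof (intro allI impI)
  fix \<epsilon> :: real assume e: "\<epsilon> > 0"
  then have e4: "\<epsilon> / 4 > 0" by simp
  obtain K where K: "compact K" "K \<subseteq> S" "emeasure lborel (S - K) < ennreal (\<epsilon> / 4)"
    using inner_compact_lborel[OF S e4] by blast
  obtain U where U: "open U" "S \<subseteq> U" "emeasure lborel (U - S) < ennreal (\<epsilon> / 4)"
    using outer_regular_lborel[OF S(1) e4] by blast
  have "K \<subseteq> U" using K(2) U(2) by (rule subset_trans)
  with K(1) U(1) obtain d where d: "d > 0" "(\<Union>x\<in>K. ball x d) \<subseteq> U"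
    by (rule compact_subset_open_imp_ball_epsilon_subset)
  have b [measurable]: "U \<in> sets borel" "K \<in> sets borel"
    using U(1) K(1) by (auto intro: borel_compact)
  have D: "emeasure lborel (U - K) \<le> ennreal (\<epsilon> / 2)"
  proof -
    have "emeasure lborel (U - K) \<le> emeasure lborel ((U - S) \<union> (S - K))"
      by (rule emeasure_mono) (use S b in auto)
    also have "\<dots> \<le> emeasure lborel (U - S) + emeasure lborel (S - K)"
      by (rule emeasure_subadditive) (use S b in auto)
    also have "\<dots> \<le> ennreal (\<epsilon> / 4) + ennreal (\<epsilon> / 4)"
      using U(3) K(3) by (intro add_mono) auto
    also have "\<dots> = ennreal (\<epsilon> / 2)" using e by (simp add: ennreal_plus[symmetric] del: ennreal_plus)
    finally show ?thesis .
  qed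
  have "shift_dist (indicator S) z \<le> ennreal \<epsilon>" if z: "norm z < d" for z
  proof -
    have "shift_dist (indicator S) z \<le> (\<integral>\<^sup>+x. indicator (U - K) x + indicator (U - K) (x - z) \<partial>lborel)"
      unfolding shift_dist_def
    proof (intro nn_integral_mono)
      fix x
      have 1: "x \<in> U - K \<or> x - z \<in> U - K" if "x \<in> S" "x - z \<notin> S"
      proof (cases "x \<in> K")
        case True
        have "x - z \<in> ball x d" using z by (simp add: dist_norm)
        then have "x - z \<in> U" using d(2) True by blast
        then show ?thesis using that(2) K(2) by blast
      qed (use that U(2) in blast)
      have 2: "x \<in> U - K \<or> x - z \<in> U - K" if "x \<notin> S" "x - z \<in> S"
      proof (cases "x - z \<in> K")
        case True
        have "x \<in> ball (x - z) d" using z by (simp add: dist_norm)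
        then have "x \<in> U" using d(2) True by blast
        then show ?thesis using that(1) K(2) by blast
      qed (use that U(2) in blast)
      have "ennreal ((indicator S (x - z) - indicator S x)\<^sup>2) = (if (x \<in> S) = (x - z \<in> S) then 0 else 1)"
        by (auto simp: indicator_def)
      also have "\<dots> \<le> indicator (U - K) x + indicator (U - K) (x - z)"
        using 1 2 by (auto simp: indicator_def)
      finally show "ennreal ((indicator S (x - z) - indicator S x)\<^sup>2) \<le>
          indicator (U - K) x + indicator (U - K) (x - z)" .
    qed
    also have "\<dots> = (\<integral>\<^sup>+x. indicator (U - K) x \<partial>lborel) + (\<integral>\<^sup>+x. indicator (U - K) (x - z) \<partial>lborel)"
      by (rule nn_integral_add) auto
    also have "(\<integral>\<^sup>+x. indicator (U - K) (x - z) \<partial>lborel) = (\<integral>\<^sup>+x. indicator (U - K) x \<partial>lborel)"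
      by (rule nn_integral_translation) auto
    also have "(\<integral>\<^sup>+x. indicator (U - K) x \<partial>lborel) = emeasure lborel (U - K)" by (rule nn_integral_indicator) auto
    also have "emeasure lborel (U - K) + emeasure lborel (U - K) \<le> ennreal (\<epsilon> / 2) + ennreal (\<epsilon> / 2)"
      by (intro add_mono D)
    also have "\<dots> = ennreal \<epsilon>" using e by (simp add: ennreal_plus[symmetric] del: ennreal_plus)
    finally show ?thesis .
  qed
  then show "\<exists>\<delta>>0. \<forall>z. norm z < \<delta> \<longrightarrow> shift_dist (indicator S) z \<le> ennreal \<epsilon>"
    using d(1) by blast
qed

text \<open>Measurable induction from indicators. The square integrals of the pieces stay finite
  because nonnegative summands and increasing approximants lie below the whole; the monotone limit
  is then a limit in L2 by dominated convergence.\<close>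

lemma L2_shift_continuous_nonneg:
  fixes f :: "'a::euclidean_space \<Rightarrow> real"
  assumes "f \<in> borel_measurable borel" "\<And>x. 0 \<le> f x" "(\<integral>\<^sup>+x. ennreal ((f x)\<^sup>2) \<partial>lborel) < \<infinity>"
  shows "L2_shift_continuous f"
  using assms
proof (induction rule: borel_measurable_induct_real)
  case (set A)
  have "(\<integral>\<^sup>+x. ennreal ((indicator A x)\<^sup>2) \<partial>lborel) = (\<integral>\<^sup>+x. indicator A x \<partial>lborel)"
    by (intro nn_integral_cong) (auto simp: indicator_def)
  then show ?case using set by (intro L2_shift_continuous_indicator) auto
next
  case (mult u c)
  show ?case
  proof (cases "c = 0")
    case True
    then show ?thesis by (auto simp: L2_shift_continuous_def shift_dist_def intro: exI[of _ 1])
  next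
    case False
    have "(\<integral>\<^sup>+x. ennreal ((c * u x)\<^sup>2) \<partial>lborel) = ennreal (c\<^sup>2) * (\<integral>\<^sup>+x. ennreal ((u x)\<^sup>2) \<partial>lborel)"
      using mult(2) by (subst nn_integral_cmult[symmetric]) (auto simp: ennreal_mult[symmetric] power_mult_distrib)
    then have "(\<integral>\<^sup>+x. ennreal ((u x)\<^sup>2) \<partial>lborel) < \<infinity>"
      using mult(5) False by (auto simp: ennreal_mult_less_top)
    then show ?thesis using mult by (intro L2_shift_continuous_cmult) auto
  qed
next
  case (add u v)
  have "(\<integral>\<^sup>+x. ennreal ((u x)\<^sup>2) \<partial>lborel) \<le> (\<integral>\<^sup>+x. ennreal ((v x + u x)\<^sup>2) \<partial>lborel)"
    "(\<integral>\<^sup>+x. ennreal ((v x)\<^sup>2) \<partial>lborel) \<le> (\<integral>\<^sup>+x. ennreal ((v x + u x)\<^sup>2) \<partial>lborel)"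
    using add by (auto intro!: nn_integral_mono ennreal_leI power_mono)
  then show ?case using add by (intro L2_shift_continuous_add) auto
next
  case (seq U)
  note [measurable] = seq(1) \<open>f \<in> borel_measurable borel\<close>
  have le: "U i x \<le> f x" for i x
  proof (rule LIMSEQ_le_const)
    show "(\<lambda>i. U i x) \<longlonglongrightarrow> f x" using seq(4) by simp
    show "\<exists>N. \<forall>n\<ge>N. U i x \<le> U n x" using seq(3) by (auto simp: incseq_def le_fun_def)
  qed
  have "(\<integral>\<^sup>+x. ennreal ((U i x)\<^sup>2) \<partial>lborel) \<le> (\<integral>\<^sup>+x. ennreal ((f x)\<^sup>2) \<partial>lborel)" for i
    using seq(2) le by (auto intro!: nn_integral_mono ennreal_leI power_mono)
  moreover have "(\<integral>\<^sup>+x. ennreal ((f x)\<^sup>2) \<partial>lborel) < \<infinity>" using seq.prems by simp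
  ultimately have c: "L2_shift_continuous (U i)" for i
    by (intro seq(5)) (rule order_le_less_trans)
  have "(\<lambda>i. \<integral>\<^sup>+x. norm (0 - (f x - U i x)\<^sup>2) \<partial>lborel) \<longlonglongrightarrow> 0"
  proof (rule nn_integral_dominated_convergence_norm[where w="\<lambda>x. (f x)\<^sup>2"])
    show "AE x in lborel. norm ((f x - U j x)\<^sup>2) \<le> (f x)\<^sup>2" for j
      using seq(2) le by (intro AE_I2) (auto intro!: power_mono)
    show "AE x in lborel. (\<lambda>i. (f x - U i x)\<^sup>2) \<longlonglongrightarrow> 0"
    proof (rule AE_I2)
      fix x
      have "(\<lambda>i. (f x - U i x)\<^sup>2) \<longlonglongrightarrow> (f x - f x)\<^sup>2"
        using seq(4)[of x] by (intro tendsto_intros) auto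
      then show "(\<lambda>i. (f x - U i x)\<^sup>2) \<longlonglongrightarrow> 0" by simp
    qed
  qed (use seq.prems in auto)
  then show ?case by (intro L2_shift_continuous_lim[OF _ _ c]) auto
qed

lemma L2_shift_continuous:
  fixes f :: "'a::euclidean_space \<Rightarrow> real"
  assumes [measurable]: "f \<in> borel_measurable borel" and i: "(\<integral>\<^sup>+x. ennreal ((f x)\<^sup>2) \<partial>lborel) < \<infinity>"
  shows "L2_shift_continuous f"
proof -
  have "(\<integral>\<^sup>+x. ennreal ((max 0 (s * f x))\<^sup>2) \<partial>lborel) \<le> (\<integral>\<^sup>+x. ennreal ((f x)\<^sup>2) \<partial>lborel)" if "s = 1 \<or> s = -1" for s :: real
    using that by (intro nn_integral_mono ennreal_leI) (auto simp: max_def)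
  then have "L2_shift_continuous (\<lambda>x. max 0 (s * f x))" if "s = 1 \<or> s = -1" for s :: real
    using that i by (intro L2_shift_continuous_nonneg) (auto intro: order_le_less_trans)
  from L2_shift_continuous_add[OF _ _ this[of 1] L2_shift_continuous_cmult[OF _ this[of "-1"], of "-1"]]
  have "L2_shift_continuous (\<lambda>x. max 0 (f x) + - max 0 (- f x))" by simp
  also have "(\<lambda>x. max 0 (f x) + - max 0 (- f x)) = f" by (auto simp: max_def)
  finally show ?thesis .
qed

section \<open>Convolution with test functions\<close>

lemma lebesgue_integral_reflect:
  fixes f :: "'a::euclidean_space \<Rightarrow> real"
  assumes "f \<in> borel_measurable borel"
  shows "(LINT y|lborel. f (x - y)) = (LINT y|lborel. f y)"
    and "(\<integral>\<^sup>+y. ennreal (f (x - y)) \<partial>lborel) = (\<integral>\<^sup>+y. ennreal (f y) \<partial>lborel)"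
    and "integrable lborel (\<lambda>y. f (x - y)) \<longleftrightarrow> integrable lborel f"
proof -
  have *: "lborel = distr lborel borel (\<lambda>y::'a. x - y)"
    using lborel_affine[of "-1" x] by (simp add: density_1)
  show "(LINT y|lborel. f (x - y)) = (LINT y|lborel. f y)"
    by (subst (2) *, subst integral_distr) (use assms in auto)
  show "(\<integral>\<^sup>+y. ennreal (f (x - y)) \<partial>lborel) = (\<integral>\<^sup>+y. ennreal (f y) \<partial>lborel)"
    by (subst (2) *, subst nn_integral_distr) (use assms in auto)
  show "integrable lborel (\<lambda>y. f (x - y)) \<longleftrightarrow> integrable lborel f"
    by (subst (2) *, subst integrable_distr_eq) (use assms in auto)
qed

lemma test_function_Lipschitz:
  assumes \<phi>: "test_function \<Omega> \<phi>"
  shows "\<exists>C\<ge>0. \<forall>x y. \<bar>\<phi> x - \<phi> y\<bar> \<le> C * norm (x - y)"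
proof -
  obtain C where C: "C \<ge> 0" "\<And>x. \<bar>\<phi> x\<bar> \<le> C \<and> norm (grad \<phi> x) \<le> C"
    using test_function_bounded[OF \<phi>] by blast
  have "\<bar>\<phi> x - \<phi> y\<bar> \<le> C * norm (x - y)" for x y
  proof -
    have "norm (\<phi> x - \<phi> y) \<le> C * norm (x - y)"
    proof (rule differentiable_bound[of UNIV])
      show "(\<phi> has_derivative (\<lambda>h. h \<bullet> grad \<phi> z)) (at z within UNIV)" for z
        by (rule has_derivative_at_withinI[OF has_derivative_grad[OF test_function_Ck[OF \<phi>]]])
      show "onorm (\<lambda>h. h \<bullet> grad \<phi> z) \<le> C" for z
      proof (rule onorm_bound)
        show "norm (h \<bullet> grad \<phi> z) \<le> C * norm h" for h
          using Cauchy_Schwarz_ineq2[of h "grad \<phi> z"] mult_left_mono[of "norm (grad \<phi> z)" C "norm h"] C(2)[of z]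
          by (simp add: mult.commute)
      qed (use C(1) in simp)
    qed auto
    then show ?thesis by simp
  qed
  then show ?thesis using C(1) by blast
qed

text \<open>The mean value theorem along the segment, then the Lipschitz bound for each partial
  derivative. A remainder uniform in x is what allows differentiating a convolution with a merely
  integrable function.\<close>

lemma test_function_Taylor:
  fixes \<phi> :: "'a::euclidean_space \<Rightarrow> real"
  assumes \<phi>: "test_function \<Omega> \<phi>"
  shows "\<exists>C\<ge>0. \<forall>x h. \<bar>\<phi> (x + h) - \<phi> x - h \<bullet> grad \<phi> x\<bar> \<le> C * (norm h)\<^sup>2"
proof -
  have "\<forall>b\<in>Basis. \<exists>C\<ge>0. \<forall>x y. \<bar>grad \<phi> x \<bullet> b - grad \<phi> y \<bullet> b\<bar> \<le> C * norm (x - y)"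
    using test_function_Lipschitz[OF test_function_grad[OF \<phi>]] by blast
  from bchoice[OF this] obtain C where CC: "\<forall>b\<in>Basis. C b \<ge> 0 \<and>
      (\<forall>x y. \<bar>grad \<phi> x \<bullet> b - grad \<phi> y \<bullet> b\<bar> \<le> C b * norm (x - y))" ..
  have C: "C b \<ge> 0" "\<bar>grad \<phi> x \<bullet> b - grad \<phi> y \<bullet> b\<bar> \<le> C b * norm (x - y)" if "b \<in> Basis" for b x y
    using CC that by auto
  have "\<bar>\<phi> (x + h) - \<phi> x - h \<bullet> grad \<phi> x\<bar> \<le> sum C Basis * (norm h)\<^sup>2" for x h
  proof -
    have der: "((\<lambda>t. \<phi> (t *\<^sub>R h + x)) has_real_derivative (grad \<phi> (t *\<^sub>R h + x) \<bullet> h)) (at t)" for t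
      unfolding has_field_derivative_def
      by (rule has_derivative_eq_rhs, rule has_derivative_compose[of "\<lambda>t. t *\<^sub>R h + x" "\<lambda>s. s *\<^sub>R h" t UNIV \<phi>])
         (auto intro!: derivative_eq_intros has_derivative_grad test_function_Ck[OF \<phi>] simp: inner_commute mult.commute)
    obtain t where t: "0 < t" "t < 1" "\<phi> (1 *\<^sub>R h + x) - \<phi> (0 *\<^sub>R h + x) = (1 - 0) * (grad \<phi> (t *\<^sub>R h + x) \<bullet> h)"
      using MVT2[OF zero_less_one der] by blast
    have "\<phi> (x + h) - \<phi> x - h \<bullet> grad \<phi> x = (grad \<phi> (t *\<^sub>R h + x) - grad \<phi> x) \<bullet> h"
      using t(3) by (simp add: add.commute inner_diff_left inner_commute[of h])
    also have "\<dots> = (\<Sum>b\<in>Basis. (grad \<phi> (t *\<^sub>R h + x) \<bullet> b - grad \<phi> x \<bullet> b) * (h \<bullet> b))"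
      by (subst euclidean_inner) (simp only: inner_diff_left)
    also have "\<bar>\<dots>\<bar> \<le> (\<Sum>b\<in>Basis. \<bar>(grad \<phi> (t *\<^sub>R h + x) \<bullet> b - grad \<phi> x \<bullet> b) * (h \<bullet> b)\<bar>)" by (rule sum_abs)
    also have "\<dots> \<le> (\<Sum>b\<in>Basis. C b * norm h * norm h)"
    proof (rule sum_mono)
      fix b :: 'a assume b: "b \<in> Basis"
      have "\<bar>grad \<phi> (t *\<^sub>R h + x) \<bullet> b - grad \<phi> x \<bullet> b\<bar> \<le> C b * norm (t *\<^sub>R h)"
        using C(2)[OF b, of "t *\<^sub>R h + x" x] by simp
      also have "\<dots> \<le> C b * norm h"
        using t C(1)[OF b] by (intro mult_left_mono) (auto simp: mult_left_le_one_le)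
      finally show "\<bar>(grad \<phi> (t *\<^sub>R h + x) \<bullet> b - grad \<phi> x \<bullet> b) * (h \<bullet> b)\<bar> \<le> C b * norm h * norm h"
        unfolding abs_mult using b C(1)[OF b] by (intro mult_mono Basis_le_norm) auto
    qed
    finally show ?thesis by (simp add: sum_distrib_right power2_eq_square mult.assoc)
  qed
  then show ?thesis using C(1) by (intro exI[of _ "sum C Basis"]) (auto intro: sum_nonneg)
qed

definition convolution :: "('a::euclidean_space \<Rightarrow> real) \<Rightarrow> ('a \<Rightarrow> real) \<Rightarrow> 'a \<Rightarrow> real" where
  "convolution \<rho> f x = (LINT y|lborel. \<rho> (x - y) * f y)"

lemma test_function_borel: "test_function \<Omega> \<phi> \<Longrightarrow> \<phi> \<in> borel_measurable borel"
  by (intro borel_measurable_continuous_onI Ck_continuous[OF test_function_Ck])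

lemma convolution_integrable:
  assumes \<rho>: "test_function \<Omega> \<rho>" and f: "integrable lborel f"
  shows "integrable lborel (\<lambda>y. \<rho> (x - y) * f y)"
proof -
  obtain C where C: "C \<ge> 0" "\<And>x. \<bar>\<rho> x\<bar> \<le> C" using test_function_bounded[OF \<rho>] by blast
  note [measurable] = test_function_borel[OF \<rho>] borel_measurable_integrable[OF f]
  show ?thesis
  proof (rule Bochner_Integration.integrable_bound)
    show "integrable lborel (\<lambda>y. C * f y)" using f by simp
    show "AE y in lborel. norm (\<rho> (x - y) * f y) \<le> norm (C * f y)"
      using C by (intro AE_I2) (auto simp: abs_mult intro!: mult_right_mono)
  qed measurable
qed

text \<open>Integrating the uniform Taylor remainder of \<rho> against f leaves an error of at most
  C |h|^2 times the L1 norm of f.\<close>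

lemma convolution_has_derivative:
  assumes \<rho>: "test_function \<Omega> \<rho>" and f: "integrable lborel f"
  shows "(convolution \<rho> f has_derivative (\<lambda>h. \<Sum>b\<in>Basis. (h \<bullet> b) * convolution (\<lambda>x. grad \<rho> x \<bullet> b) f x)) (at x)"
proof -
  obtain C where C: "C \<ge> 0" "\<And>x h. \<bar>\<rho> (x + h) - \<rho> x - h \<bullet> grad \<rho> x\<bar> \<le> C * (norm h)\<^sup>2"
    using test_function_Taylor[OF \<rho>] by blast
  define M where "M = (LINT y|lborel. \<bar>f y\<bar>)"
  have M: "M \<ge> 0" unfolding M_def by simp
  have bound: "\<bar>convolution \<rho> f (x + h) - convolution \<rho> f x - (\<Sum>b\<in>Basis. (h \<bullet> b) * convolution (\<lambda>x. grad \<rho> x \<bullet> b) f x)\<bar> \<le> C * (norm h)\<^sup>2 * M" for h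
  proof -
    have i: "integrable lborel (\<lambda>y. \<rho> (x + h - y) * f y)" "integrable lborel (\<lambda>y. \<rho> (x - y) * f y)"
      by (intro convolution_integrable[OF \<rho> f])+
    have ib: "integrable lborel (\<lambda>y. (grad \<rho> (x - y) \<bullet> b) * f y)" if "b \<in> Basis" for b
      by (rule convolution_integrable[OF test_function_grad[OF \<rho> that] f])
    have sum_eq: "(\<Sum>b\<in>Basis. (h \<bullet> b) * (g \<bullet> b * r)) = (h \<bullet> g) * r" for g :: 'a and r
      by (simp add: euclidean_inner[of h g] sum_distrib_right mult.assoc)
    have s: "(\<Sum>b\<in>Basis. (h \<bullet> b) * convolution (\<lambda>x. grad \<rho> x \<bullet> b) f x) = (LINT y|lborel. (h \<bullet> grad \<rho> (x - y)) * f y)"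
      "integrable lborel (\<lambda>y. (h \<bullet> grad \<rho> (x - y)) * f y)"
    proof -
      have "(\<Sum>b\<in>Basis. (h \<bullet> b) * convolution (\<lambda>x. grad \<rho> x \<bullet> b) f x) =
        (LINT y|lborel. (\<Sum>b\<in>Basis. (h \<bullet> b) * ((grad \<rho> (x - y) \<bullet> b) * f y)))"
        unfolding convolution_def using ib by (subst Bochner_Integration.integral_sum) auto
      then show "(\<Sum>b\<in>Basis. (h \<bullet> b) * convolution (\<lambda>x. grad \<rho> x \<bullet> b) f x) = (LINT y|lborel. (h \<bullet> grad \<rho> (x - y)) * f y)"
        by (simp only: sum_eq)
      have "integrable lborel (\<lambda>y. \<Sum>b\<in>Basis. (h \<bullet> b) * ((grad \<rho> (x - y) \<bullet> b) * f y))"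
        using ib by (intro Bochner_Integration.integrable_sum integrable_mult_right)
      then show "integrable lborel (\<lambda>y. (h \<bullet> grad \<rho> (x - y)) * f y)" by (simp only: sum_eq)
    qed
    have "convolution \<rho> f (x + h) - convolution \<rho> f x - (\<Sum>b\<in>Basis. (h \<bullet> b) * convolution (\<lambda>x. grad \<rho> x \<bullet> b) f x) =
      (LINT y|lborel. (\<rho> (x + h - y) - \<rho> (x - y) - h \<bullet> grad \<rho> (x - y)) * f y)"
      unfolding s(1) unfolding convolution_def using i s(2) by (simp add: left_diff_distrib)
    also have "\<bar>\<dots>\<bar> \<le> (LINT y|lborel. C * (norm h)\<^sup>2 * \<bar>f y\<bar>)"
    proof (rule integral_abs_bound_integral)
      show "integrable lborel (\<lambda>y. (\<rho> (x + h - y) - \<rho> (x - y) - h \<bullet> grad \<rho> (x - y)) * f y)"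
        using i s(2) by (simp add: left_diff_distrib)
      show "integrable lborel (\<lambda>y. C * (norm h)\<^sup>2 * \<bar>f y\<bar>)" using f by simp
      fix y
      show "\<bar>(\<rho> (x + h - y) - \<rho> (x - y) - h \<bullet> grad \<rho> (x - y)) * f y\<bar> \<le> C * (norm h)\<^sup>2 * \<bar>f y\<bar>"
        using C(2)[of "x - y" h] unfolding abs_mult by (intro mult_right_mono) (auto simp: algebra_simps)
    qed
    also have "\<dots> = C * (norm h)\<^sup>2 * M" by (simp add: M_def)
    finally show ?thesis .
  qed
  show ?thesis
    unfolding has_derivative_at_alt
  proof (intro conjI allI impI)
    show "bounded_linear (\<lambda>h. \<Sum>b\<in>Basis. (h \<bullet> b) * convolution (\<lambda>x. grad \<rho> x \<bullet> b) f x)"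
      by (intro bounded_linear_sum bounded_linear_mult_const bounded_linear_inner_left)
    fix e :: real assume e: "e > 0"
    define d where "d = e / (C * M + 1)"
    have CM: "C * M + 1 > 0" using C(1) M by (simp add: add_nonneg_pos)
    have d: "d > 0" "C * M * d \<le> e"
      using e CM C(1) M by (auto simp: d_def field_simps)
    show "\<exists>d>0. \<forall>y. norm (y - x) < d \<longrightarrow>
       norm (convolution \<rho> f y - convolution \<rho> f x - (\<Sum>b\<in>Basis. ((y - x) \<bullet> b) * convolution (\<lambda>x. grad \<rho> x \<bullet> b) f x)) \<le> e * norm (y - x)"
    proof (intro exI conjI allI impI)
      show "d > 0" by fact
      fix y assume y: "norm (y - x) < d"
      have "norm (convolution \<rho> f y - convolution \<rho> f x - (\<Sum>b\<in>Basis. ((y - x) \<bullet> b) * convolution (\<lambda>x. grad \<rho> x \<bullet> b) f x))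
         \<le> C * (norm (y - x))\<^sup>2 * M"
        using bound[of "y - x"] by simp
      also have "\<dots> = (C * M * norm (y - x)) * norm (y - x)" by (simp add: power2_eq_square)
      also have "\<dots> \<le> (C * M * d) * norm (y - x)"
        using y C(1) M by (intro mult_right_mono mult_left_mono) auto
      also have "\<dots> \<le> e * norm (y - x)" by (intro mult_right_mono d) simp
      finally show "norm (convolution \<rho> f y - convolution \<rho> f x - (\<Sum>b\<in>Basis. ((y - x) \<bullet> b) * convolution (\<lambda>x. grad \<rho> x \<bullet> b) f x))
        \<le> e * norm (y - x)" .
    qed
  qed
qed

lemma grad_convolution:
  assumes \<rho>: "test_function \<Omega> \<rho>" and f: "integrable lborel f" and b: "b \<in> Basis"
  shows "grad (convolution \<rho> f) x \<bullet> b = convolution (\<lambda>x. grad \<rho> x \<bullet> b) f x"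
proof -
  have "grad (convolution \<rho> f) x = (\<Sum>b\<in>Basis. convolution (\<lambda>x. grad \<rho> x \<bullet> b) f x *\<^sub>R b)"
    by (rule grad_eqI) (use convolution_has_derivative[OF \<rho> f, of x] in \<open>simp add: inner_sum_right mult.commute\<close>)
  then show ?thesis using b by (simp add: inner_sum_left inner_Basis if_distrib cong: if_cong)
qed

text \<open>All derivatives fall on \<rho>, whose partial derivatives are again test functions;
  hence the induction with \<rho> arbitrary.\<close>

lemma Ck_convolution:
  assumes "test_function \<Omega> \<rho>" and f: "integrable lborel f"
  shows "Ck k (convolution \<rho> f)"
  using assms(1)
proof (induction k arbitrary: \<rho>)
  case 0
  show ?case
    using has_derivative_continuous[OF convolution_has_derivative[OF 0 f]]
    by (simp add: continuous_at_imp_continuous_on)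
next
  case (Suc k)
  show ?case
    by (rule Ck_SucI[OF convolution_has_derivative[OF Suc.prems f]])
       (intro Suc.IH test_function_grad Suc.prems)
qed

lemma mollifier_exists:
  assumes "\<delta> > 0"
  shows "\<exists>\<rho>::'a::euclidean_space \<Rightarrow> real. test_function UNIV \<rho> \<and> (\<forall>x. \<rho> x \<ge> 0) \<and>
     (\<forall>x. norm x \<ge> \<delta> \<longrightarrow> \<rho> x = 0) \<and> (LINT x|lborel. \<rho> x) = 1"
proof -
  \<comment> \<open>Points of the box have all coordinates below c in absolute value, hence norm
    below \<delta> by the l1 bound.\<close>
  define c where "c = \<delta> / DIM('a)"
  have c: "c > 0" using assms by (simp add: c_def)
  define B where "B = box_bump 0 (- (c *\<^sub>R One)) (c *\<^sub>R (One::'a))"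
  have t: "test_function UNIV B" unfolding B_def by (rule test_box_bump) simp
  have i: "integrable lborel B"
  proof -
    obtain K where "compact K" "\<And>x. x \<notin> K \<Longrightarrow> B x = 0" using test_function_supp[OF t] by blast
    then show ?thesis
      by (intro integrable_continuous_compact_support[of B K] Ck_continuous[OF test_function_Ck[OF t]])
  qed
  have "(LINT x|lborel. B x) \<noteq> 0"
  proof
    assume "(LINT x|lborel. B x) = 0"
    then have "AE x in lborel. B x = 0"
      using i by (subst (asm) integral_nonneg_eq_0_iff_AE) (auto simp: B_def box_bump_bounds)
    then have "AE x in lborel. x \<notin> box (- (c *\<^sub>R One)) (c *\<^sub>R (One::'a))"
    proof eventually_elim
      case (elim x)
      then show ?case using box_bump_pos[of 0 "- (c *\<^sub>R One)" "c *\<^sub>R One" x] by (simp only: B_def) simp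
    qed
    then have "emeasure lborel (box (- (c *\<^sub>R One)) (c *\<^sub>R (One::'a))) = 0"
      by (subst (asm) AE_iff_measurable[OF _ refl]) auto
    moreover have "emeasure lborel (box (- (c *\<^sub>R One)) (c *\<^sub>R (One::'a))) = ennreal (\<Prod>b\<in>(Basis::'a set). c + c)"
      using c by (subst emeasure_lborel_box) (auto simp: inner_diff_left inner_add_left)
    moreover have "(\<Prod>b\<in>(Basis::'a set). c + c) > 0" using c by (intro prod_pos) auto
    ultimately show False using c by simp
  qed
  moreover have "(LINT x|lborel. B x) \<ge> 0" by (simp add: B_def box_bump_bounds)
  ultimately have I: "(LINT x|lborel. B x) > 0" by simp
  define \<rho> where "\<rho> x = inverse (LINT x|lborel. B x) * B x" for x
  have "\<rho> x = 0" if "norm x \<ge> \<delta>" for x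
  proof -
    have "x \<notin> box (- (c *\<^sub>R One)) (c *\<^sub>R One)"
    proof
      assume "x \<in> box (- (c *\<^sub>R One)) (c *\<^sub>R One)"
      then have "\<bar>x \<bullet> b\<bar> < c" if "b \<in> Basis" for b using that by (auto simp: box_def abs_less_iff)
      then have "(\<Sum>b\<in>Basis. \<bar>x \<bullet> b\<bar>) < (\<Sum>b\<in>(Basis::'a set). c)" by (intro sum_strict_mono) auto
      also have "\<dots> = \<delta>" by (simp add: c_def)
      finally show False using norm_le_l1[of x] that by simp
    qed
    then show ?thesis by (simp add: \<rho>_def B_def box_bump_zero)
  qed
  moreover have "test_function UNIV \<rho>" unfolding \<rho>_def by (rule test_function_cmult[OF t])
  moreover have "\<rho> x \<ge> 0" for x using I by (simp add: \<rho>_def B_def box_bump_bounds)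
  moreover have "(LINT x|lborel. \<rho> x) = 1" using I by (simp add: \<rho>_def)
  ultimately show ?thesis by blast
qed

text \<open>The error at x is an average of f (x - z) - f x with respect to the probability density
  \<rho>. Splitting \<rho> into two square roots, Cauchy-Schwarz moves the square inside the
  average; after Fubini the squared error is the \<rho>-average of \<open>shift_dist f z\<close>,
  where only short shifts count.\<close>

lemma convolution_L2_close:
  fixes f \<rho> :: "'a::euclidean_space \<Rightarrow> real"
  assumes \<rho>: "test_function UNIV \<rho>" "\<And>x. \<rho> x \<ge> 0" "\<And>x. norm x \<ge> \<delta> \<Longrightarrow> \<rho> x = 0" "(LINT x|lborel. \<rho> x) = 1"
    and f: "integrable lborel f" and sh: "\<And>z. norm z < \<delta> \<Longrightarrow> shift_dist f z \<le> \<epsilon>"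
  shows "(\<integral>\<^sup>+x. ennreal ((convolution \<rho> f x - f x)\<^sup>2) \<partial>lborel) \<le> \<epsilon>"
proof -
  note [measurable] = test_function_borel[OF \<rho>(1)]
  have [measurable]: "f \<in> borel_measurable borel" using borel_measurable_integrable[OF f] by simp
  obtain K where "compact K" "\<And>x. x \<notin> K \<Longrightarrow> \<rho> x = 0" using test_function_supp[OF \<rho>(1)] by blast
  then have i\<rho>: "integrable lborel \<rho>"
    by (intro integrable_continuous_compact_support[of \<rho> K] Ck_continuous[OF test_function_Ck[OF \<rho>(1)]])
  have \<rho>1: "(\<integral>\<^sup>+z. ennreal (\<rho> z) \<partial>lborel) = 1"
    using nn_integral_eq_integral[OF i\<rho>] \<rho>(2,4) by simp
  have pw: "ennreal ((convolution \<rho> f x - f x)\<^sup>2) \<le> (\<integral>\<^sup>+z. ennreal (\<rho> z * (f (x - z) - f x)\<^sup>2) \<partial>lborel)" for x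
  proof -
    have e: "convolution \<rho> f x = (LINT z|lborel. \<rho> z * f (x - z))"
      unfolding convolution_def using lebesgue_integral_reflect(1)[of "\<lambda>z. \<rho> z * f (x - z)" x] by simp
    have i1: "integrable lborel (\<lambda>z. \<rho> z * f (x - z))"
      using lebesgue_integral_reflect(3)[of "\<lambda>z. \<rho> z * f (x - z)" x] convolution_integrable[OF \<rho>(1) f, of x] by simp
    have i2: "integrable lborel (\<lambda>z. \<rho> z * f x)" using i\<rho> by simp
    have eq: "convolution \<rho> f x - f x = (LINT z|lborel. \<rho> z * (f (x - z) - f x))"
      using i1 i2 \<rho>(4) by (simp add: e right_diff_distrib)
    have i3: "integrable lborel (\<lambda>z. \<rho> z * (f (x - z) - f x))" using i1 i2 by (simp add: right_diff_distrib)
    have "ennreal (norm (convolution \<rho> f x - f x)) \<le> (\<integral>\<^sup>+z. ennreal (norm (\<rho> z * (f (x - z) - f x))) \<partial>lborel)"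
      unfolding eq by (rule integral_norm_bound_ennreal[OF i3])
    also have "\<dots> = (\<integral>\<^sup>+z. ennreal (sqrt (\<rho> z)) * ennreal (sqrt (\<rho> z) * \<bar>f (x - z) - f x\<bar>) \<partial>lborel)"
      using \<rho>(2) by (intro nn_integral_cong) (simp add: ennreal_mult[symmetric] abs_mult mult.assoc[symmetric])
    finally have "(ennreal (norm (convolution \<rho> f x - f x)))\<^sup>2 \<le>
      (\<integral>\<^sup>+z. ennreal (sqrt (\<rho> z)) * ennreal (sqrt (\<rho> z) * \<bar>f (x - z) - f x\<bar>) \<partial>lborel)\<^sup>2"
      by (intro power_mono) auto
    also have "\<dots> \<le> (\<integral>\<^sup>+z. (ennreal (sqrt (\<rho> z)))\<^sup>2 \<partial>lborel) *
       (\<integral>\<^sup>+z. (ennreal (sqrt (\<rho> z) * \<bar>f (x - z) - f x\<bar>))\<^sup>2 \<partial>lborel)"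
      by (rule Cauchy_Schwarz_nn_integral) measurable
    also have "(\<integral>\<^sup>+z. (ennreal (sqrt (\<rho> z)))\<^sup>2 \<partial>lborel) = 1"
      using \<rho>(2) by (simp add: ennreal_power \<rho>1)
    also have "(\<integral>\<^sup>+z. (ennreal (sqrt (\<rho> z) * \<bar>f (x - z) - f x\<bar>))\<^sup>2 \<partial>lborel) =
       (\<integral>\<^sup>+z. ennreal (\<rho> z * (f (x - z) - f x)\<^sup>2) \<partial>lborel)"
      using \<rho>(2) by (simp add: ennreal_power power_mult_distrib)
    finally show ?thesis by (simp add: ennreal_power)
  qed
  have "(\<integral>\<^sup>+x. ennreal ((convolution \<rho> f x - f x)\<^sup>2) \<partial>lborel) \<le>
     (\<integral>\<^sup>+x. \<integral>\<^sup>+z. ennreal (\<rho> z * (f (x - z) - f x)\<^sup>2) \<partial>lborel \<partial>lborel)"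
    by (intro nn_integral_mono pw)
  also have "\<dots> = (\<integral>\<^sup>+z. \<integral>\<^sup>+x. ennreal (\<rho> z * (f (x - z) - f x)\<^sup>2) \<partial>lborel \<partial>lborel)"
    by (intro lborel_pair.Fubini') measurable
  also have "\<dots> = (\<integral>\<^sup>+z. ennreal (\<rho> z) * shift_dist f z \<partial>lborel)"
    unfolding shift_dist_def using \<rho>(2)
    by (intro nn_integral_cong) (simp add: ennreal_mult nn_integral_cmult)
  also have "\<dots> \<le> (\<integral>\<^sup>+z. ennreal (\<rho> z) * \<epsilon> \<partial>lborel)"
  proof (intro nn_integral_mono)
    fix z show "ennreal (\<rho> z) * shift_dist f z \<le> ennreal (\<rho> z) * \<epsilon>"
      using \<rho>(3)[of z] sh[of z] by (cases "norm z < \<delta>") (auto intro!: mult_left_mono)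
  qed
  also have "\<dots> = \<epsilon>" by (simp add: nn_integral_multc \<rho>1)
  finally show ?thesis .
qed

section \<open>Cut-off and mollification\<close>

lemma has_weak_gradient_mult_test:
  assumes \<Omega>: "open \<Omega>" and u: "u \<in> L2 \<Omega>" "has_weak_gradient \<Omega> u g" and \<zeta>: "test_function UNIV \<zeta>"
  shows "(\<lambda>x. u x * \<zeta> x) \<in> L2 \<Omega>"
    and "has_weak_gradient \<Omega> (\<lambda>x. u x * \<zeta> x) (\<lambda>x. \<zeta> x *\<^sub>R g x + u x *\<^sub>R grad \<zeta> x)"
proof -
  note Ck = test_function_Ck[OF \<zeta>] and g = has_weak_gradient_L2[OF u(2)]
  obtain C where C: "\<And>x. \<bar>\<zeta> x\<bar> \<le> C \<and> norm (grad \<zeta> x) \<le> C" using test_function_bounded[OF \<zeta>] by blast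
  have m: "\<zeta> \<in> borel_measurable (lebesgue_on \<Omega>)" "grad \<zeta> \<in> borel_measurable (lebesgue_on \<Omega>)"
    by (intro continuous_measurable_lebesgue_on Ck_continuous[OF Ck] continuous_grad Ck)+
  have gm: "g \<in> borel_measurable (lebesgue_on \<Omega>)" using g by (simp add: L2_def)
  show "(\<lambda>x. u x * \<zeta> x) \<in> L2 \<Omega>"
    using L2_bounded_mult[OF u(1) m(1), of C] C by simp
  have ug: "(\<lambda>x. u x *\<^sub>R grad \<zeta> x) \<in> L2 \<Omega>"
    using L2_bounded_mult[OF u(1) m(2), of C] C by simp
  have cg: "(\<lambda>x. \<zeta> x *\<^sub>R g x) \<in> L2 \<Omega>"
  proof -
    have "integrable (lebesgue_on \<Omega>) (\<lambda>x. (norm (\<zeta> x *\<^sub>R g x))\<^sup>2)"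
    proof (rule Bochner_Integration.integrable_bound)
      show "integrable (lebesgue_on \<Omega>) (\<lambda>x. C\<^sup>2 * (norm (g x))\<^sup>2)" using g by (simp add: L2_def)
      have "(norm (\<zeta> x *\<^sub>R g x))\<^sup>2 \<le> C\<^sup>2 * (norm (g x))\<^sup>2" for x
        using C[of x] power_mono[of "\<bar>\<zeta> x\<bar>" C 2] by (auto simp: power_mult_distrib intro!: mult_right_mono)
      then show "AE x in lebesgue_on \<Omega>. norm ((norm (\<zeta> x *\<^sub>R g x))\<^sup>2) \<le> norm (C\<^sup>2 * (norm (g x))\<^sup>2)"
        by (intro AE_I2) simp
    qed (use m gm in measurable)
    then show ?thesis using m gm by (auto simp: L2_def)
  qed
  show "has_weak_gradient \<Omega> (\<lambda>x. u x * \<zeta> x) (\<lambda>x. \<zeta> x *\<^sub>R g x + u x *\<^sub>R grad \<zeta> x)"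
    unfolding has_weak_gradient_def
  proof (intro conjI allI impI ballI)
    show "(\<lambda>x. \<zeta> x *\<^sub>R g x + u x *\<^sub>R grad \<zeta> x) \<in> L2 \<Omega>" by (rule L2_add[OF cg ug])
    fix \<phi> b assume \<phi>: "test_function \<Omega> \<phi>" and b: "b \<in> (Basis :: 'a set)"
    note Ck\<phi> = test_function_Ck[OF \<phi>] and L = test_function_L2[OF \<Omega> \<phi>]
    \<comment> \<open>The product rule comes from testing the weak gradient of u with the product
      \<open>\<phi> x * \<zeta> x\<close>.\<close>
    have t: "test_function \<Omega> (\<lambda>x. \<phi> x * \<zeta> x)" by (rule test_function_mult[OF \<phi> Ck])
    have "(LINT x|lebesgue_on \<Omega>. u x * (grad (\<lambda>x. \<phi> x * \<zeta> x) x \<bullet> b)) = - (LINT x|lebesgue_on \<Omega>. (g x \<bullet> b) * (\<phi> x * \<zeta> x))"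
      by (rule has_weak_gradientD[OF u(2) t b])
    also have "(\<lambda>x. u x * (grad (\<lambda>x. \<phi> x * \<zeta> x) x \<bullet> b)) = (\<lambda>x. u x * \<zeta> x * (grad \<phi> x \<bullet> b) + ((u x *\<^sub>R grad \<zeta> x) \<bullet> b) * \<phi> x)"
      by (rule ext) (simp only: grad_mult[OF Ck\<phi> Ck], simp add: inner_add_left algebra_simps)
    also have "(LINT x|lebesgue_on \<Omega>. u x * \<zeta> x * (grad \<phi> x \<bullet> b) + ((u x *\<^sub>R grad \<zeta> x) \<bullet> b) * \<phi> x) =
      (LINT x|lebesgue_on \<Omega>. u x * \<zeta> x * (grad \<phi> x \<bullet> b)) + (LINT x|lebesgue_on \<Omega>. ((u x *\<^sub>R grad \<zeta> x) \<bullet> b) * \<phi> x)"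
      by (intro Bochner_Integration.integral_add L2_mult L2_inner_const ug L \<open>(\<lambda>x. u x * \<zeta> x) \<in> L2 \<Omega>\<close>)
    finally have 1: "(LINT x|lebesgue_on \<Omega>. u x * \<zeta> x * (grad \<phi> x \<bullet> b)) =
      - ((LINT x|lebesgue_on \<Omega>. (g x \<bullet> b) * (\<phi> x * \<zeta> x)) + (LINT x|lebesgue_on \<Omega>. ((u x *\<^sub>R grad \<zeta> x) \<bullet> b) * \<phi> x))"
      by simp
    have "(LINT x|lebesgue_on \<Omega>. ((\<zeta> x *\<^sub>R g x) \<bullet> b) * \<phi> x + ((u x *\<^sub>R grad \<zeta> x) \<bullet> b) * \<phi> x) =
      (LINT x|lebesgue_on \<Omega>. ((\<zeta> x *\<^sub>R g x) \<bullet> b) * \<phi> x) + (LINT x|lebesgue_on \<Omega>. ((u x *\<^sub>R grad \<zeta> x) \<bullet> b) * \<phi> x)"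
      by (intro Bochner_Integration.integral_add L2_mult L2_inner_const ug cg L)
    then show "(LINT x|lebesgue_on \<Omega>. u x * \<zeta> x * (grad \<phi> x \<bullet> b)) =
      - (LINT x|lebesgue_on \<Omega>. ((\<zeta> x *\<^sub>R g x + u x *\<^sub>R grad \<zeta> x) \<bullet> b) * \<phi> x)"
      unfolding 1 by (simp add: inner_add_left algebra_simps)
  qed
qed

text \<open>Any weak gradient at hand computes the Sobolev norm, so that the chosen
  \<open>wgrad\<close> can be avoided.\<close>

lemma energy_form_eqI:
  assumes "open \<Omega>" "d \<in> L2 \<Omega>" "has_weak_gradient \<Omega> d k"
  shows "energy_form \<Omega> 1 d d = (LINT x|lebesgue_on \<Omega>. (norm (k x))\<^sup>2 + (d x)\<^sup>2)"
    and "integrable (lebesgue_on \<Omega>) (\<lambda>x. (norm (k x))\<^sup>2 + (d x)\<^sup>2)"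
proof -
  have k: "k \<in> L2 \<Omega>" by (rule has_weak_gradient_L2[OF assms(3)])
  show "energy_form \<Omega> 1 d d = (LINT x|lebesgue_on \<Omega>. (norm (k x))\<^sup>2 + (d x)\<^sup>2)"
    unfolding energy_form_self
  proof (rule integral_cong_AE)
    show "AE x in lebesgue_on \<Omega>. (norm (wgrad \<Omega> d x))\<^sup>2 + 1 * (d x)\<^sup>2 = (norm (k x))\<^sup>2 + (d x)\<^sup>2"
      using wgrad_eqI[OF assms] by eventually_elim simp
  qed (use H1_measurable[OF H1I[OF assms(2,3)]] L2_measurable[OF k] in measurable)
  show "integrable (lebesgue_on \<Omega>) (\<lambda>x. (norm (k x))\<^sup>2 + (d x)\<^sup>2)"
    using k assms(2) by (simp add: L2_def)
qed

text \<open>A fixed bump with value 1 at the origin is stretched by 1 / h. The cut-offs tend to 1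
  pointwise and their gradients carry the factor h, so the error tends to 0 by dominated
  convergence.\<close>

lemma cutoff_approximation:
  fixes u :: "'a::euclidean_space \<Rightarrow> real"
  assumes u: "u \<in> H1 UNIV" and e: "\<epsilon> > 0"
  shows "\<exists>\<zeta>. test_function UNIV \<zeta> \<and> energy_form UNIV 1 (\<lambda>x. u x - u x * \<zeta> x) (\<lambda>x. u x - u x * \<zeta> x) < \<epsilon>"
proof -
  \<comment> \<open>The bump need not be 1 near the origin: its value 1 at 0 and continuity already
    give the pointwise limit.\<close>
  define \<zeta>0 where "\<zeta>0 x = inverse (box_bump 0 (- One) One (0::'a)) * box_bump 0 (- One) One x" for x :: 'a
  have t0: "test_function UNIV \<zeta>0" unfolding \<zeta>0_def by (intro test_function_cmult test_box_bump) simp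
  have "(0::'a) \<in> box (- One) One" by (auto simp: box_def)
  then have "box_bump 0 (- One) One (0::'a) > 0" by (simp add: box_bump_pos)
  then have \<zeta>00: "\<zeta>0 0 = 1" by (simp add: \<zeta>0_def)
  obtain K where K: "compact K" "\<And>x. x \<notin> K \<Longrightarrow> \<zeta>0 x = 0" using test_function_supp[OF t0] by blast
  obtain C where C: "C \<ge> 0" "\<And>x. \<bar>\<zeta>0 x\<bar> \<le> C \<and> norm (grad \<zeta>0 x) \<le> C" using test_function_bounded[OF t0] by blast
  define h where "h n = inverse (real (Suc n))" for n
  have h: "0 < h n" "h n \<le> 1" for n by (auto simp: h_def field_simps)
  have h0: "h \<longlonglongrightarrow> 0" unfolding h_def by (rule LIMSEQ_inverse_real_of_nat)
  define \<zeta> where "\<zeta> n x = \<zeta>0 (0 + h n *\<^sub>R x)" for n x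
  have t: "test_function UNIV (\<zeta> n)" for n
  proof (rule test_functionI[where K="(\<lambda>x. inverse (h n) *\<^sub>R x) ` K"])
    show "Ck k (\<zeta> n)" for k unfolding \<zeta>_def[abs_def] by (rule Ck_affine[OF test_function_Ck[OF t0]])
    show "compact ((\<lambda>x. inverse (h n) *\<^sub>R x) ` K)" by (rule compact_scaling[OF K(1)])
    fix x assume x: "x \<notin> (\<lambda>x. inverse (h n) *\<^sub>R x) ` K"
    have "h n *\<^sub>R x \<notin> K"
    proof
      assume "h n *\<^sub>R x \<in> K"
      then have "inverse (h n) *\<^sub>R (h n *\<^sub>R x) \<in> (\<lambda>x. inverse (h n) *\<^sub>R x) ` K" by (rule imageI)
      then show False using x h(1)[of n] by simp
    qed
    then show "\<zeta> n x = 0" using K(2) by (simp add: \<zeta>_def)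
  qed simp
  have g\<zeta>: "grad (\<zeta> n) x = h n *\<^sub>R grad \<zeta>0 (h n *\<^sub>R x)" for n x
    unfolding \<zeta>_def[abs_def] by (subst grad_affine[OF test_function_Ck[OF t0]]) simp
  note uL = H1_L2[OF u] and gL = wgrad_L2[OF u]
  let ?g = "wgrad UNIV u"
  let ?k = "\<lambda>n x. ?g x + (-1) *\<^sub>R (\<zeta> n x *\<^sub>R ?g x + u x *\<^sub>R grad (\<zeta> n) x)"
  have d: "(\<lambda>x. u x - u x * \<zeta> n x) \<in> L2 UNIV" "has_weak_gradient UNIV (\<lambda>x. u x - u x * \<zeta> n x) (?k n)" for n
  proof -
    note m = has_weak_gradient_mult_test[OF open_UNIV uL wgrad[OF u] t[of n]]
    show "(\<lambda>x. u x - u x * \<zeta> n x) \<in> L2 UNIV" by (rule L2_diff[OF uL m(1)])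
    show "has_weak_gradient UNIV (\<lambda>x. u x - u x * \<zeta> n x) (?k n)"
      using has_weak_gradient_add[OF open_UNIV uL L2_cmult[OF m(1), of "-1"] wgrad[OF u] has_weak_gradient_cmult[OF m(2), of "-1"]]
      by simp
  qed
  have "(\<lambda>n. LINT x|lebesgue_on UNIV. (norm (?k n x))\<^sup>2 + (u x - u x * \<zeta> n x)\<^sup>2) \<longlonglongrightarrow> (LINT x|lebesgue_on (UNIV::'a set). (0::real))"
  \<comment> \<open>Built from |1 - \<zeta>| \<le> 1 + C and |\<nabla>\<zeta>| \<le> C, both uniform
    in n because h \<le> 1.\<close>
  proof (rule integral_dominated_convergence[where w="\<lambda>x. 2 * ((1 + C)\<^sup>2 * (norm (?g x))\<^sup>2 + C\<^sup>2 * (u x)\<^sup>2) + (1 + C)\<^sup>2 * (u x)\<^sup>2"])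
    show "(\<lambda>x. (norm (?k n x))\<^sup>2 + (u x - u x * \<zeta> n x)\<^sup>2) \<in> borel_measurable (lebesgue_on UNIV)" for n
      using energy_form_eqI(2)[OF open_UNIV d] by (rule borel_measurable_integrable)
    show "integrable (lebesgue_on UNIV) (\<lambda>x. 2 * ((1 + C)\<^sup>2 * (norm (?g x))\<^sup>2 + C\<^sup>2 * (u x)\<^sup>2) + (1 + C)\<^sup>2 * (u x)\<^sup>2)"
      using uL gL by (simp add: L2_def)
    show "AE x in lebesgue_on UNIV. (\<lambda>n. (norm (?k n x))\<^sup>2 + (u x - u x * \<zeta> n x)\<^sup>2) \<longlonglongrightarrow> 0"
    proof (rule AE_I2)
      fix x :: 'a
      have hx: "(\<lambda>n. h n *\<^sub>R x) \<longlonglongrightarrow> 0 *\<^sub>R x" by (intro tendsto_intros h0)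
      have "isCont \<zeta>0 (0 *\<^sub>R x)" "isCont (grad \<zeta>0) (0 *\<^sub>R x)"
        using Ck_continuous[OF test_function_Ck[OF t0]] continuous_grad[OF test_function_Ck[OF t0]]
        by (simp_all add: continuous_on_eq_continuous_at)
      from this[THEN isCont_tendsto_compose, OF hx]
      have 1: "(\<lambda>n. \<zeta>0 (h n *\<^sub>R x)) \<longlonglongrightarrow> \<zeta>0 (0 *\<^sub>R x)" "(\<lambda>n. grad \<zeta>0 (h n *\<^sub>R x)) \<longlonglongrightarrow> grad \<zeta>0 (0 *\<^sub>R x)" .
      have "(\<lambda>n. (norm (?k n x))\<^sup>2 + (u x - u x * \<zeta> n x)\<^sup>2) \<longlonglongrightarrow>
        (norm (?g x + (-1) *\<^sub>R (\<zeta>0 (0 *\<^sub>R x) *\<^sub>R ?g x + u x *\<^sub>R (0 *\<^sub>R grad \<zeta>0 (0 *\<^sub>R x)))))\<^sup>2 + (u x - u x * \<zeta>0 (0 *\<^sub>R x))\<^sup>2"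
        unfolding g\<zeta> \<zeta>_def add_0_left by (intro tendsto_intros 1 h0)
      then show "(\<lambda>n. (norm (?k n x))\<^sup>2 + (u x - u x * \<zeta> n x)\<^sup>2) \<longlonglongrightarrow> 0"
        by (simp add: \<zeta>00)
    qed
    show "AE x in lebesgue_on UNIV. norm ((norm (?k n x))\<^sup>2 + (u x - u x * \<zeta> n x)\<^sup>2) \<le>
      2 * ((1 + C)\<^sup>2 * (norm (?g x))\<^sup>2 + C\<^sup>2 * (u x)\<^sup>2) + (1 + C)\<^sup>2 * (u x)\<^sup>2" for n
    proof (rule AE_I2)
      fix x :: 'a
      have b1: "\<bar>1 - \<zeta> n x\<bar> \<le> 1 + C" using C(2)[of "0 + h n *\<^sub>R x"] unfolding \<zeta>_def by linarith
      have b2: "norm (grad (\<zeta> n) x) \<le> C"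
      proof -
        have "norm (grad (\<zeta> n) x) = h n * norm (grad \<zeta>0 (h n *\<^sub>R x))" using h(1)[of n] by (simp add: g\<zeta>)
        also have "\<dots> \<le> 1 * C" using h[of n] C by (intro mult_mono) auto
        finally show ?thesis by simp
      qed
      have "norm (?k n x) = norm ((1 - \<zeta> n x) *\<^sub>R ?g x - u x *\<^sub>R grad (\<zeta> n) x)"
        by (simp add: algebra_simps)
      also have "\<dots> \<le> norm ((1 - \<zeta> n x) *\<^sub>R ?g x) + norm (u x *\<^sub>R grad (\<zeta> n) x)" by (rule norm_triangle_ineq4)
      also have "\<dots> \<le> (1 + C) * norm (?g x) + C * \<bar>u x\<bar>"
        using mult_right_mono[OF b1, of "norm (?g x)"] mult_left_mono[OF b2, of "\<bar>u x\<bar>"]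
        by (simp add: mult.commute)
      finally have "(norm (?k n x))\<^sup>2 \<le> ((1 + C) * norm (?g x) + C * \<bar>u x\<bar>)\<^sup>2"
        by (rule power_mono) simp
      also have "\<dots> \<le> 2 * ((1 + C)\<^sup>2 * (norm (?g x))\<^sup>2 + C\<^sup>2 * (u x)\<^sup>2)"
      proof -
        have "(a + b)\<^sup>2 \<le> 2 * (a\<^sup>2 + b\<^sup>2)" for a b :: real
          using sum_squares_bound[of a b] by (simp add: power2_sum)
        from this[of "(1 + C) * norm (?g x)" "C * \<bar>u x\<bar>"] show ?thesis
          by (simp only: power_mult_distrib power2_abs)
      qed
      finally have A: "(norm (?k n x))\<^sup>2 \<le> 2 * ((1 + C)\<^sup>2 * (norm (?g x))\<^sup>2 + C\<^sup>2 * (u x)\<^sup>2)" .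
      have "(u x - u x * \<zeta> n x)\<^sup>2 = \<bar>1 - \<zeta> n x\<bar>\<^sup>2 * (u x)\<^sup>2"
        by (simp add: power_mult_distrib[symmetric] algebra_simps)
      also have "\<dots> \<le> (1 + C)\<^sup>2 * (u x)\<^sup>2" by (intro mult_right_mono power_mono b1) auto
      finally show "norm ((norm (?k n x))\<^sup>2 + (u x - u x * \<zeta> n x)\<^sup>2) \<le>
        2 * ((1 + C)\<^sup>2 * (norm (?g x))\<^sup>2 + C\<^sup>2 * (u x)\<^sup>2) + (1 + C)\<^sup>2 * (u x)\<^sup>2"
        using A by simp
    qed
  qed simp
  then have "(\<lambda>n. energy_form UNIV 1 (\<lambda>x. u x - u x * \<zeta> n x) (\<lambda>x. u x - u x * \<zeta> n x)) \<longlonglongrightarrow> 0"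
    by (simp add: energy_form_eqI(1)[OF open_UNIV d])
  then have "\<forall>\<^sub>F n in sequentially. energy_form UNIV 1 (\<lambda>x. u x - u x * \<zeta> n x) (\<lambda>x. u x - u x * \<zeta> n x) < \<epsilon>"
    using e by (rule order_tendstoD(2))
  then obtain n where "energy_form UNIV 1 (\<lambda>x. u x - u x * \<zeta> n x) (\<lambda>x. u x - u x * \<zeta> n x) < \<epsilon>"
    by (auto simp: eventually_sequentially)
  then show ?thesis using t by blast
qed

lemma lebesgue_lborel_integral:
  fixes q q' p :: "'a::euclidean_space \<Rightarrow> real"
  assumes "q \<in> borel_measurable (lebesgue_on UNIV)" "q' \<in> borel_measurable borel" "p \<in> borel_measurable borel"
    "AE x in lborel. q x = q' x"
  shows "(LINT x|lebesgue_on UNIV. q x * p x) = (LINT x|lborel. q' x * p x)"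
proof -
  have "(LINT x|lebesgue_on UNIV. q x * p x) = (LINT x|lebesgue. q' x * p x)"
    unfolding lebesgue_on_UNIV_eq
  proof (rule integral_cong_AE)
    show "AE x in lebesgue. q x * p x = q' x * p x"
      using AE_completion[OF assms(4)] by eventually_elim simp
    have "p \<in> borel_measurable lebesgue" "q' \<in> borel_measurable lebesgue"
      using assms(2,3) by (auto intro!: measurable_completion)
    then show "(\<lambda>x. q x * p x) \<in> borel_measurable lebesgue" "(\<lambda>x. q' x * p x) \<in> borel_measurable lebesgue"
      using assms(1) by (auto simp: lebesgue_on_UNIV_eq)
  qed
  also have "\<dots> = (LINT x|lborel. q' x * p x)"
    using assms(2,3) by (intro integral_completion) simp
  finally show ?thesis .
qed

text \<open>Convolutions are formed with the Borel measure, whereas Sobolev functions are only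
  Lebesgue measurable; this passes between the two.\<close>

lemma integrable_Borel_representative:
  fixes f :: "'a::euclidean_space \<Rightarrow> real"
  assumes "integrable (lebesgue_on UNIV) f"
  shows "\<exists>f'. f' \<in> borel_measurable borel \<and> (AE x in lborel. f x = f' x) \<and> integrable lborel f'"
proof -
  have f: "integrable lebesgue f" using assms by (simp add: lebesgue_on_UNIV_eq)
  obtain f' where f': "f' \<in> borel_measurable lborel" "AE x in lborel. f x = f' x"
    using completion_ex_borel_measurable_real[OF borel_measurable_integrable[OF f]] by blast
  have "integrable lebesgue f'"
    by (rule integrable_cong_AE_imp[OF f measurable_completion[OF f'(1)] AE_completion[OF f'(2)]])
  then have "integrable lborel f'" using f'(1) by (simp add: integrable_completion)
  then show ?thesis using f' by (intro exI[of _ f']) simp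
qed

text \<open>The derivative of the convolution falls on the mollifier, and the definition of the weak
  gradient moves it to v; so the gradient of the mollified function is the mollified gradient, and
  \<open>convolution_L2_close\<close> applies to v and to every component of G.\<close>

lemma mollification:
  fixes v :: "'a::euclidean_space \<Rightarrow> real"
  assumes v: "v \<in> L2 UNIV" "has_weak_gradient UNIV v G"
    and iv: "integrable (lebesgue_on UNIV) v" "\<And>b. b \<in> Basis \<Longrightarrow> integrable (lebesgue_on UNIV) (\<lambda>x. G x \<bullet> b)"
    and K: "compact K" "\<And>x. x \<notin> K \<Longrightarrow> v x = 0" and e: "\<epsilon> > 0"
  shows "\<exists>\<phi>. test_function UNIV \<phi> \<and> energy_form UNIV 1 (\<lambda>x. v x - \<phi> x) (\<lambda>x. v x - \<phi> x) < \<epsilon>"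
proof -
  have GL: "G \<in> L2 UNIV" by (rule has_weak_gradient_L2[OF v(2)])
  obtain v0 where v0: "v0 \<in> borel_measurable borel" "AE x in lborel. v x = v0 x" "integrable lborel v0"
    using integrable_Borel_representative[OF iv(1)] by blast
  \<comment> \<open>The Borel representative agrees with v only almost everywhere; forcing it to
    vanish off K gives the convolution a compact support.\<close>
  define w where "w x = indicator K x * v0 x" for x
  have Kb: "K \<in> sets borel" using K(1) by (rule borel_compact)
  have w [measurable]: "w \<in> borel_measurable borel" unfolding w_def[abs_def] using v0(1) Kb by measurable
  have iw: "integrable lborel w"
    using integrable_mult_indicator[OF _ v0(3), of K] Kb unfolding w_def[abs_def] by simp
  have vw: "AE x in lborel. v x = w x"
    using v0(2) by eventually_elim (use K(2) in \<open>auto simp: w_def indicator_def\<close>)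
  have "\<forall>b\<in>Basis. \<exists>f'. f' \<in> borel_measurable borel \<and> (AE x in lborel. G x \<bullet> b = f' x) \<and> integrable lborel f'"
    using integrable_Borel_representative[OF iv(2)] by blast
  from bchoice[OF this] obtain F where F: "\<forall>b\<in>Basis. F b \<in> borel_measurable borel \<and> (AE x in lborel. G x \<bullet> b = F b x) \<and> integrable lborel (F b)" ..
  have L2_rep: "(\<integral>\<^sup>+x. ennreal ((f x)\<^sup>2) \<partial>lborel) < \<infinity>"
    if f: "f \<in> borel_measurable borel" "AE x in lborel. q x = f x" "q \<in> L2 UNIV" for f q :: "'a \<Rightarrow> real"
  proof -
    have "integrable lebesgue (\<lambda>x. (norm (q x))\<^sup>2)" using f(3) by (simp add: L2_def lebesgue_on_UNIV_eq)
    then have "(\<integral>\<^sup>+x. ennreal ((q x)\<^sup>2) \<partial>lborel) < \<infinity>"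
      by (simp add: integrable_iff_bounded nn_integral_completion)
    also have "(\<integral>\<^sup>+x. ennreal ((q x)\<^sup>2) \<partial>lborel) = (\<integral>\<^sup>+x. ennreal ((f x)\<^sup>2) \<partial>lborel)"
      by (rule nn_integral_cong_AE) (use f(2) in \<open>eventually_elim, simp\<close>)
    finally show ?thesis .
  qed
  \<comment> \<open>One share for each partial derivative and one for the function; the factor 2
    makes the final inequality strict.\<close>
  define \<eta> where "\<eta> = \<epsilon> / (2 * (real DIM('a) + 1))"
  have \<eta>: "\<eta> > 0" using e by (simp add: \<eta>_def)
  have "L2_shift_continuous w" by (rule L2_shift_continuous[OF w L2_rep[OF w vw v(1)]])
  then obtain \<delta>0 where \<delta>0: "\<delta>0 > 0" "\<And>z. norm z < \<delta>0 \<Longrightarrow> shift_dist w z \<le> ennreal \<eta>"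
    using \<eta> unfolding L2_shift_continuous_def by blast
  have "\<forall>b\<in>Basis. \<exists>\<delta>>0. \<forall>z. norm z < \<delta> \<longrightarrow> shift_dist (F b) z \<le> ennreal \<eta>"
  proof
    fix b :: 'a assume b: "b \<in> Basis"
    have "L2_shift_continuous (F b)"
      by (rule L2_shift_continuous[OF _ L2_rep[OF _ _ L2_inner_const[OF GL, of b]]]) (use F b in auto)
    then show "\<exists>\<delta>>0. \<forall>z. norm z < \<delta> \<longrightarrow> shift_dist (F b) z \<le> ennreal \<eta>"
      using \<eta> unfolding L2_shift_continuous_def by blast
  qed
  from bchoice[OF this] obtain \<Delta> where \<Delta>: "\<forall>b\<in>Basis. \<Delta> b > 0 \<and> (\<forall>z. norm z < \<Delta> b \<longrightarrow> shift_dist (F b) z \<le> ennreal \<eta>)" ..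
  define \<delta> where "\<delta> = Min (insert \<delta>0 (\<Delta> ` Basis))"
  have \<delta>: "\<delta> > 0" unfolding \<delta>_def using \<delta>0(1) \<Delta> by (subst Min_gr_iff) auto
  have \<delta>le: "\<delta> \<le> \<delta>0" "\<And>b. b \<in> Basis \<Longrightarrow> \<delta> \<le> \<Delta> b" unfolding \<delta>_def
    by (intro Min_le; simp)+
  obtain \<rho> :: "'a \<Rightarrow> real" where \<rho>: "test_function UNIV \<rho>" "\<And>x. \<rho> x \<ge> 0" "\<And>x. norm x \<ge> \<delta> \<Longrightarrow> \<rho> x = 0" "(LINT x|lborel. \<rho> x) = 1"
    using mollifier_exists[OF \<delta>] by blast
  define W where "W = convolution \<rho> w"
  have close: "(\<integral>\<^sup>+x. ennreal ((convolution \<rho> w x - w x)\<^sup>2) \<partial>lborel) \<le> ennreal \<eta>"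
    by (rule convolution_L2_close[OF \<rho> iw]) (use \<delta>0(2) \<delta>le(1) in auto)
  have closeF: "(\<integral>\<^sup>+x. ennreal ((convolution \<rho> (F b) x - F b x)\<^sup>2) \<partial>lborel) \<le> ennreal \<eta>" if b: "b \<in> Basis" for b
    by (rule convolution_L2_close[OF \<rho>]) (use F \<Delta> \<delta>le(2)[OF b] b in auto)
  have tW: "test_function UNIV W"
  proof (rule test_functionI[where K="{x + y |x y. x \<in> K \<and> y \<in> cball 0 \<delta>}"])
    show "Ck k W" for k unfolding W_def by (rule Ck_convolution[OF \<rho>(1) iw])
    show "compact {x + y |x y. x \<in> K \<and> y \<in> cball 0 \<delta>}" by (rule compact_sums[OF K(1) compact_cball])
    fix x assume x: "x \<notin> {x + y |x y. x \<in> K \<and> y \<in> cball 0 \<delta>}"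
    have "\<rho> (x - y) * w y = 0" for y
    proof (cases "y \<in> K")
      case True
      have "norm (x - y) \<ge> \<delta>"
      proof (rule ccontr)
        assume "\<not> norm (x - y) \<ge> \<delta>"
        then have "x = y + (x - y)" "x - y \<in> cball 0 \<delta>" by auto
        then show False using x True by blast
      qed
      then show ?thesis using \<rho>(3) by simp
    qed (simp add: w_def)
    then have "(\<lambda>y. \<rho> (x - y) * w y) = (\<lambda>y. 0)" by (intro ext)
    then show "W x = 0" unfolding W_def convolution_def by (simp only: Bochner_Integration.integral_zero)
  qed simp
  have gW: "grad W x \<bullet> b = convolution \<rho> (F b) x" if b: "b \<in> Basis" for x b
  proof -
    \<comment> \<open>The kernel as a function of its second variable is the test function with
      which the weak gradient is tested. The affine form is the one \<open>Ck_affine\<close> and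
      \<open>grad_affine\<close> expect.\<close>
    define \<phi> where "\<phi> y = \<rho> (x + (-1) *\<^sub>R y)" for y
    have t\<phi>: "test_function UNIV \<phi>"
    proof (rule test_functionI[where K="cball x \<delta>"])
      show "Ck k \<phi>" for k unfolding \<phi>_def[abs_def] by (rule Ck_affine[OF test_function_Ck[OF \<rho>(1)]])
      show "\<phi> y = 0" if "y \<notin> cball x \<delta>" for y using that \<rho>(3)[of "x - y"] by (simp add: \<phi>_def dist_norm)
    qed auto
    have g\<phi>: "grad \<phi> y = (-1) *\<^sub>R grad \<rho> (x + (-1) *\<^sub>R y)" for y
      unfolding \<phi>_def[abs_def] by (rule grad_affine[OF test_function_Ck[OF \<rho>(1)]])
    have m: "\<phi> \<in> borel_measurable borel" "(\<lambda>y. grad \<phi> y \<bullet> b) \<in> borel_measurable borel"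
      using test_function_borel[OF t\<phi>] test_function_borel[OF test_function_grad[OF t\<phi> b]] by auto
    have "grad W x \<bullet> b = (LINT y|lborel. (grad \<rho> (x - y) \<bullet> b) * w y)"
      unfolding W_def grad_convolution[OF \<rho>(1) iw b] convolution_def ..
    also have "\<dots> = - (LINT y|lborel. w y * (grad \<phi> y \<bullet> b))"
      by (simp add: g\<phi> mult.commute)
    also have "(LINT y|lborel. w y * (grad \<phi> y \<bullet> b)) = (LINT y|lebesgue_on UNIV. v y * (grad \<phi> y \<bullet> b))"
      by (rule lebesgue_lborel_integral[OF L2_measurable[OF v(1)] w m(2) vw, symmetric])
    also have "\<dots> = - (LINT y|lebesgue_on UNIV. (G y \<bullet> b) * \<phi> y)"
      by (rule has_weak_gradientD[OF v(2) t\<phi> b])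
    also have "(LINT y|lebesgue_on UNIV. (G y \<bullet> b) * \<phi> y) = (LINT y|lborel. F b y * \<phi> y)"
      by (rule lebesgue_lborel_integral[OF L2_measurable[OF L2_inner_const[OF GL]] _ m(1)]) (use F b in auto)
    also have "\<dots> = convolution \<rho> (F b) x" by (simp add: convolution_def \<phi>_def mult.commute)
    finally show ?thesis by simp
  qed
  have hW: "W \<in> L2 UNIV" "has_weak_gradient UNIV W (grad W)"
    by (rule test_function_L2(1)[OF open_UNIV tW], rule has_weak_gradient_test[OF open_UNIV tW])
  have d: "(\<lambda>x. v x - W x) \<in> L2 UNIV" "has_weak_gradient UNIV (\<lambda>x. v x - W x) (\<lambda>x. G x - grad W x)"
    using L2_diff[OF v(1) hW(1)]
      has_weak_gradient_add[OF open_UNIV v(1) L2_cmult[OF hW(1), of "-1"] v(2) has_weak_gradient_cmult[OF hW(2), of "-1"]]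
    by simp_all
  have "ennreal (energy_form UNIV 1 (\<lambda>x. v x - W x) (\<lambda>x. v x - W x)) =
    (\<integral>\<^sup>+x. ennreal ((norm (G x - grad W x))\<^sup>2 + (v x - W x)\<^sup>2) \<partial>lborel)"
    unfolding energy_form_eqI(1)[OF open_UNIV d]
    using nn_integral_eq_integral[OF energy_form_eqI(2)[OF open_UNIV d]]
    by (simp add: lebesgue_on_UNIV_eq nn_integral_completion)
  also have "\<dots> = (\<integral>\<^sup>+x. (\<Sum>b\<in>Basis. ennreal ((convolution \<rho> (F b) x - F b x)\<^sup>2)) + ennreal ((convolution \<rho> w x - w x)\<^sup>2) \<partial>lborel)"
  proof (rule nn_integral_cong_AE)
    have "AE x in lborel. \<forall>b\<in>Basis. G x \<bullet> b = F b x"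
      using F by (subst AE_ball_countable) (auto intro: countable_finite)
    with vw show "AE x in lborel. ennreal ((norm (G x - grad W x))\<^sup>2 + (v x - W x)\<^sup>2) =
      (\<Sum>b\<in>Basis. ennreal ((convolution \<rho> (F b) x - F b x)\<^sup>2)) + ennreal ((convolution \<rho> w x - w x)\<^sup>2)"
    proof eventually_elim
      case (elim x)
      have "(norm (G x - grad W x))\<^sup>2 = (\<Sum>b\<in>Basis. ((G x - grad W x) \<bullet> b)\<^sup>2)"
        by (subst power2_norm_eq_inner, subst euclidean_inner) (simp add: power2_eq_square)
      also have "\<dots> = (\<Sum>b\<in>Basis. (convolution \<rho> (F b) x - F b x)\<^sup>2)"
        using elim(2) by (intro sum.cong refl) (simp add: inner_diff_left gW power2_commute)
      finally show ?case
        using elim(1) by (simp add: W_def power2_commute sum_nonneg)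
    qed
  qed
  also have "\<dots> = (\<Sum>b\<in>Basis. \<integral>\<^sup>+x. ennreal ((convolution \<rho> (F b) x - F b x)\<^sup>2) \<partial>lborel) +
      (\<integral>\<^sup>+x. ennreal ((convolution \<rho> w x - w x)\<^sup>2) \<partial>lborel)"
  proof -
    have m: "convolution \<rho> f \<in> borel_measurable borel" if "integrable lborel f" for f
      by (rule borel_measurable_continuous_onI[OF Ck_continuous[OF Ck_convolution[OF \<rho>(1) that]]])
    have 1: "(\<lambda>x. ennreal ((convolution \<rho> (F b) x - F b x)\<^sup>2)) \<in> borel_measurable lborel" if "b \<in> Basis" for b
      using m[of "F b"] F that by auto
    have 2: "(\<lambda>x. ennreal ((convolution \<rho> w x - w x)\<^sup>2)) \<in> borel_measurable lborel"
      using m[OF iw] by auto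
    show ?thesis
      using 1 2 by (subst nn_integral_add, intro borel_measurable_sum) (auto simp: nn_integral_sum simp del: sum_ennreal)
  qed
  also have "\<dots> \<le> (\<Sum>b\<in>(Basis::'a set). ennreal \<eta>) + ennreal \<eta>"
    by (intro add_mono sum_mono closeF close)
  also have "\<dots> = ennreal (\<epsilon> / 2)"
  proof -
    have "(\<Sum>b\<in>(Basis::'a set). ennreal \<eta>) = ennreal (\<Sum>b\<in>(Basis::'a set). \<eta>)"
      using \<eta> by (intro sum_ennreal) auto
    also have "\<dots> + ennreal \<eta> = ennreal ((real DIM('a) + 1) * \<eta>)"
      using \<eta> by (subst ennreal_plus[symmetric]) (auto simp: distrib_right)
    also have "(real DIM('a) + 1) * \<eta> = \<epsilon> / 2" by (simp add: \<eta>_def field_simps)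
    finally show ?thesis .
  qed
  finally have "energy_form UNIV 1 (\<lambda>x. v x - W x) (\<lambda>x. v x - W x) \<le> \<epsilon> / 2"
    using e by (simp add: ennreal_le_iff)
  then show ?thesis using tW e by (intro exI[of _ W]) auto
qed

text \<open>Cutting off comes first: it provides the compact support, and makes the function and its
  gradient integrable as products of square integrable functions, which \<open>mollification\<close>
  requires.\<close>

lemma H1_UNIV_approximable:
  fixes u :: "'a::euclidean_space \<Rightarrow> real"
  assumes u: "u \<in> H1 UNIV"
  shows "approximable UNIV u"
  unfolding approximable_def
proof (intro conjI allI impI u)
  fix \<epsilon> :: real assume e: "\<epsilon> > 0"
  then have e4: "\<epsilon> / 4 > 0" by simp
  obtain \<zeta> where \<zeta>: "test_function UNIV \<zeta>" "energy_form UNIV 1 (\<lambda>x. u x - u x * \<zeta> x) (\<lambda>x. u x - u x * \<zeta> x) < \<epsilon> / 4"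
    using cutoff_approximation[OF u e4] by blast
  note m = has_weak_gradient_mult_test[OF open_UNIV H1_L2[OF u] wgrad[OF u] \<zeta>(1)]
  obtain K where K: "compact K" "\<And>x. x \<notin> K \<Longrightarrow> \<zeta> x = 0" using test_function_supp[OF \<zeta>(1)] by blast
  note L\<zeta> = test_function_L2[OF open_UNIV \<zeta>(1)]
  have "\<exists>\<phi>. test_function UNIV \<phi> \<and> energy_form UNIV 1 (\<lambda>x. u x * \<zeta> x - \<phi> x) (\<lambda>x. u x * \<zeta> x - \<phi> x) < \<epsilon> / 4"
  proof (rule mollification[OF m _ _ K(1) _ e4])
    show "integrable (lebesgue_on UNIV) (\<lambda>x. u x * \<zeta> x)" by (rule L2_mult[OF H1_L2[OF u] L\<zeta>(1)])
    show "u x * \<zeta> x = 0" if "x \<notin> K" for x using K(2)[OF that] by simp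
    fix b :: 'a assume "b \<in> Basis"
    have "integrable (lebesgue_on UNIV) (\<lambda>x. \<zeta> x * (wgrad UNIV u x \<bullet> b) + u x * (grad \<zeta> x \<bullet> b))"
      by (intro Bochner_Integration.integrable_add L2_mult L2_inner_const L\<zeta> wgrad_L2 H1_L2 u)
    then show "integrable (lebesgue_on UNIV) (\<lambda>x. (\<zeta> x *\<^sub>R wgrad UNIV u x + u x *\<^sub>R grad \<zeta> x) \<bullet> b)"
      by (simp add: inner_add_left)
  qed
  then obtain \<phi> where \<phi>: "test_function UNIV \<phi>" "energy_form UNIV 1 (\<lambda>x. u x * \<zeta> x - \<phi> x) (\<lambda>x. u x * \<zeta> x - \<phi> x) < \<epsilon> / 4" by blast
  have H: "(\<lambda>x. u x * \<zeta> x) \<in> H1 UNIV" by (rule H1I[OF m])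
  have "energy_form UNIV 1 (\<lambda>x. (u x - u x * \<zeta> x) + (u x * \<zeta> x - \<phi> x)) (\<lambda>x. (u x - u x * \<zeta> x) + (u x * \<zeta> x - \<phi> x)) < \<epsilon>"
    using energy_form_add_le[OF open_UNIV H1_diff[OF open_UNIV u H] H1_diff[OF open_UNIV H test_function_H1[OF open_UNIV \<phi>(1)]], of 1] \<zeta>(2) \<phi>(2)
    by simp
  then show "\<exists>\<phi>. test_function UNIV \<phi> \<and> energy_form UNIV 1 (\<lambda>x. u x - \<phi> x) (\<lambda>x. u x - \<phi> x) < \<epsilon>"
    using \<phi>(1) by (intro exI[of _ \<phi>]) simp
qed

section \<open>Embedding into the space of fourth powers\<close>

text \<open>Everything vanishes outside \<Omega>, so the integrals over \<Omega> are those of the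
  inequality on the whole space.\<close>

lemma test_function_L4_bound:
  fixes \<phi> :: "'a::euclidean_space \<Rightarrow> real"
  assumes D: "DIM('a) \<le> 3" and \<Omega>: "open \<Omega>" and \<phi>: "test_function \<Omega> \<phi>"
  shows "(\<integral>\<^sup>+x. ennreal ((\<phi> x)^4) \<partial>lebesgue_on \<Omega>) \<le> ennreal (4 * (energy_form \<Omega> 1 \<phi> \<phi>)\<^sup>2)"
proof -
  have S: "\<Omega> \<inter> space lebesgue \<in> sets lebesgue" using \<Omega> by auto
  obtain K where K: "K \<subseteq> \<Omega>" "\<And>x. x \<notin> K \<Longrightarrow> \<phi> x = 0 \<and> grad \<phi> x = 0"
    using test_function_supp[OF \<phi>] by blast
  have out: "\<phi> x = 0 \<and> grad \<phi> x = 0" if "x \<notin> \<Omega>" for x using K that by blast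
  have t: "test_function UNIV \<phi>" by (rule test_function_mono[OF \<phi>]) simp
  note w = has_weak_gradient_test[OF \<Omega> t]
  note L = test_function_L2[OF \<Omega> \<phi>]
  have res: "(\<integral>\<^sup>+x. f x \<partial>lebesgue_on \<Omega>) = (\<integral>\<^sup>+x. f x \<partial>lborel)" if "\<And>x. x \<notin> \<Omega> \<Longrightarrow> f x = 0" for f :: "'a \<Rightarrow> ennreal"
  proof -
    have "(\<integral>\<^sup>+x. f x \<partial>lebesgue_on \<Omega>) = (\<integral>\<^sup>+x. f x * indicator \<Omega> x \<partial>lebesgue)"
      by (rule nn_integral_restrict_space[OF S])
    also have "\<dots> = (\<integral>\<^sup>+x. f x \<partial>lebesgue)"
      by (rule nn_integral_cong) (use that in \<open>auto simp: indicator_def\<close>)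
    finally show ?thesis by (simp add: nn_integral_completion)
  qed
  have "(\<integral>\<^sup>+x. ennreal ((norm (grad \<phi> x))\<^sup>2 + (\<phi> x)\<^sup>2) \<partial>lborel) = ennreal (energy_form \<Omega> 1 \<phi> \<phi>)"
  proof -
    have "(\<integral>\<^sup>+x. ennreal ((norm (grad \<phi> x))\<^sup>2 + (\<phi> x)\<^sup>2) \<partial>lborel) =
       (\<integral>\<^sup>+x. ennreal ((norm (grad \<phi> x))\<^sup>2 + (\<phi> x)\<^sup>2) \<partial>lebesgue_on \<Omega>)"
      by (rule res[symmetric]) (use out in simp)
    also have "\<dots> = ennreal (energy_form \<Omega> 1 \<phi> \<phi>)"
      unfolding energy_form_eqI(1)[OF \<Omega> L(1) w]
      by (rule nn_integral_eq_integral[OF energy_form_eqI(2)[OF \<Omega> L(1) w]]) simp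
    finally show ?thesis .
  qed
  moreover have "(\<integral>\<^sup>+x. ennreal ((\<phi> x)^4) \<partial>lebesgue_on \<Omega>) = (\<integral>\<^sup>+x. ennreal ((\<phi> x)^4) \<partial>lborel)"
    by (rule res) (use out in simp)
  moreover have "4 * (ennreal (energy_form \<Omega> 1 \<phi> \<phi>))\<^sup>2 = ennreal (4 * (energy_form \<Omega> 1 \<phi> \<phi>)\<^sup>2)"
    by (simp add: ennreal_power energy_form_nonneg ennreal_mult)
  ultimately show ?thesis using sobolev_test_function[OF D t] by simp
qed

lemma approximable_test: "open \<Omega> \<Longrightarrow> test_function \<Omega> \<phi> \<Longrightarrow> approximable \<Omega> \<phi>"
  unfolding approximable_def
proof (intro conjI allI impI)
  assume \<Omega>: "open \<Omega>" and \<phi>: "test_function \<Omega> \<phi>"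
  show H: "\<phi> \<in> H1 \<Omega>" by (rule test_function_H1[OF \<Omega> \<phi>])
  fix \<epsilon> :: real assume e: "\<epsilon> > 0"
  have "energy_form \<Omega> 1 (\<lambda>x. \<phi> x - \<phi> x) (\<lambda>x. \<phi> x - \<phi> x) = 0"
    using energy_form_cmult_left[OF \<Omega> H H1_cmult[OF H, of 0], of 1 0] by simp
  then show "\<exists>\<psi>. test_function \<Omega> \<psi> \<and> energy_form \<Omega> 1 (\<lambda>x. \<phi> x - \<psi> x) (\<lambda>x. \<phi> x - \<psi> x) < \<epsilon>"
    using \<phi> e by (intro exI[of _ \<phi>]) simp
qed

lemma approximable_diff:
  assumes "open \<Omega>" "approximable \<Omega> u" "approximable \<Omega> v"
  shows "approximable \<Omega> (\<lambda>x. u x - v x)"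
  using approximable_add[OF assms(1,2) approximable_cmult[OF assms(1,3), of "-1"]] by simp

lemma approximable_sequence:
  assumes "approximable \<Omega> u"
  obtains \<phi> :: "nat \<Rightarrow> 'a::euclidean_space \<Rightarrow> real" where "\<And>n. test_function \<Omega> (\<phi> n)"
    "\<And>n. energy_form \<Omega> 1 (\<lambda>x. u x - \<phi> n x) (\<lambda>x. u x - \<phi> n x) \<le> inverse (real (Suc n))"
proof -
  have "\<forall>n. \<exists>\<phi>. test_function \<Omega> \<phi> \<and> energy_form \<Omega> 1 (\<lambda>x. u x - \<phi> x) (\<lambda>x. u x - \<phi> x) < inverse (real (Suc n))"
    using assms unfolding approximable_def by simp
  from choice[OF this] obtain \<phi> where \<phi>: "\<forall>n. test_function \<Omega> (\<phi> n) \<and>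
    energy_form \<Omega> 1 (\<lambda>x. u x - \<phi> n x) (\<lambda>x. u x - \<phi> n x) < inverse (real (Suc n))" ..
  have "test_function \<Omega> (\<phi> n)" "energy_form \<Omega> 1 (\<lambda>x. u x - \<phi> n x) (\<lambda>x. u x - \<phi> n x) \<le> inverse (real (Suc n))" for n
    using \<phi> by (auto intro: less_imp_le)
  then show thesis by (rule that)
qed

lemma L2_norm_le_energy_form:
  assumes "u \<in> H1 \<Omega>"
  shows "(LINT x|lebesgue_on \<Omega>. (u x)\<^sup>2) \<le> energy_form \<Omega> 1 u u"
  unfolding energy_form_self
  using H1_L2[OF assms] wgrad_L2[OF assms] by (intro integral_mono) (auto simp: L2_def)

text \<open>Fatou's lemma along a subsequence that converges almost everywhere. The constant 4
  becomes 16 because the squared norms of the approximants are bounded through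
  \<open>energy_form_add_le\<close>, which costs a factor 2 that is then squared.\<close>

lemma approximable_L4_nn:
  fixes u :: "'a::euclidean_space \<Rightarrow> real"
  assumes D: "DIM('a) \<le> 3" and \<Omega>: "open \<Omega>" and u: "approximable \<Omega> u"
  shows "(\<integral>\<^sup>+x. ennreal ((u x)^4) \<partial>lebesgue_on \<Omega>) \<le> ennreal (16 * (energy_form \<Omega> 1 u u)\<^sup>2)"
proof -
  obtain \<phi> where \<phi>: "\<And>n. test_function \<Omega> (\<phi> n)"
    "\<And>n. energy_form \<Omega> 1 (\<lambda>x. u x - \<phi> n x) (\<lambda>x. u x - \<phi> n x) \<le> inverse (real (Suc n))"
    using approximable_sequence[OF u] by blast
  note uH = approximable_H1[OF u]
  have \<phi>H: "\<phi> n \<in> H1 \<Omega>" for n by (rule test_function_H1[OF \<Omega> \<phi>(1)])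
  note dH = H1_diff[OF \<Omega> uH \<phi>H]
  have "\<exists>r::nat \<Rightarrow> nat. strict_mono r \<and> (AE x in lebesgue_on \<Omega>. (\<lambda>n. (u x - \<phi> (r n) x)\<^sup>2) \<longlonglongrightarrow> 0)"
  proof (rule tendsto_L1_AE_subseq)
    show "integrable (lebesgue_on \<Omega>) (\<lambda>x. (u x - \<phi> n x)\<^sup>2)" for n
      using H1_L2[OF dH[of n]] by (simp add: L2_def)
    show "(\<lambda>n. LINT x|lebesgue_on \<Omega>. norm ((u x - \<phi> n x)\<^sup>2)) \<longlonglongrightarrow> 0"
    proof (rule tendsto_sandwich[OF _ _ tendsto_const LIMSEQ_inverse_real_of_nat])
      show "\<forall>\<^sub>F n in sequentially. 0 \<le> (LINT x|lebesgue_on \<Omega>. norm ((u x - \<phi> n x)\<^sup>2))" by simp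
      show "\<forall>\<^sub>F n in sequentially. (LINT x|lebesgue_on \<Omega>. norm ((u x - \<phi> n x)\<^sup>2)) \<le> inverse (real (Suc n))"
        using order_trans[OF L2_norm_le_energy_form[OF dH] \<phi>(2)] by (intro always_eventually allI) simp
    qed
  qed
  then obtain r :: "nat \<Rightarrow> nat" where r: "strict_mono r" "AE x in lebesgue_on \<Omega>. (\<lambda>n. (u x - \<phi> (r n) x)\<^sup>2) \<longlonglongrightarrow> 0"
    by blast
  define c where "c n = 4 * (2 * energy_form \<Omega> 1 u u + 2 * inverse (real (Suc n)))\<^sup>2" for n
  have "c \<longlonglongrightarrow> 4 * (2 * energy_form \<Omega> 1 u u + 2 * 0)\<^sup>2"
    unfolding c_def[abs_def] by (intro tendsto_intros LIMSEQ_inverse_real_of_nat)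
  then have "(\<lambda>n. c (r n)) \<longlonglongrightarrow> 16 * (energy_form \<Omega> 1 u u)\<^sup>2"
    using LIMSEQ_subseq_LIMSEQ[OF _ r(1)] by (simp add: power_mult_distrib comp_def)
  then have lim: "(\<lambda>n. ennreal (c (r n))) \<longlonglongrightarrow> ennreal (16 * (energy_form \<Omega> 1 u u)\<^sup>2)"
    by (rule tendsto_ennrealI)
  have le: "(\<integral>\<^sup>+x. ennreal ((\<phi> n x)^4) \<partial>lebesgue_on \<Omega>) \<le> ennreal (c n)" for n
  proof -
    \<comment> \<open>The argument is \<open>\<phi> n\<close>, written as u minus the error.\<close>
    have "energy_form \<Omega> 1 (\<lambda>x. u x + (-1) * (u x - \<phi> n x)) (\<lambda>x. u x + (-1) * (u x - \<phi> n x))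
      \<le> 2 * energy_form \<Omega> 1 u u + 2 * energy_form \<Omega> 1 (\<lambda>x. (-1) * (u x - \<phi> n x)) (\<lambda>x. (-1) * (u x - \<phi> n x))"
      by (rule energy_form_add_le[OF \<Omega> uH H1_cmult[OF dH]]) simp
    also have "energy_form \<Omega> 1 (\<lambda>x. (-1) * (u x - \<phi> n x)) (\<lambda>x. (-1) * (u x - \<phi> n x)) = energy_form \<Omega> 1 (\<lambda>x. u x - \<phi> n x) (\<lambda>x. u x - \<phi> n x)"
      by (subst energy_form_cmult_left[OF \<Omega> dH H1_cmult[OF dH]], subst energy_form_cmult_right[OF \<Omega> dH dH]) simp
    finally have "energy_form \<Omega> 1 (\<phi> n) (\<phi> n) \<le> 2 * energy_form \<Omega> 1 u u + 2 * inverse (real (Suc n))"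
      using \<phi>(2)[of n] by simp
    then have "4 * (energy_form \<Omega> 1 (\<phi> n) (\<phi> n))\<^sup>2 \<le> c n"
      unfolding c_def using energy_form_nonneg[of 1 \<Omega> "\<phi> n"] by (intro mult_left_mono power_mono) auto
    then show ?thesis
      using test_function_L4_bound[OF D \<Omega> \<phi>(1)[of n]] by (meson ennreal_leI order_trans)
  qed
  have "(\<integral>\<^sup>+x. ennreal ((u x)^4) \<partial>lebesgue_on \<Omega>) \<le> (\<integral>\<^sup>+x. liminf (\<lambda>n. ennreal ((\<phi> (r n) x)^4)) \<partial>lebesgue_on \<Omega>)"
  proof (rule nn_integral_mono_AE)
    show "AE x in lebesgue_on \<Omega>. ennreal ((u x)^4) \<le> liminf (\<lambda>n. ennreal ((\<phi> (r n) x)^4))"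
      using r(2)
    proof eventually_elim
      case (elim x)
      then have "(\<lambda>n. sqrt ((u x - \<phi> (r n) x)\<^sup>2)) \<longlonglongrightarrow> sqrt 0" by (intro tendsto_intros)
      then have "(\<lambda>n. u x - \<phi> (r n) x) \<longlonglongrightarrow> 0" by (simp add: tendsto_rabs_zero_iff)
      then have "(\<lambda>n. u x - (u x - \<phi> (r n) x)) \<longlonglongrightarrow> u x - 0" by (intro tendsto_intros)
      then have "(\<lambda>n. ennreal ((\<phi> (r n) x)^4)) \<longlonglongrightarrow> ennreal ((u x)^4)"
        by (intro tendsto_ennrealI tendsto_intros) simp
      from lim_imp_Liminf[OF trivial_limit_sequentially this] show ?case by simp
    qed
  qed
  also have "\<dots> \<le> liminf (\<lambda>n. \<integral>\<^sup>+x. ennreal ((\<phi> (r n) x)^4) \<partial>lebesgue_on \<Omega>)"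
    by (rule nn_integral_liminf) (use H1_measurable(1)[OF \<phi>H] in measurable)
  also have "\<dots> \<le> liminf (\<lambda>n. ennreal (c (r n)))"
    by (intro Liminf_mono always_eventually allI le)
  also have "\<dots> = ennreal (16 * (energy_form \<Omega> 1 u u)\<^sup>2)"
    by (rule lim_imp_Liminf[OF trivial_limit_sequentially lim])
  finally show ?thesis .
qed

lemma approximable_L4:
  fixes u :: "'a::euclidean_space \<Rightarrow> real"
  assumes D: "DIM('a) \<le> 3" and \<Omega>: "open \<Omega>" and u: "approximable \<Omega> u"
  shows "integrable (lebesgue_on \<Omega>) (\<lambda>x. (u x)^4)" "(LINT x|lebesgue_on \<Omega>. (u x)^4) \<le> 16 * (energy_form \<Omega> 1 u u)\<^sup>2"
proof -
  note m = H1_measurable(1)[OF approximable_H1[OF u]]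
  show i: "integrable (lebesgue_on \<Omega>) (\<lambda>x. (u x)^4)"
    using order_le_less_trans[OF approximable_L4_nn[OF assms] ennreal_less_top] m
    by (subst integrable_iff_bounded) auto
  have "ennreal (LINT x|lebesgue_on \<Omega>. (u x)^4) \<le> ennreal (16 * (energy_form \<Omega> 1 u u)\<^sup>2)"
    using approximable_L4_nn[OF assms] by (subst nn_integral_eq_integral[OF i, symmetric]) auto
  then show "(LINT x|lebesgue_on \<Omega>. (u x)^4) \<le> 16 * (energy_form \<Omega> 1 u u)\<^sup>2"
    by (simp add: ennreal_le_iff)
qed

lemma integral_Cauchy_Schwarz:
  fixes f g :: "'a \<Rightarrow> real"
  assumes "f \<in> borel_measurable M" "g \<in> borel_measurable M"
    "integrable M (\<lambda>x. (f x)\<^sup>2)" "integrable M (\<lambda>x. (g x)\<^sup>2)"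
  shows "(LINT x|M. f x * g x)\<^sup>2 \<le> (LINT x|M. (f x)\<^sup>2) * (LINT x|M. (g x)\<^sup>2)"
proof (rule quadratic_nonneg_discriminant)
  fix t
  have i: "integrable M (\<lambda>x. f x * g x)" using sqint_inner[of f M g] assms by simp
  have "(LINT x|M. (f x + t * g x)\<^sup>2) = (LINT x|M. (f x)\<^sup>2 + 2 * t * (f x * g x) + t\<^sup>2 * (g x)\<^sup>2)"
    by (intro Bochner_Integration.integral_cong refl) (simp add: power2_eq_square algebra_simps)
  also have "\<dots> = (LINT x|M. (f x)\<^sup>2) + 2 * (LINT x|M. f x * g x) * t + (LINT x|M. (g x)\<^sup>2) * t\<^sup>2"
    using assms i by simp
  finally show "(LINT x|M. (f x)\<^sup>2) + 2 * (LINT x|M. f x * g x) * t + (LINT x|M. (g x)\<^sup>2) * t\<^sup>2 \<ge> 0"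
    using Bochner_Integration.integral_nonneg[of M "\<lambda>x. (f x + t * g x)\<^sup>2"] by simp
qed

lemma integrable_mult4:
  fixes a b c d :: "'a \<Rightarrow> real"
  assumes [measurable]: "a \<in> borel_measurable M" "b \<in> borel_measurable M" "c \<in> borel_measurable M" "d \<in> borel_measurable M"
    and "integrable M (\<lambda>x. (a x)^4)" "integrable M (\<lambda>x. (b x)^4)" "integrable M (\<lambda>x. (c x)^4)" "integrable M (\<lambda>x. (d x)^4)"
  shows "integrable M (\<lambda>x. a x * b x * c x * d x)"
proof (rule Bochner_Integration.integrable_bound)
  show "integrable M (\<lambda>x. (a x)^4 + (b x)^4 + (c x)^4 + (d x)^4)" using assms by auto
  have "\<bar>p * q * r * s\<bar> \<le> p^4 + q^4 + r^4 + s^4" for p q r s :: real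
  proof -
    have s2: "\<bar>y * z\<bar> \<le> y\<^sup>2 + z\<^sup>2" for y z :: real
    proof -
      have "2 * (\<bar>y\<bar> * \<bar>z\<bar>) \<le> y\<^sup>2 + z\<^sup>2" using sum_squares_bound[of "\<bar>y\<bar>" "\<bar>z\<bar>"] by (simp add: mult.assoc)
      moreover have "0 \<le> \<bar>y\<bar> * \<bar>z\<bar>" by simp
      ultimately show ?thesis unfolding abs_mult by linarith
    qed
    have s4: "(y * z)\<^sup>2 \<le> y^4 + z^4" for y z :: real
      using s2[of "y\<^sup>2" "z\<^sup>2"] by (simp add: power_mult_distrib flip: power_mult)
    have "\<bar>(p * q) * (r * s)\<bar> \<le> (p * q)\<^sup>2 + (r * s)\<^sup>2" by (rule s2)
    also have "\<dots> \<le> (p^4 + q^4) + (r^4 + s^4)" by (intro add_mono s4)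
    finally show ?thesis by (simp add: mult.assoc)
  qed
  then show "AE x in M. norm (a x * b x * c x * d x) \<le> norm ((a x)^4 + (b x)^4 + (c x)^4 + (d x)^4)"
    by (intro AE_I2) simp
qed measurable

section \<open>Spectrum of the coupling matrix\<close>

text \<open>On the unit sphere of S the quadratic form attains its maximum at an eigenvector v. Its
  orthogonal complement within S is invariant by symmetry and has smaller dimension.\<close>

lemma selfadjoint_orthonormal_eigenbasis:
  fixes f :: "'a::euclidean_space \<Rightarrow> 'a"
  assumes f: "linear f" and sym: "\<And>x y. f x \<bullet> y = x \<bullet> f y"
    and "subspace S" "\<And>x. x \<in> S \<Longrightarrow> f x \<in> S"
  shows "\<exists>B. finite B \<and> B \<subseteq> S \<and> pairwise orthogonal B \<and> (\<forall>b\<in>B. norm b = 1 \<and> (\<exists>d. f b = d *\<^sub>R b)) \<and> span B = S"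
  using assms(3,4)
proof (induction "dim S" arbitrary: S rule: less_induct)
  case less
  show ?case
  proof (cases "S = {0}")
    case True
    then show ?thesis by (intro exI[of _ "{}"]) auto
  next
    case False
    then obtain x0 where x0: "x0 \<in> S" "x0 \<noteq> 0" using subspace_0[OF less.prems(1)] by blast
    have "compact (S \<inter> sphere 0 1)"
      by (intro closed_Int_compact closed_subspace less.prems) auto
    moreover have "x0 /\<^sub>R norm x0 \<in> S \<inter> sphere 0 1"
      using x0 less.prems(1) by (auto simp: subspace_scale)
    moreover have "continuous_on (S \<inter> sphere 0 1) (\<lambda>x. x \<bullet> f x)"
      by (intro continuous_intros linear_continuous_on f[unfolded linear_conv_bounded_linear])
    ultimately obtain v where v: "v \<in> S \<inter> sphere 0 1" "\<And>y. y \<in> S \<inter> sphere 0 1 \<Longrightarrow> y \<bullet> f y \<le> v \<bullet> f v"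
      using continuous_attains_sup[of "S \<inter> sphere 0 1" "\<lambda>x. x \<bullet> f x"] by blast
    define \<mu> where "\<mu> = v \<bullet> f v"
    have vS: "v \<in> S" and v1: "v \<bullet> v = 1" using v(1) by (auto simp: dot_square_norm)
    have max: "x \<bullet> f x \<le> \<mu> * (x \<bullet> x)" if "x \<in> S" for x
    proof (cases "x = 0")
      case False
      have "x /\<^sub>R norm x \<in> S \<inter> sphere 0 1" using False that less.prems(1) by (auto simp: subspace_scale)
      from v(2)[OF this] have "(inverse (norm x))\<^sup>2 * (x \<bullet> f x) \<le> \<mu>"
        by (simp add: linear_cmul[OF f] \<mu>_def power2_eq_square mult.assoc)
      then have "(x \<bullet> f x) / (norm x)\<^sup>2 \<le> \<mu>" by (simp add: divide_inverse power_inverse mult.commute)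
      then show ?thesis
        using False pos_divide_le_eq[of "(norm x)\<^sup>2" "x \<bullet> f x" \<mu>] by (simp add: dot_square_norm)
    qed (simp add: linear_0[OF f])
    have orth: "w \<bullet> (f v - \<mu> *\<^sub>R v) = 0" if w: "w \<in> S" for w
    proof -
      \<comment> \<open>The quadratic in t is nonnegative by maximality and has constant term 0, so
        its linear coefficient vanishes.\<close>
      have "(\<mu> * (v \<bullet> w) - w \<bullet> f v)\<^sup>2 \<le> 0 * (\<mu> * (w \<bullet> w) - w \<bullet> f w)"
      proof (rule quadratic_nonneg_discriminant)
        fix t
        have "v + t *\<^sub>R w \<in> S" using vS w less.prems(1) by (auto intro: subspace_add subspace_scale)
        from max[OF this] have "0 \<le> \<mu> * ((v + t *\<^sub>R w) \<bullet> (v + t *\<^sub>R w)) - (v + t *\<^sub>R w) \<bullet> f (v + t *\<^sub>R w)" by simp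
        also have "\<dots> = \<mu> * (v \<bullet> v) - v \<bullet> f v + 2 * (\<mu> * (v \<bullet> w) - w \<bullet> f v) * t + (\<mu> * (w \<bullet> w) - w \<bullet> f w) * t\<^sup>2"
          using sym[of v w] by (simp add: linear_add[OF f] linear_cmul[OF f] inner_add_left inner_add_right
              inner_commute[of w v] inner_commute[of "f v" w] power2_eq_square algebra_simps)
        finally show "0 \<le> 0 + 2 * (\<mu> * (v \<bullet> w) - w \<bullet> f v) * t + (\<mu> * (w \<bullet> w) - w \<bullet> f w) * t\<^sup>2"
          by (simp add: v1 \<mu>_def)
      qed
      then show ?thesis by (simp add: inner_diff_right inner_commute[of w v])
    qed
    \<comment> \<open>This vector lies in S and is orthogonal to S, hence to itself.\<close>
    have "f v - \<mu> *\<^sub>R v \<in> S"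
      using vS less.prems by (auto intro: subspace_diff subspace_scale)
    from orth[OF this] have fv: "f v = \<mu> *\<^sub>R v" by simp
    define T where "T = {x \<in> S. v \<bullet> x = 0}"
    have T: "subspace T" "T \<subseteq> S"
      using less.prems(1) by (auto simp: T_def subspace_def inner_add_right)
    have Tf: "f x \<in> T" if "x \<in> T" for x
      using that less.prems(2) sym[of v x] by (auto simp: T_def fv)
    have "v \<notin> T" using v1 by (simp add: T_def)
    then have "T \<subset> S" using T(2) vS by blast
    then have "dim T < dim S"
      using T(1) less.prems(1) by (intro dim_psubset) (simp add: span_eq_iff[THEN iffD2])
    from less.hyps[OF this T(1) Tf] obtain B where B: "finite B" "B \<subseteq> T" "pairwise orthogonal B"
      "\<forall>b\<in>B. norm b = 1 \<and> (\<exists>d. f b = d *\<^sub>R b)" "span B = T" by blast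
    show ?thesis
    proof (intro exI[of _ "insert v B"] conjI)
      show "finite (insert v B)" using B(1) by simp
      show sub: "insert v B \<subseteq> S" using vS B(2) T(2) by blast
      show "pairwise orthogonal (insert v B)"
        using B(2,3) by (auto simp: pairwise_insert orthogonal_def T_def inner_commute)
      show "\<forall>b\<in>insert v B. norm b = 1 \<and> (\<exists>d. f b = d *\<^sub>R b)"
        using B(4) fv v(1) by auto
      show "span (insert v B) = S"
      proof
        show "span (insert v B) \<subseteq> S" by (rule span_minimal[OF sub less.prems(1)])
        show "S \<subseteq> span (insert v B)"
        proof
          fix x assume x: "x \<in> S"
          have "x - (v \<bullet> x) *\<^sub>R v \<in> T"
            using x vS less.prems(1) v1 by (auto simp: T_def inner_diff_right intro: subspace_diff subspace_scale)
          then have "x - (v \<bullet> x) *\<^sub>R v \<in> span B" by (simp add: B(5))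
          then show "x \<in> span (insert v B)" unfolding span_insert by blast
        qed
      qed
    qed
  qed
qed

section \<open>Diagonalization of symmetric matrices\<close>

lemma orthogonal_matrix_sums:
  fixes P :: "real^'n::finite^'n"
  assumes "orthogonal_matrix P"
  shows "(\<Sum>i\<in>UNIV. P $ i $ k * P $ i $ l) = (if k = l then 1 else 0)"
    and "(\<Sum>k\<in>UNIV. P $ i $ k * P $ j $ k) = (if i = j then 1 else 0)"
proof -
  have "(transpose P ** P) $ k $ l = (mat 1 :: real^'n^'n) $ k $ l" "(P ** transpose P) $ i $ j = (mat 1 :: real^'n^'n) $ i $ j"
    using assms by (simp_all add: orthogonal_matrix_def)
  then show "(\<Sum>i\<in>UNIV. P $ i $ k * P $ i $ l) = (if k = l then 1 else 0)"
    "(\<Sum>k\<in>UNIV. P $ i $ k * P $ j $ k) = (if i = j then 1 else 0)"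
    by (simp_all add: matrix_matrix_mult_def transpose_def mat_def)
qed

text \<open>A bijection indexes the eigenvectors by the coordinates themselves, so that they can be
  the columns of a square matrix.\<close>

lemma symmetric_matrix_diagonalization:
  fixes B :: "real^'n::finite^'n"
  assumes sym: "\<And>i j. B $ i $ j = B $ j $ i"
  shows "\<exists>(P::real^'n^'n) d. orthogonal_matrix P \<and>
     (\<forall>i j. B $ i $ j = (\<Sum>k\<in>UNIV. P $ i $ k * d k * P $ j $ k))"
proof -
  let ?f = "\<lambda>x. B *v x"
  have tr: "transpose B = B" using sym by (simp add: transpose_def vec_eq_iff)
  have s: "?f x \<bullet> y = x \<bullet> ?f y" for x y
    using dot_lmul_matrix[of x B y] tr by (metis transpose_matrix_vector inner_commute)
  obtain E where E: "finite E" "pairwise orthogonal E" "\<forall>b\<in>E. norm b = 1 \<and> (\<exists>d. ?f b = d *\<^sub>R b)" "span E = UNIV"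
    using selfadjoint_orthonormal_eigenbasis[of ?f UNIV, OF matrix_vector_mul_linear s] by auto
  have "0 \<notin> E" using E(3) by force
  then have ind: "independent E" using E(2) by (rule pairwise_orthogonal_independent[rotated])
  have "card E = CARD('n)" using dim_eq_card[of E UNIV] E(4) ind by simp
  then obtain e where e: "bij_betw e (UNIV::'n set) E"
    using finite_same_card_bij[of "UNIV::'n set" E] E(1) by auto
  have eE: "e k \<in> E" for k using e by (auto simp: bij_betw_def)
  have "\<forall>k. \<exists>d. ?f (e k) = d *\<^sub>R e k" using E(3) eE by blast
  from choice[OF this] obtain d where d: "\<And>k. ?f (e k) = d k *\<^sub>R e k" by blast
  define P :: "real^'n^'n" where "P = (\<chi> i k. e k $ i)"
  have ee: "e k \<bullet> e l = (if k = l then 1 else 0)" for k l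
  proof (cases "k = l")
    case True then show ?thesis using E(3) eE[of l] by (auto simp: dot_square_norm)
  next
    case False
    then have "e k \<noteq> e l" using e by (auto simp: bij_betw_def inj_on_def)
    then show ?thesis using E(2) eE False by (auto simp: pairwise_def orthogonal_def)
  qed
  have "transpose P ** P = mat 1"
    using ee by (auto simp: vec_eq_iff matrix_matrix_mult_def transpose_def P_def mat_def inner_vec_def)
  then have P: "orthogonal_matrix P" by (simp add: orthogonal_matrix)
  note PP = orthogonal_matrix_sums(2)[OF P]
  have BP: "(\<Sum>l\<in>UNIV. B $ i $ l * P $ l $ k) = d k * P $ i $ k" for i k
  proof -
    have "(B *v e k) $ i = (d k *\<^sub>R e k) $ i" by (simp only: d)
    then show ?thesis by (simp add: matrix_vector_mult_def P_def)
  qed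
  have "B $ i $ j = (\<Sum>k\<in>UNIV. P $ i $ k * d k * P $ j $ k)" for i j
  proof -
    have "(\<Sum>k\<in>UNIV. P $ i $ k * d k * P $ j $ k) = (\<Sum>k\<in>UNIV. (\<Sum>l\<in>UNIV. B $ i $ l * P $ l $ k) * P $ j $ k)"
      by (simp add: BP mult.commute)
    also have "\<dots> = (\<Sum>l\<in>UNIV. B $ i $ l * (\<Sum>k\<in>UNIV. P $ l $ k * P $ j $ k))"
      unfolding sum_distrib_right sum_distrib_left by (subst sum.swap) (simp add: mult.assoc)
    also have "\<dots> = B $ i $ j" by (simp add: PP if_distrib cong: if_cong)
    finally show ?thesis by simp
  qed
  then show ?thesis using P by blast
qed

lemma diagonalization_det_trace:
  fixes B P :: "real^'n::finite^'n"
  assumes P: "orthogonal_matrix P" and B: "\<And>i j. B $ i $ j = (\<Sum>k\<in>UNIV. P $ i $ k * d k * P $ j $ k)"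
  shows "det B = (\<Prod>k\<in>UNIV. d k)" "(\<Sum>i\<in>UNIV. B $ i $ i) = (\<Sum>k\<in>UNIV. d k)"
proof -
  define D :: "real^'n^'n" where "D = (\<chi> i j. if i = j then d i else 0)"
  have BD: "B = P ** D ** transpose P"
    by (simp add: vec_eq_iff matrix_matrix_mult_def transpose_def D_def B if_distrib mult.assoc cong: if_cong)
  have "det D = (\<Prod>k\<in>UNIV. d k)" by (subst det_diagonal) (auto simp: D_def)
  moreover have "det P * det P = 1"
    using P det_mul[of P "transpose P"] by (simp add: orthogonal_matrix_def det_transpose)
  ultimately show "det B = (\<Prod>k\<in>UNIV. d k)"
    unfolding BD det_mul det_transpose by (simp add: mult.assoc mult.left_commute)
  note PP = orthogonal_matrix_sums(1)[OF P]
  have "(\<Sum>i\<in>UNIV. B $ i $ i) = (\<Sum>k\<in>UNIV. d k * (\<Sum>i\<in>UNIV. P $ i $ k * P $ i $ k))"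
    unfolding B sum_distrib_left by (subst sum.swap) (simp add: mult_ac)
  then show "(\<Sum>i\<in>UNIV. B $ i $ i) = (\<Sum>k\<in>UNIV. d k)" by (simp add: PP)
qed

section \<open>Counting signs of eigenvalues\<close>

lemma prod_sign_negatives:
  fixes d :: "'n::finite \<Rightarrow> real"
  assumes "(\<Prod>k\<in>UNIV. d k) \<noteq> 0"
  shows "(\<Prod>k\<in>UNIV. d k) > 0 \<longleftrightarrow> even (card {k. d k < 0})"
    and "card {k. d k > 0} + card {k. d k < 0} = CARD('n)"
proof -
  have nz: "d k \<noteq> 0" for k using assms by (auto simp: prod_zero_iff)
  have U: "UNIV = {k. d k > 0} \<union> {k. d k < 0}" "{k. d k > 0} \<inter> {k. d k < 0} = {}"
    using nz by (auto simp: neq_iff)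
  show "card {k. d k > 0} + card {k. d k < 0} = CARD('n)"
    by (simp only: card_Un_disjoint[OF _ _ U(2), symmetric] finite U(1)[symmetric])
  have "(\<Prod>k\<in>UNIV. d k) = (\<Prod>k | d k > 0. d k) * (\<Prod>k | d k < 0. d k)"
    by (subst U(1), rule prod.union_disjoint) (use U(2) in auto)
  also have "(\<Prod>k | d k < 0. d k) = (\<Prod>k | d k < 0. (-1) * (- d k))" by simp
  also have "\<dots> = (-1) ^ card {k. d k < 0} * (\<Prod>k | d k < 0. - d k)"
    by (simp only: prod.distrib prod_constant)
  finally have e: "(\<Prod>k\<in>UNIV. d k) = (-1) ^ card {k. d k < 0} * ((\<Prod>k | d k > 0. d k) * (\<Prod>k | d k < 0. - d k))"
    by simp
  define p where "p = (\<Prod>k | d k > 0. d k) * (\<Prod>k | d k < 0. - d k)"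
  have "p > 0" unfolding p_def by (intro mult_pos_pos prod_pos) auto
  then show "(\<Prod>k\<in>UNIV. d k) > 0 \<longleftrightarrow> even (card {k. d k < 0})"
    unfolding e p_def[symmetric] by (cases "even (card {k. d k < 0})") auto
qed

text \<open>The number of positive values is n minus the number of negative ones, and the sign of
  the product fixes the parity of the latter. The two formulas say that there are at least two
  negative values in the even case and at least three in the odd case.\<close>

lemma count_positive_eigenvalues:
  fixes d :: "'n::finite \<Rightarrow> real"
  assumes n: "CARD('n) \<ge> 3" and lower: "\<And>k. d k \<ge> -1" and k1: "d k1 = 1" and tr: "(\<Sum>k\<in>UNIV. d k) = 0"
  shows "(\<Prod>k\<in>UNIV. d k) > 0 \<Longrightarrow> \<exists>l::nat. int (card {k. d k > 0}) = int CARD('n) - 2 - 2 * int l"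
    and "(\<Prod>k\<in>UNIV. d k) < 0 \<Longrightarrow> \<exists>l::nat. int (card {k. d k > 0}) = int CARD('n) - 3 - 2 * int l"
proof -
  have neg: "card {k. d k < 0} \<noteq> 0"
  proof
    assume "card {k. d k < 0} = 0"
    then have "\<forall>k. d k \<ge> 0" by (auto simp: not_less)
    then have "d k1 \<le> (\<Sum>k\<in>UNIV. d k)" by (intro member_le_sum) auto
    then show False using k1 tr by simp
  qed
  show "\<exists>l::nat. int (card {k. d k > 0}) = int CARD('n) - 2 - 2 * int l" if p: "(\<Prod>k\<in>UNIV. d k) > 0"
  proof -
    note sgn = prod_sign_negatives[OF less_imp_neq[OF p, THEN not_sym]]
    have "even (card {k. d k < 0})" using sgn(1) p by simp
    then obtain m where m: "card {k. d k < 0} = 2 * m" by (rule evenE)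
    then have "m \<ge> 1" using neg by simp
    \<comment> \<open>With 2 m negative values and m \<ge> 1, the witness is l = m - 1.\<close>
    then have "int (card {k. d k > 0}) = int CARD('n) - 2 - 2 * int (m - 1)"
      using sgn(2) m by (simp add: of_nat_diff)
    then show ?thesis by blast
  qed
  show "\<exists>l::nat. int (card {k. d k > 0}) = int CARD('n) - 3 - 2 * int l" if p: "(\<Prod>k\<in>UNIV. d k) < 0"
  proof -
    note sgn = prod_sign_negatives[OF less_imp_neq[OF p]]
    have "odd (card {k. d k < 0})" using sgn(1) p by simp
    then obtain m where m: "card {k. d k < 0} = 2 * m + 1" by (rule oddE)
    note c = sgn(2)
    have "m \<noteq> 0"
    proof
      assume "m = 0"
      then obtain j where j: "{k. d k < 0} = {j}" using m by (auto simp: card_1_singleton_iff)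
      \<comment> \<open>With a single negative value d j, at least two values are positive, one of
        them being 1. The remaining ones then sum to more than 1, but trace 0 makes this sum - d j,
        which is at most 1.\<close>
      have "card ({k. d k > 0} - {k1}) \<noteq> 0" using c j n k1 by (subst card_Diff_singleton) auto
      then obtain k2 where k2: "d k2 > 0" "k2 \<noteq> k1" by (auto simp: card_eq_0_iff)
      have dj: "d j < 0" using j by auto
      have rest: "d k \<ge> 0" if "k \<noteq> j" for k using j that by (auto simp: not_less[symmetric])
      have "d k1 + d k2 = (\<Sum>k\<in>{k1, k2}. d k)" using k2 by simp
      also have "\<dots> \<le> (\<Sum>k\<in>UNIV - {j}. d k)"
        using dj k1 k2 rest by (intro sum_mono2) auto
      also have "\<dots> = - d j" using tr by (simp add: sum.remove[of UNIV j d])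
      finally show False using lower[of j] k1 k2 by simp
    qed
    \<comment> \<open>With 2 m + 1 negative values and m \<ge> 1, again l = m - 1.\<close>
    then have "int (card {k. d k > 0}) = int CARD('n) - 3 - 2 * int (m - 1)"
      using c m by (simp add: of_nat_diff)
    then show ?thesis by blast
  qed
qed

text \<open>Scaling rows and columns of A by c makes the weighted row sums \<open>Ac\<close> into an
  eigenvector equation for a symmetric matrix, while the sign of the determinant and the zero
  diagonal survive.\<close>

lemma coupling_matrix_spectrum:
  fixes A :: "real^'n::finite^'n" and c :: "'n \<Rightarrow> real"
  assumes n: "CARD('n) \<ge> 3" and sym: "\<And>i j. A $ i $ j = A $ j $ i" and nn: "\<And>i j. A $ i $ j \<ge> 0"
    and diag: "\<And>i. A $ i $ i = 0" and c: "\<And>i. c i > 0" and Ac: "\<And>i. (\<Sum>j\<in>UNIV. A $ i $ j * (c j)\<^sup>2) = 1"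
  obtains P :: "real^'n^'n" and d where "orthogonal_matrix P"
    "\<And>i j. A $ i $ j * c i * c j = (\<Sum>k\<in>UNIV. P $ i $ k * d k * P $ j $ k)" "\<And>k. d k \<le> 1"
    "det A > 0 \<Longrightarrow> \<exists>l::nat. int (card {k. d k > 0}) = int CARD('n) - 2 - 2 * int l"
    "det A < 0 \<Longrightarrow> \<exists>l::nat. int (card {k. d k > 0}) = int CARD('n) - 3 - 2 * int l"
proof -
  define B :: "real^'n^'n" where "B = (\<chi> i j. A $ i $ j * c i * c j)"
  have Bs: "B $ i $ j = B $ j $ i" for i j using sym[of i j] by (simp add: B_def mult_ac)
  obtain P d where P: "orthogonal_matrix P" and Bd: "\<And>i j. B $ i $ j = (\<Sum>k\<in>UNIV. P $ i $ k * d k * P $ j $ k)"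
    using symmetric_matrix_diagonalization[of B] Bs by blast
  note dt = diagonalization_det_trace[OF P Bd]
  note PtP = orthogonal_matrix_sums(1)[OF P]
  note PPt = orthogonal_matrix_sums(2)[OF P]
  have BP: "(\<Sum>j\<in>UNIV. B $ i $ j * P $ j $ k) = d k * P $ i $ k" for i k
  proof -
    have "(\<Sum>j\<in>UNIV. B $ i $ j * P $ j $ k) = (\<Sum>l\<in>UNIV. P $ i $ l * d l * (\<Sum>j\<in>UNIV. P $ j $ l * P $ j $ k))"
      unfolding Bd sum_distrib_left sum_distrib_right by (subst sum.swap) (simp add: mult.assoc)
    then show ?thesis by (simp add: PtP if_distrib mult.commute cong: if_cong)
  qed
  have quad: "d k = (\<Sum>i\<in>UNIV. \<Sum>j\<in>UNIV. B $ i $ j * (P $ i $ k * P $ j $ k))" for k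
  proof -
    have "(\<Sum>i\<in>UNIV. \<Sum>j\<in>UNIV. B $ i $ j * (P $ i $ k * P $ j $ k)) = (\<Sum>i\<in>UNIV. P $ i $ k * (\<Sum>j\<in>UNIV. B $ i $ j * P $ j $ k))"
      unfolding sum_distrib_left by (simp add: mult_ac)
    also have "\<dots> = d k * (\<Sum>i\<in>UNIV. P $ i $ k * P $ i $ k)"
      unfolding BP sum_distrib_left by (simp add: mult_ac)
    finally show ?thesis by (simp add: PtP)
  qed
  have bound: "\<bar>d k\<bar> \<le> 1" for k
  proof -
    let ?x = "\<lambda>i. P $ i $ k"
    \<comment> \<open>The factor c j is paired with the i-th entry and c i with the j-th, so that
      summing over the other index produces exactly the row sums equal to 1.\<close>
    have young: "\<bar>B $ i $ j * (?x i * ?x j)\<bar> \<le> (A $ i $ j * (c j)\<^sup>2 * (?x i)\<^sup>2 + A $ j $ i * (c i)\<^sup>2 * (?x j)\<^sup>2) / 2" for i j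
    proof -
      have "2 * (c j * \<bar>?x i\<bar>) * (c i * \<bar>?x j\<bar>) \<le> (c j * \<bar>?x i\<bar>)\<^sup>2 + (c i * \<bar>?x j\<bar>)\<^sup>2" by (rule sum_squares_bound)
      then have "A $ i $ j * (2 * (c j * \<bar>?x i\<bar>) * (c i * \<bar>?x j\<bar>)) \<le> A $ i $ j * ((c j * \<bar>?x i\<bar>)\<^sup>2 + (c i * \<bar>?x j\<bar>)\<^sup>2)"
        by (rule mult_left_mono[OF _ nn])
      moreover have "\<bar>B $ i $ j * (?x i * ?x j)\<bar> = A $ i $ j * c i * c j * (\<bar>?x i\<bar> * \<bar>?x j\<bar>)"
        using nn[of i j] c[of i] c[of j] by (simp add: B_def abs_mult)
      ultimately show ?thesis using sym[of j i] by (simp add: power_mult_distrib algebra_simps)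
    qed
    have "\<bar>d k\<bar> \<le> (\<Sum>i\<in>UNIV. \<bar>\<Sum>j\<in>UNIV. B $ i $ j * (?x i * ?x j)\<bar>)" unfolding quad[of k] by (rule sum_abs)
    also have "\<dots> \<le> (\<Sum>i\<in>UNIV. \<Sum>j\<in>UNIV. \<bar>B $ i $ j * (?x i * ?x j)\<bar>)" by (intro sum_mono sum_abs)
    also have "\<dots> \<le> (\<Sum>i\<in>UNIV. \<Sum>j\<in>UNIV. (A $ i $ j * (c j)\<^sup>2 * (?x i)\<^sup>2 + A $ j $ i * (c i)\<^sup>2 * (?x j)\<^sup>2) / 2)"
      by (intro sum_mono young)
    also have "\<dots> = ((\<Sum>i\<in>UNIV. \<Sum>j\<in>UNIV. A $ i $ j * (c j)\<^sup>2 * (?x i)\<^sup>2) + (\<Sum>i\<in>UNIV. \<Sum>j\<in>UNIV. A $ j $ i * (c i)\<^sup>2 * (?x j)\<^sup>2)) / 2"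
      by (simp add: sum.distrib sum_divide_distrib add_divide_distrib)
    also have "(\<Sum>i\<in>UNIV. \<Sum>j\<in>UNIV. A $ j $ i * (c i)\<^sup>2 * (?x j)\<^sup>2) = (\<Sum>i\<in>UNIV. \<Sum>j\<in>UNIV. A $ i $ j * (c j)\<^sup>2 * (?x i)\<^sup>2)"
      by (rule sum.swap)
    also have "(\<Sum>i\<in>UNIV. \<Sum>j\<in>UNIV. A $ i $ j * (c j)\<^sup>2 * (?x i)\<^sup>2) = (\<Sum>i\<in>UNIV. (?x i)\<^sup>2)"
      by (simp add: sum_distrib_right[symmetric] Ac)
    also have "\<dots> = 1" using PtP[of k k] by (simp add: power2_eq_square)
    finally show ?thesis by simp
  qed
  have "\<exists>k1. d k1 = 1"
  proof (rule ccontr)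
    assume no: "\<nexists>k1. d k1 = 1"
    \<comment> \<open>The coordinates of c in the eigenbasis. From B c = c they satisfy y k = d k *
      y k, so all vanish if no eigenvalue is 1, contradicting c > 0.\<close>
    define y where "y k = (\<Sum>i\<in>UNIV. P $ i $ k * c i)" for k
    have Bc: "(\<Sum>j\<in>UNIV. B $ i $ j * c j) = c i" for i
    proof -
      have "(\<Sum>j\<in>UNIV. B $ i $ j * c j) = c i * (\<Sum>j\<in>UNIV. A $ i $ j * (c j)\<^sup>2)"
        unfolding sum_distrib_left by (simp add: B_def power2_eq_square mult_ac)
      then show ?thesis by (simp add: Ac)
    qed
    have "y k = 0" for k
    proof -
      have "y k = (\<Sum>i\<in>UNIV. \<Sum>j\<in>UNIV. P $ i $ k * (B $ i $ j * c j))"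
        unfolding y_def sum_distrib_left[symmetric] by (simp add: Bc)
      also have "\<dots> = (\<Sum>j\<in>UNIV. \<Sum>i\<in>UNIV. P $ i $ k * (B $ i $ j * c j))" by (rule sum.swap)
      also have "\<dots> = (\<Sum>j\<in>UNIV. (\<Sum>i\<in>UNIV. B $ j $ i * P $ i $ k) * c j)"
      proof -
        have "P $ i $ k * (B $ i $ j * c j) = B $ j $ i * P $ i $ k * c j" for i j using Bs[of i j] by simp
        then show ?thesis by (simp only: sum_distrib_right)
      qed
      also have "\<dots> = d k * y k" unfolding BP y_def sum_distrib_left by (simp add: mult_ac)
      finally show ?thesis using no by simp
    qed
    moreover have "(\<Sum>k\<in>UNIV. P $ i $ k * y k) = c i" for i
    proof -
      have "(\<Sum>k\<in>UNIV. P $ i $ k * y k) = (\<Sum>j\<in>UNIV. (\<Sum>k\<in>UNIV. P $ i $ k * P $ j $ k) * c j)"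
        unfolding y_def sum_distrib_left sum_distrib_right by (subst sum.swap) (simp add: mult_ac)
      then show ?thesis by (simp add: PPt if_distrib[of "\<lambda>x. x * _"] cong: if_cong)
    qed
    ultimately show False using c by simp
  qed
  then obtain k1 where k1: "d k1 = 1" ..
  have tr: "(\<Sum>k\<in>UNIV. d k) = 0" using dt(2) by (simp add: B_def diag)
  have lower: "d k \<ge> -1" for k using bound[of k] by simp
  \<comment> \<open>B arises from A by multiplying with the diagonal matrix of c on both
    sides.\<close>
  have "det B = det A * (\<Prod>i\<in>UNIV. c i)\<^sup>2"
  proof -
    define C :: "real^'n^'n" where "C = (\<chi> i j. if i = j then c i else 0)"
    have l: "(\<Sum>k\<in>UNIV. C $ i $ k * y k) = c i * y i" for i y
    proof -
      have "(\<Sum>k\<in>UNIV. C $ i $ k * y k) = (\<Sum>k\<in>UNIV. if i = k then c i * y i else 0)"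
        by (rule sum.cong) (auto simp: C_def)
      then show ?thesis by simp
    qed
    have r: "(\<Sum>k\<in>UNIV. y k * C $ k $ j) = y j * c j" for j y
    proof -
      have "(\<Sum>k\<in>UNIV. y k * C $ k $ j) = (\<Sum>k\<in>UNIV. if k = j then y j * c j else 0)"
        by (rule sum.cong) (auto simp: C_def)
      then show ?thesis by simp
    qed
    have "B = C ** A ** C"
      by (simp add: vec_eq_iff matrix_matrix_mult_def l r B_def)
    moreover have "det C = (\<Prod>i\<in>UNIV. c i)" by (subst det_diagonal) (auto simp: C_def)
    ultimately show ?thesis by (simp add: det_mul power2_eq_square)
  qed
  moreover have "(\<Prod>i\<in>UNIV. c i)\<^sup>2 > 0" using c by (intro zero_less_power prod_pos) simp
  ultimately have sg: "det A > 0 \<Longrightarrow> (\<Prod>k\<in>UNIV. d k) > 0" "det A < 0 \<Longrightarrow> (\<Prod>k\<in>UNIV. d k) < 0"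
    unfolding dt(1)[symmetric] by (auto simp: zero_less_mult_iff mult_less_0_iff)
  note count = count_positive_eigenvalues(1)[OF n lower k1 tr, OF sg(1)] count_positive_eigenvalues(2)[OF n lower k1 tr, OF sg(2)]
  show thesis
  proof (rule that[OF P])
    show "A $ i $ j * c i * c j = (\<Sum>k\<in>UNIV. P $ i $ k * d k * P $ j $ k)" for i j
      using Bd[of i j] by (simp add: B_def)
    show "d k \<le> 1" for k using bound[of k] by simp
  qed (fact count)+
qed

section \<open>Ground states\<close>

text \<open>In the radial case the approximating test functions come from density in the full
  Sobolev space and need not be radial.\<close>

lemma H_approximable: "open \<Omega> \<Longrightarrow> u \<in> H \<Omega> \<Longrightarrow> approximable \<Omega> u"
  by (cases "\<Omega> = UNIV") (auto simp: H_def H10_eq_approximable H1_UNIV_approximable)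

lemma H_add:
  assumes "open \<Omega>" "u \<in> H \<Omega>" "v \<in> H \<Omega>"
  shows "(\<lambda>x. u x + v x) \<in> H \<Omega>"
proof (cases "\<Omega> = UNIV")
  case True
  then have uv: "u \<in> H1 UNIV" "v \<in> H1 UNIV" "radially_symmetric u" "radially_symmetric v"
    using assms by (auto simp: H_def)
  obtain f g where "AE x in lebesgue. u x = f (norm x)" "AE x in lebesgue. v x = g (norm x)"
    using uv(3,4) unfolding radially_symmetric_def by blast
  then have "AE x in lebesgue. u x + v x = f (norm x) + g (norm x)" by eventually_elim simp
  then have "radially_symmetric (\<lambda>x. u x + v x)"
    unfolding radially_symmetric_def by (intro exI[of _ "\<lambda>r. f r + g r"])
  then show ?thesis using True H1_add[OF open_UNIV uv(1,2)] by (simp add: H_def)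
next
  case False
  then show ?thesis using assms approximable_add[OF assms(1), of u v] by (simp add: H_def H10_eq_approximable)
qed

lemma H_cmult:
  assumes "open \<Omega>" "u \<in> H \<Omega>"
  shows "(\<lambda>x. c * u x) \<in> H \<Omega>"
proof (cases "\<Omega> = UNIV")
  case True
  then have u: "u \<in> H1 UNIV" "radially_symmetric u" using assms by (auto simp: H_def)
  obtain f where "AE x in lebesgue. u x = f (norm x)" using u(2) unfolding radially_symmetric_def by blast
  then have "AE x in lebesgue. c * u x = c * f (norm x)" by eventually_elim simp
  then have "radially_symmetric (\<lambda>x. c * u x)"
    unfolding radially_symmetric_def by (intro exI[of _ "\<lambda>r. c * f r"])
  then show ?thesis using True H1_cmult[OF u(1), of c] by (simp add: H_def)
next
  case False
  then show ?thesis using assms approximable_cmult[OF assms(1), of u c] by (simp add: H_def H10_eq_approximable)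
qed

text \<open>Links the weak form of the equations, written with the classical gradient of the test
  function, to the inner product.\<close>

lemma energy_form_test:
  assumes "open \<Omega>" "u \<in> H1 \<Omega>" "test_function \<Omega> \<phi>"
  shows "energy_form \<Omega> lam u \<phi> = (LINT x|lebesgue_on \<Omega>. wgrad \<Omega> u x \<bullet> grad \<phi> x + lam * u x * \<phi> x)"
  unfolding energy_form_def
proof (rule integral_cong_AE)
  show "AE x in lebesgue_on \<Omega>. wgrad \<Omega> u x \<bullet> wgrad \<Omega> \<phi> x + lam * (u x * \<phi> x) = wgrad \<Omega> u x \<bullet> grad \<phi> x + lam * u x * \<phi> x"
    using wgrad_test[OF assms(1,3)] by eventually_elim simp
qed (use H1_measurable[OF assms(2)] H1_measurable[OF test_function_H1[OF assms(1,3)]]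
    L2_measurable[OF test_function_L2(2)[OF assms(1,3)]] in measurable)

text \<open>Divide by the square of t and let t tend to 0.\<close>

lemma polynomial_nonneg_leading:
  fixes \<alpha> \<beta> \<gamma> :: real
  assumes "\<And>t. 0 \<le> \<alpha> * t\<^sup>2 + \<beta> * t^3 + \<gamma> * t^4"
  shows "\<alpha> \<ge> 0"
proof (rule tendsto_lowerbound)
  show "((\<lambda>t. \<alpha> + \<beta> * t + \<gamma> * t\<^sup>2) \<longlongrightarrow> \<alpha>) (at 0)"
    by (rule tendsto_eq_intros refl | simp)+
  have "0 \<le> \<alpha> + \<beta> * t + \<gamma> * t\<^sup>2" if "t \<noteq> 0" for t
  proof -
    have "\<alpha> * t\<^sup>2 + \<beta> * t^3 + \<gamma> * t^4 = t\<^sup>2 * (\<alpha> + \<beta> * t + \<gamma> * t\<^sup>2)"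
      by (simp add: algebra_simps power2_eq_square power3_eq_cube power4_eq_xxxx)
    then show ?thesis using assms[of t] that by (simp add: zero_le_mult_iff)
  qed
  then show "\<forall>\<^sub>F t in at 0. 0 \<le> \<alpha> + \<beta> * t + \<gamma> * t\<^sup>2" by (simp add: eventually_at_filter)
qed simp

locale ground_state =
  fixes \<Omega> :: "'a::euclidean_space set" and lam :: real and U :: "'a \<Rightarrow> real"
  assumes dim3: "DIM('a) \<le> 3" and open_\<Omega>: "open \<Omega>" and \<Omega>_nonempty: "\<Omega> \<noteq> {}" and lam_pos: "lam > 0"
    and least: "least_energy_positive_solution \<Omega> lam U"
begin

abbreviation "M \<equiv> lebesgue_on \<Omega>"

section \<open>Testing the equation with elements of H\<close>

lemma U_H: "U \<in> H \<Omega>" and U_pos: "AE x in M. U x > 0"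
  using least by (auto simp: least_energy_positive_solution_def)

lemma H_H1: "v \<in> H \<Omega> \<Longrightarrow> v \<in> H1 \<Omega>"
  by (rule approximable_H1[OF H_approximable[OF open_\<Omega>]])

lemma H_measurable: "v \<in> H \<Omega> \<Longrightarrow> v \<in> borel_measurable M"
  by (rule H1_measurable(1)[OF H_H1])

lemma H_L4: "v \<in> H \<Omega> \<Longrightarrow> integrable M (\<lambda>x. (v x)^4)"
  by (rule approximable_L4(1)[OF dim3 open_\<Omega> H_approximable[OF open_\<Omega>]])

lemma H_integrable_mult4: "a \<in> H \<Omega> \<Longrightarrow> b \<in> H \<Omega> \<Longrightarrow> c \<in> H \<Omega> \<Longrightarrow> d \<in> H \<Omega> \<Longrightarrow> integrable M (\<lambda>x. a x * b x * c x * d x)"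
  by (intro integrable_mult4 H_measurable H_L4)

lemma approximable_integrable_mult4:
  assumes "approximable \<Omega> w"
  shows "integrable M (\<lambda>x. U x * U x * U x * w x)" "integrable M (\<lambda>x. U x * U x * w x * w x)"
  by (intro integrable_mult4 H_measurable H_L4 U_H H1_measurable(1) approximable_H1[OF assms]
      approximable_L4(1)[OF dim3 open_\<Omega> assms])+

text \<open>By the equation tested with \<open>U\<close> this is also the squared energy norm of
  \<open>U\<close>, so the ground state energy is K / 4.\<close>

definition K :: real where "K = (LINT x|M. (U x)^4)"

lemma K_nonneg: "K \<ge> 0" unfolding K_def by (intro Bochner_Integration.integral_nonneg) simp

lemma Hoelder_U2:
  assumes "v \<in> borel_measurable M" "integrable M (\<lambda>x. (v x)^4)"
  shows "(LINT x|M. U x * U x * v x * v x)\<^sup>2 \<le> K * (LINT x|M. (v x)^4)"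
proof -
  have "(LINT x|M. (U x)\<^sup>2 * (v x)\<^sup>2)\<^sup>2 \<le> (LINT x|M. ((U x)\<^sup>2)\<^sup>2) * (LINT x|M. ((v x)\<^sup>2)\<^sup>2)"
    by (rule integral_Cauchy_Schwarz) (use assms H_measurable[OF U_H] H_L4[OF U_H] in \<open>auto simp flip: power_mult\<close>)
  then show ?thesis by (simp add: K_def power2_eq_square mult.assoc power4_eq_xxxx)
qed

text \<open>Cauchy-Schwarz with U^3 w = U^2 (U w), and then again for \<integral> U^2 w^2; the
  factor 4 is the root of the 16 in the L4 bound.\<close>

lemma cubic_bound:
  assumes w: "approximable \<Omega> w"
  shows "(LINT x|M. U x * U x * U x * w x)\<^sup>2 \<le> K * (4 * sqrt K * energy_form \<Omega> 1 w w)"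
proof -
  note wH = approximable_H1[OF w] and L4 = approximable_L4[OF dim3 open_\<Omega> w]
  have n: "energy_form \<Omega> 1 w w \<ge> 0" by (rule energy_form_nonneg) simp
  have "(LINT x|M. U x * U x * w x * w x)\<^sup>2 \<le> K * (16 * (energy_form \<Omega> 1 w w)\<^sup>2)"
    using Hoelder_U2[OF H1_measurable(1)[OF wH] L4(1)] mult_left_mono[OF L4(2) K_nonneg] by simp
  also have "\<dots> = (4 * sqrt K * energy_form \<Omega> 1 w w)\<^sup>2" using K_nonneg by (simp add: power_mult_distrib)
  finally have B: "(LINT x|M. U x * U x * w x * w x) \<le> 4 * sqrt K * energy_form \<Omega> 1 w w"
    by (rule power2_le_imp_le) (use K_nonneg n in simp)
  have e: "(\<lambda>x. (U x * w x)\<^sup>2) = (\<lambda>x. U x * U x * w x * w x)" "(\<lambda>x. ((U x)\<^sup>2)\<^sup>2) = (\<lambda>x. (U x)^4)"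
    "(\<lambda>x. (U x)\<^sup>2 * (U x * w x)) = (\<lambda>x. U x * U x * U x * w x)"
    by (simp_all add: power2_eq_square power4_eq_xxxx mult_ac)
  have "(LINT x|M. (U x)\<^sup>2 * (U x * w x))\<^sup>2 \<le> (LINT x|M. ((U x)\<^sup>2)\<^sup>2) * (LINT x|M. (U x * w x)\<^sup>2)"
  proof (rule integral_Cauchy_Schwarz)
    show "integrable M (\<lambda>x. (U x * w x)\<^sup>2)" unfolding e by (rule approximable_integrable_mult4(2)[OF w])
    show "integrable M (\<lambda>x. ((U x)\<^sup>2)\<^sup>2)" unfolding e by (rule H_L4[OF U_H])
  qed (use H_measurable[OF U_H] H1_measurable(1)[OF wH] in auto)
  then have "(LINT x|M. U x * U x * U x * w x)\<^sup>2 \<le> K * (LINT x|M. U x * U x * w x * w x)"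
    unfolding e K_def[symmetric] .
  from order_trans[OF this mult_left_mono[OF B K_nonneg]] show ?thesis .
qed

text \<open>The residual of the equation is bounded in the Sobolev norm: Cauchy-Schwarz for the
  linear part, \<open>cubic_bound\<close> for the other. The factor \<open>max 1 lam\<close>
  compares the norm with weight \<open>lam\<close> to the one with weight 1, in which test functions
  are dense.\<close>

lemma weak_residual_bound:
  assumes w: "approximable \<Omega> w"
  shows "(energy_form \<Omega> lam U w - (LINT x|M. U x * U x * U x * w x))\<^sup>2 \<le>
     (2 * energy_form \<Omega> lam U U * max 1 lam + 8 * K * sqrt K) * energy_form \<Omega> 1 w w"
proof -
  note wH = approximable_H1[OF w]
  have "energy_form \<Omega> lam w w \<le> (LINT x|M. max 1 lam * ((norm (wgrad \<Omega> w x))\<^sup>2 + 1 * (w x)\<^sup>2))"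
    unfolding energy_form_self
  proof (rule integral_mono)
    show "integrable M (\<lambda>x. (norm (wgrad \<Omega> w x))\<^sup>2 + lam * (w x)\<^sup>2)"
      "integrable M (\<lambda>x. max 1 lam * ((norm (wgrad \<Omega> w x))\<^sup>2 + 1 * (w x)\<^sup>2))"
      using H1_L2[OF wH] wgrad_L2[OF wH] by (auto simp: L2_def)
    fix x
    have "1 * (norm (wgrad \<Omega> w x))\<^sup>2 \<le> max 1 lam * (norm (wgrad \<Omega> w x))\<^sup>2" "lam * (w x)\<^sup>2 \<le> max 1 lam * (w x)\<^sup>2"
      by (intro mult_right_mono; simp)+
    then show "(norm (wgrad \<Omega> w x))\<^sup>2 + lam * (w x)\<^sup>2 \<le> max 1 lam * ((norm (wgrad \<Omega> w x))\<^sup>2 + 1 * (w x)\<^sup>2)"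
      by (simp add: distrib_left)
  qed
  then have m: "energy_form \<Omega> lam w w \<le> max 1 lam * energy_form \<Omega> 1 w w" by (simp add: energy_form_self)
  have 1: "(energy_form \<Omega> lam U w)\<^sup>2 \<le> energy_form \<Omega> lam U U * (max 1 lam * energy_form \<Omega> 1 w w)"
    using energy_form_Cauchy_Schwarz[OF open_\<Omega> H_H1[OF U_H] wH, of lam] lam_pos
      mult_left_mono[OF m energy_form_nonneg[of lam \<Omega> U]] by simp
  note 2 = cubic_bound[OF w]
  have "(energy_form \<Omega> lam U w - (LINT x|M. U x * U x * U x * w x))\<^sup>2 \<le> 2 * (energy_form \<Omega> lam U w)\<^sup>2 + 2 * (LINT x|M. U x * U x * U x * w x)\<^sup>2"
    using sum_squares_bound[of "energy_form \<Omega> lam U w" "- (LINT x|M. U x * U x * U x * w x)"] by (simp add: power2_diff)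
  also have "\<dots> \<le> 2 * (energy_form \<Omega> lam U U * (max 1 lam * energy_form \<Omega> 1 w w)) + 2 * (K * (4 * sqrt K * energy_form \<Omega> 1 w w))"
    using 1 2 by simp
  finally show ?thesis by (simp add: algebra_simps)
qed

lemma weak_equation_test:
  assumes \<phi>: "test_function \<Omega> \<phi>"
  shows "energy_form \<Omega> lam U \<phi> = (LINT x|M. U x * U x * U x * \<phi> x)"
proof -
  have "(LINT x|M. wgrad \<Omega> U x \<bullet> grad \<phi> x + lam * U x * \<phi> x) = (LINT x|M. (U x)^3 * \<phi> x)"
    using least \<phi> by (simp add: least_energy_positive_solution_def weakly_solves_def)
  then show ?thesis by (simp add: energy_form_test[OF open_\<Omega> H_H1[OF U_H] \<phi>] power3_eq_cube)
qed

text \<open>The residual vanishes on test functions and is small on the difference between v and an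
  approximating test function, so its square lies below every positive number.\<close>

lemma weak_equation:
  assumes v: "v \<in> H \<Omega>"
  shows "energy_form \<Omega> lam U v = (LINT x|M. U x * U x * U x * v x)"
proof -
  define F where "F w = energy_form \<Omega> lam U w - (LINT x|M. U x * U x * U x * w x)" for w
  define C where "C = 2 * energy_form \<Omega> lam U U * max 1 lam + 8 * K * sqrt K"
  have C: "C \<ge> 0" unfolding C_def using K_nonneg energy_form_nonneg[of lam \<Omega> U] lam_pos by simp
  note va = H_approximable[OF open_\<Omega> v]
  have Ft: "F \<phi> = 0" if "test_function \<Omega> \<phi>" for \<phi>
    using weak_equation_test[OF that] by (simp add: F_def)
  have "(F v)\<^sup>2 \<le> C * \<epsilon>" if e: "\<epsilon> > 0" for \<epsilon>
  proof -
    obtain \<phi> where \<phi>: "test_function \<Omega> \<phi>" "energy_form \<Omega> 1 (\<lambda>x. v x - \<phi> x) (\<lambda>x. v x - \<phi> x) < \<epsilon>"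
      using va e unfolding approximable_def by blast
    note \<phi>a = approximable_test[OF open_\<Omega> \<phi>(1)]
    note da = approximable_diff[OF open_\<Omega> va \<phi>a]
    have "(LINT x|M. U x * U x * U x * v x) =
      (LINT x|M. U x * U x * U x * (v x - \<phi> x)) + (LINT x|M. U x * U x * U x * \<phi> x)"
      by (subst Bochner_Integration.integral_add[OF approximable_integrable_mult4(1)[OF da] approximable_integrable_mult4(1)[OF \<phi>a], symmetric])
         (simp add: algebra_simps)
    moreover have "energy_form \<Omega> lam U v = energy_form \<Omega> lam U (\<lambda>x. v x - \<phi> x) + energy_form \<Omega> lam U \<phi>"
      using energy_form_add_right[OF open_\<Omega> approximable_H1[OF da] approximable_H1[OF \<phi>a] H_H1[OF U_H], of lam] by simp
    ultimately have "F v = F (\<lambda>x. v x - \<phi> x)" using Ft[OF \<phi>(1)] by (simp add: F_def)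
    then have "(F v)\<^sup>2 \<le> C * energy_form \<Omega> 1 (\<lambda>x. v x - \<phi> x) (\<lambda>x. v x - \<phi> x)"
      using weak_residual_bound[OF da] by (simp add: F_def C_def)
    also have "\<dots> \<le> C * \<epsilon>" using \<phi>(2) C by (intro mult_left_mono) auto
    finally show ?thesis .
  qed
  note b = this
  have "(F v)\<^sup>2 \<le> 0"
  proof (rule field_le_epsilon)
    fix e :: real assume e: "e > 0"
    have "(F v)\<^sup>2 \<le> C * (e / (C + 1))" using b[of "e / (C + 1)"] e C by simp
    also have "\<dots> \<le> e" using C e by (simp add: divide_simps)
    finally show "(F v)\<^sup>2 \<le> 0 + e" by simp
  qed
  then show ?thesis by (simp add: F_def)
qed

text \<open>A nonempty open set has positive measure; without this, positivity almost everywhere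
  would carry no information.\<close>

lemma not_AE_False: "\<not> (AE x in M. False)"
proof
  assume "AE x in M. False"
  then have "AE x in lebesgue. x \<notin> \<Omega>"
    using open_\<Omega> by (subst (asm) AE_restrict_space_iff) auto
  then have "emeasure lebesgue \<Omega> = 0"
    using open_\<Omega> by (subst (asm) AE_iff_measurable[OF _ refl]) auto
  moreover have "emeasure lebesgue \<Omega> \<noteq> 0"
  proof -
    have "\<not> negligible \<Omega>" using open_not_negligible[OF open_\<Omega> \<Omega>_nonempty] .
    then show ?thesis using open_\<Omega> by (auto simp: negligible_iff_null_sets null_sets_def)
  qed
  ultimately show False by simp
qed

lemma energy_form_pos:
  assumes v: "v \<in> H \<Omega>" and nz: "\<not> (AE x in M. v x = 0)"
  shows "energy_form \<Omega> lam v v > 0" "(LINT x|M. (v x)^4) > 0"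
proof -
  note L = H1_L2[OF H_H1[OF v]] wgrad_L2[OF H_H1[OF v]]
  have i2: "integrable M (\<lambda>x. (v x)\<^sup>2)" using L(1) by (simp add: L2_def)
  have pos: "(LINT x|M. f x) > 0" if "integrable M f" "\<And>x. f x \<ge> 0" "\<And>x. f x = 0 \<Longrightarrow> v x = 0" for f :: "'a \<Rightarrow> real"
  proof -
    have "(LINT x|M. f x) \<noteq> 0"
    proof
      assume "(LINT x|M. f x) = 0"
      then have "AE x in M. f x = 0"
        using integral_nonneg_eq_0_iff_AE[OF that(1)] that(2) by simp
      then have "AE x in M. v x = 0" by eventually_elim (rule that(3))
      then show False using nz by simp
    qed
    moreover have "(LINT x|M. f x) \<ge> 0" using that(2) by (rule Bochner_Integration.integral_nonneg)
    ultimately show ?thesis by linarith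
  qed
  have p: "(LINT x|M. (v x)\<^sup>2) > 0" "(LINT x|M. (v x)^4) > 0"
    by (rule pos; simp add: i2 H_L4[OF v])+
  show "(LINT x|M. (v x)^4) > 0" by fact
  have "lam * (LINT x|M. (v x)\<^sup>2) = (LINT x|M. lam * (v x)\<^sup>2)" by simp
  also have "\<dots> \<le> energy_form \<Omega> lam v v"
    unfolding energy_form_self by (rule integral_mono) (use L in \<open>auto simp: L2_def\<close>)
  finally show "energy_form \<Omega> lam v v > 0" using mult_pos_pos[OF lam_pos p(1)] by linarith
qed

lemma U_nonzero: "\<not> (AE x in M. U x = 0)"
proof
  assume "AE x in M. U x = 0"
  with U_pos have "AE x in M. False" by eventually_elim simp
  then show False using not_AE_False by simp
qed

lemma energy_form_UU: "energy_form \<Omega> lam U U = K"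
  using weak_equation[OF U_H] by (simp add: K_def power4_eq_xxxx)

lemma K_pos: "K > 0"
  using energy_form_pos(1)[OF U_H U_nonzero] by (simp add: energy_form_UU)

section \<open>Consequences of minimality\<close>

lemma scalar_energy_energy_form: "scalar_energy \<Omega> lam v = energy_form \<Omega> lam v v / 2 - (LINT x|M. (v x)^4) / 4"
  by (simp add: scalar_energy_def energy_form_self)

text \<open>A nonzero v is rescaled onto the Nehari manifold, where its energy becomes a quarter of
  the quotient of \<parallel>v\<parallel>^4 by \<integral> v^4. Minimality compares this with K /
  4.\<close>

lemma ground_state_quotient:
  assumes v: "v \<in> H \<Omega>"
  shows "K * (LINT x|M. (v x)^4) \<le> (energy_form \<Omega> lam v v)\<^sup>2"
proof (cases "AE x in M. v x = 0")
  case True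
  have "(LINT x|M. (v x)^4) = (LINT x|M. 0)"
    by (rule integral_cong_AE) (use True H_measurable[OF v] in auto)
  then show ?thesis by simp
next
  case False
  define N where "N = energy_form \<Omega> lam v v"
  define L where "L = (LINT x|M. (v x)^4)"
  have NL: "N > 0" "L > 0" using energy_form_pos[OF v False] by (auto simp: N_def L_def)
  \<comment> \<open>The scaling that equates t^2 N and t^4 L, the two sides of the Nehari
    condition.\<close>
  define t where "t = sqrt (N / L)"
  have t: "t > 0" "t\<^sup>2 = N / L" using NL by (auto simp: t_def)
  let ?w = "\<lambda>x. t * v x"
  have ipw: "energy_form \<Omega> lam ?w ?w = t\<^sup>2 * N"
    using energy_form_cmult_left[OF open_\<Omega> H_H1[OF v] H1_cmult[OF H_H1[OF v]], of lam t t]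
      energy_form_cmult_right[OF open_\<Omega> H_H1[OF v] H_H1[OF v], of lam t]
    by (simp add: N_def power2_eq_square)
  have Lw: "(LINT x|M. (?w x)^4) = (t\<^sup>2)\<^sup>2 * L" by (simp add: power_mult_distrib L_def)
  have "?w \<in> nehari \<Omega> lam"
  proof -
    have "(LINT x|M. (norm (wgrad \<Omega> ?w x))\<^sup>2 + lam * (?w x)\<^sup>2) = (LINT x|M. (?w x)^4)"
      using NL unfolding energy_form_self[symmetric] ipw Lw t(2) by (simp add: power2_eq_square)
    moreover have "\<not> (AE x in M. ?w x = 0)" using False t(1) by simp
    ultimately show ?thesis using H_cmult[OF open_\<Omega> v, of t] by (simp add: nehari_def)
  qed
  then have "scalar_energy \<Omega> lam U \<le> scalar_energy \<Omega> lam ?w"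
    using least by (auto simp: least_energy_positive_solution_def)
  then have "K / 4 \<le> t\<^sup>2 * N / 2 - (t\<^sup>2)\<^sup>2 * L / 4"
    unfolding scalar_energy_energy_form ipw Lw energy_form_UU by (simp add: K_def)
  also have "\<dots> = N\<^sup>2 / L / 4" using NL unfolding t(2) by (simp add: power2_eq_square)
  finally show ?thesis using NL by (simp add: N_def[symmetric] L_def[symmetric] pos_le_divide_eq)
qed

text \<open>The weighted inner product in which the linearization of the cubic term at
  \<open>U\<close> is expressed.\<close>

definition b :: "('a \<Rightarrow> real) \<Rightarrow> ('a \<Rightarrow> real) \<Rightarrow> real" where
  "b v w = (LINT x|M. U x * U x * v x * w x)"

text \<open>Hoelder's inequality produces K \<integral> v^4, which is precisely the left side of
  \<open>ground_state_quotient\<close>.\<close>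

lemma b_le_energy_form:
  assumes v: "v \<in> H \<Omega>"
  shows "b v v \<le> energy_form \<Omega> lam v v"
proof (rule power2_le_imp_le)
  show "(b v v)\<^sup>2 \<le> (energy_form \<Omega> lam v v)\<^sup>2"
    unfolding b_def using Hoelder_U2[OF H_measurable[OF v] H_L4[OF v]] ground_state_quotient[OF v] by simp
  show "0 \<le> energy_form \<Omega> lam v v" using lam_pos by (intro energy_form_nonneg) simp
qed

lemma b_nonneg: "b v v \<ge> 0"
  unfolding b_def
proof (rule Bochner_Integration.integral_nonneg)
  fix x
  have "U x * U x * v x * v x = (U x * v x)\<^sup>2" by (simp add: power2_eq_square mult_ac)
  then show "0 \<le> U x * U x * v x * v x" by simp
qed

text \<open>\<open>t = 0\<close> minimizes \<open>t \<mapsto> \<parallel>U + t v\<parallel>\<^sup>4 - K \<integral>(U + t v)\<^sup>4\<close>, so its second derivative there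
  is nonnegative.\<close>

lemma three_b_le_energy_form:
  assumes v: "v \<in> H \<Omega>" and orth: "b U v = 0"
  shows "3 * b v v \<le> energy_form \<Omega> lam v v"
proof -
  define N where "N = energy_form \<Omega> lam v v"
  define c3 where "c3 = (LINT x|M. U x * v x * v x * v x)"
  define c4 where "c4 = (LINT x|M. v x * v x * v x * v x)"
  have UUUv: "(LINT x|M. U x * U x * U x * v x) = 0" using orth by (simp add: b_def)
  \<comment> \<open>By the equation, orthogonality in the form \<open>b\<close> is orthogonality in
    the energy form as well; so the terms linear in t vanish on both sides.\<close>
  have uv0: "energy_form \<Omega> lam U v = 0" using weak_equation[OF v] UUUv by simp
  have "0 \<le> (2 * K * N - 6 * K * b v v) * t\<^sup>2 + (- (4 * K * c3)) * t^3 + (N\<^sup>2 - K * c4) * t^4" for t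
  proof -
    let ?w = "\<lambda>x. U x + t * v x"
    have "?w \<in> H \<Omega>" by (intro H_add H_cmult open_\<Omega> U_H v)
    from ground_state_quotient[OF this]
    have q: "K * (LINT x|M. (?w x)^4) \<le> (energy_form \<Omega> lam ?w ?w)\<^sup>2" .
    have ipw: "energy_form \<Omega> lam ?w ?w = K + N * t\<^sup>2"
      using energy_form_line[OF open_\<Omega> H_H1[OF U_H] H_H1[OF v], of lam t] by (simp add: uv0 energy_form_UU N_def)
    have "(LINT x|M. (?w x)^4) = (LINT x|M. U x * U x * U x * U x + 4 * t * (U x * U x * U x * v x) +
        6 * t\<^sup>2 * (U x * U x * v x * v x) + 4 * t^3 * (U x * v x * v x * v x) + t^4 * (v x * v x * v x * v x))"
      by (intro Bochner_Integration.integral_cong refl)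
         (simp add: power4_eq_xxxx power3_eq_cube power2_eq_square algebra_simps)
    also have "\<dots> = K + 6 * t\<^sup>2 * b v v + 4 * t^3 * c3 + t^4 * c4"
      using H_integrable_mult4[OF U_H U_H U_H U_H] H_integrable_mult4[OF U_H U_H U_H v] H_integrable_mult4[OF U_H U_H v v] H_integrable_mult4[OF U_H v v v] H_integrable_mult4[OF v v v v] UUUv
      by (simp add: b_def c3_def c4_def K_def power4_eq_xxxx)
    finally have Lw: "(LINT x|M. (?w x)^4) = K + 6 * t\<^sup>2 * b v v + 4 * t^3 * c3 + t^4 * c4" .
    \<comment> \<open>The constant terms cancel because the energy norm and the fourth power
      integral of \<open>U\<close> are both K; what is left begins with the square of t.\<close>
    have "(K + N * t\<^sup>2)\<^sup>2 - K * (K + 6 * t\<^sup>2 * b v v + 4 * t^3 * c3 + t^4 * c4) =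
      (2 * K * N - 6 * K * b v v) * t\<^sup>2 + (- (4 * K * c3)) * t^3 + (N\<^sup>2 - K * c4) * t^4"
      by (simp add: power4_eq_xxxx power3_eq_cube power2_eq_square algebra_simps)
    then show ?thesis using q unfolding ipw Lw by linarith
  qed
  then have "0 \<le> 2 * K * N - 6 * K * b v v" by (rule polynomial_nonneg_leading)
  then have "0 \<le> (2 * K) * (N - 3 * b v v)" by (simp add: algebra_simps)
  then show ?thesis using K_pos by (simp add: N_def zero_le_mult_iff)
qed

lemma b_UU: "b U U = K"
  by (simp add: b_def K_def power4_eq_xxxx)

end

section \<open>The second variation and the Morse index\<close>

lemma second_deriv_quartic:
  fixes a0 a1 a2 a3 a4 :: real
  shows "deriv (deriv (\<lambda>t. a0 + a1 * t + a2 * t\<^sup>2 + a3 * t^3 + a4 * t^4)) 0 = 2 * a2"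
proof -
  have "deriv (\<lambda>t. a0 + a1 * t + a2 * t\<^sup>2 + a3 * t^3 + a4 * t^4) = (\<lambda>t. a1 + 2 * a2 * t + 3 * a3 * t\<^sup>2 + 4 * a4 * t^3)"
    by (rule ext, rule DERIV_imp_deriv) (rule derivative_eq_intros refl | simp)+
  moreover have "deriv (\<lambda>t. a1 + 2 * a2 * t + 3 * a3 * t\<^sup>2 + 4 * a4 * t^3) 0 = 2 * a2"
    by (rule DERIV_imp_deriv) (rule derivative_eq_intros refl | simp)+
  ultimately show ?thesis by simp
qed

lemma fun_sum_apply:
  fixes f :: "'v \<Rightarrow> 'n \<Rightarrow> 'a \<Rightarrow> real"
  shows "(\<Sum>v\<in>B. a v *\<^sub>R f v) i x = (\<Sum>v\<in>B. a v * f v i x)"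
  by (induction B rule: infinite_finite_induct) (simp_all add: scaleR_fun_def)

text \<open>More unknowns than homogeneous equations. Each v is sent to the vector of its
  coefficients, which lies in a space of dimension at most card J.\<close>

lemma nontrivial_relation:
  fixes f :: "'v \<Rightarrow> 'n::finite \<Rightarrow> real"
  assumes B: "finite B" and J: "card B > card J"
  shows "\<exists>a. (\<exists>v\<in>B. a v \<noteq> 0) \<and> (\<forall>k\<in>J. (\<Sum>v\<in>B. a v * f v k) = 0)"
proof -
  define e :: "'n \<Rightarrow> real^'n" where "e k = axis k 1" for k
  define t where "t v = (\<Sum>k\<in>J. f v k *\<^sub>R e k)" for v
  have tk: "t v $ k = f v k" if "k \<in> J" for v k
  proof -
    have "(f v j *\<^sub>R e j) $ k = (if j = k then f v k else 0)" for j by (simp add: e_def axis_def)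
    then show ?thesis using that by (simp add: t_def del: vector_scaleR_component)
  qed
  have "\<exists>a. (\<exists>v\<in>B. a v \<noteq> 0) \<and> (\<Sum>v\<in>B. a v *\<^sub>R t v) = 0"
  \<comment> \<open>Linear dependence is a notion for sets, so two elements with equal coefficient
    vectors need their own relation.\<close>
  proof (cases "inj_on t B")
    case True
    have "t v \<in> span (e ` J)" for v unfolding t_def by (intro span_sum span_scale span_base imageI)
    then have "t ` B \<subseteq> span (e ` J)" by blast
    then have "dim (t ` B) \<le> card (e ` J)" by (rule dim_le_card) simp
    also have "\<dots> \<le> card J" by (rule card_image_le) simp
    also have "\<dots> < card (t ` B)" using J True by (simp add: card_image)
    finally have "dependent (t ` B)" by (intro dependent_biggerset_general)
    then obtain u where u: "\<exists>v\<in>t ` B. u v \<noteq> 0" "(\<Sum>v\<in>t ` B. u v *\<^sub>R v) = 0"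
      using dependent_finite[of "t ` B"] B by auto
    then show ?thesis using True by (intro exI[of _ "u \<circ> t"]) (auto simp: sum.reindex)
  next
    case False
    then obtain v w where vw: "v \<in> B" "w \<in> B" "v \<noteq> w" "t v = t w" by (auto simp: inj_on_def)
    let ?a = "\<lambda>x. if x = v then 1 else if x = w then -1 else 0 :: real"
    have "(\<Sum>x\<in>B. ?a x *\<^sub>R t x) = (\<Sum>x\<in>{v, w}. ?a x *\<^sub>R t x)"
      by (rule sum.mono_neutral_right) (use B vw in auto)
    also have "\<dots> = 0" using vw by simp
    finally show ?thesis using vw(1) by (intro exI[of _ ?a]) auto
  qed
  then obtain a where a: "\<exists>v\<in>B. a v \<noteq> 0" "(\<Sum>v\<in>B. a v *\<^sub>R t v) = 0" by blast
  have "(\<Sum>v\<in>B. a v * f v k) = 0" if "k \<in> J" for k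
  proof -
    have "(\<Sum>v\<in>B. a v *\<^sub>R t v) $ k = 0" by (simp add: a(2))
    then show ?thesis by (simp add: tk[OF that])
  qed
  then show ?thesis using a(1) by blast
qed

context ground_state
begin

section \<open>Bilinear forms on H and diagonal coordinates\<close>

lemma H_sum:
  assumes "finite I" "\<And>i. i \<in> I \<Longrightarrow> f i \<in> H \<Omega>"
  shows "(\<lambda>x. \<Sum>i\<in>I. a i * f i x) \<in> H \<Omega>"
  using assms
proof (induction rule: finite_induct)
  case empty
  show ?case using H_cmult[OF open_\<Omega> U_H, of 0] by simp
next
  case (insert i I)
  then show ?case using H_add[OF open_\<Omega> H_cmult[OF open_\<Omega>, of "f i" "a i"], of "\<lambda>x. \<Sum>i\<in>I. a i * f i x"] by simp
qed

text \<open>Common interface of \<open>energy_form\<close> and \<open>b\<close>. Linearity is asked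
  for on \<open>H\<close> only, where the integrals are known to converge.\<close>

definition bilinear_on_H :: "(('a \<Rightarrow> real) \<Rightarrow> ('a \<Rightarrow> real) \<Rightarrow> real) \<Rightarrow> bool" where
  "bilinear_on_H q \<longleftrightarrow> (\<forall>u\<in>H \<Omega>. \<forall>v\<in>H \<Omega>. \<forall>w\<in>H \<Omega>. q (\<lambda>x. u x + v x) w = q u w + q v w) \<and>
     (\<forall>c. \<forall>u\<in>H \<Omega>. \<forall>w\<in>H \<Omega>. q (\<lambda>x. c * u x) w = c * q u w) \<and> (\<forall>u v. q u v = q v u)"

lemma bilinear_on_HD:
  assumes "bilinear_on_H q" "u \<in> H \<Omega>" "v \<in> H \<Omega>" "w \<in> H \<Omega>"
  shows "q (\<lambda>x. u x + v x) w = q u w + q v w" "q (\<lambda>x. c * u x) w = c * q u w"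
proof -
  note q = assms(1)[unfolded bilinear_on_H_def]
  from conjunct1[OF q, rule_format, OF assms(2-4)] conjunct1[OF conjunct2[OF q], rule_format, OF assms(2,4)]
  show "q (\<lambda>x. u x + v x) w = q u w + q v w" "q (\<lambda>x. c * u x) w = c * q u w" .
qed

lemma bilinear_on_H_commute: "bilinear_on_H q \<Longrightarrow> q u v = q v u"
  unfolding bilinear_on_H_def by simp

lemma bilinear_energy_form: "bilinear_on_H (energy_form \<Omega> lam)"
  unfolding bilinear_on_H_def
  by (intro conjI ballI allI energy_form_add_left energy_form_cmult_left energy_form_commute open_\<Omega> H_H1)

lemma bilinear_b: "bilinear_on_H b"
  unfolding bilinear_on_H_def
proof (intro conjI ballI allI)
  fix u v w assume H: "u \<in> H \<Omega>" "v \<in> H \<Omega>" "w \<in> H \<Omega>"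
  show "b (\<lambda>x. u x + v x) w = b u w + b v w"
    unfolding b_def
    by (subst Bochner_Integration.integral_add[OF H_integrable_mult4[OF U_H U_H H(1,3)] H_integrable_mult4[OF U_H U_H H(2,3)], symmetric])
       (simp add: algebra_simps)
next
  fix c :: real and u w
  have "(\<lambda>x. U x * U x * (c * u x) * w x) = (\<lambda>x. c * (U x * U x * u x * w x))" by (simp add: mult_ac)
  then show "b (\<lambda>x. c * u x) w = c * b u w" by (simp add: b_def)
next
  fix u v show "b u v = b v u" by (simp add: b_def mult_ac)
qed

lemma bilinear_sum_left:
  assumes q: "bilinear_on_H q" and I: "finite I" "\<And>i. i \<in> I \<Longrightarrow> f i \<in> H \<Omega>" and w: "w \<in> H \<Omega>"
  shows "q (\<lambda>x. \<Sum>i\<in>I. a i * f i x) w = (\<Sum>i\<in>I. a i * q (f i) w)"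
  using I
proof (induction rule: finite_induct)
  case empty
  show ?case using bilinear_on_HD(2)[OF q U_H U_H w, of 0] by simp
next
  case (insert i I)
  have fi: "f i \<in> H \<Omega>" and r: "(\<lambda>x. \<Sum>i\<in>I. a i * f i x) \<in> H \<Omega>" using insert by (auto intro: H_sum)
  have "q (\<lambda>x. a i * f i x + (\<Sum>i\<in>I. a i * f i x)) w = q (\<lambda>x. a i * f i x) w + q (\<lambda>x. \<Sum>i\<in>I. a i * f i x) w"
    by (rule bilinear_on_HD(1)[OF q H_cmult[OF open_\<Omega> fi] r w])
  also have "q (\<lambda>x. a i * f i x) w = a i * q (f i) w" by (rule bilinear_on_HD(2)[OF q fi fi w])
  finally show ?case using insert by simp
qed

lemma bilinear_sum_right:
  assumes q: "bilinear_on_H q" and "finite I" "\<And>i. i \<in> I \<Longrightarrow> f i \<in> H \<Omega>" "w \<in> H \<Omega>"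
  shows "q w (\<lambda>x. \<Sum>i\<in>I. a i * f i x) = (\<Sum>i\<in>I. a i * q w (f i))"
  unfolding bilinear_on_H_commute[OF q, of w] by (rule bilinear_sum_left[OF assms])

text \<open>Used with e = 1, where orthogonality of P makes the right side the plain sum over the
  components, and with the eigenvalues for e, where it becomes the coupling term.\<close>

lemma bilinear_diagonalize:
  fixes P :: "real^'n::finite^'n"
  assumes q: "bilinear_on_H q" and \<phi>: "\<And>i. \<phi> i \<in> H \<Omega>"
  shows "(\<Sum>k\<in>UNIV. e k * q (\<lambda>x. \<Sum>i\<in>UNIV. P $ i $ k * \<phi> i x) (\<lambda>x. \<Sum>i\<in>UNIV. P $ i $ k * \<phi> i x)) =
     (\<Sum>i\<in>UNIV. \<Sum>j\<in>UNIV. (\<Sum>k\<in>UNIV. P $ i $ k * e k * P $ j $ k) * q (\<phi> i) (\<phi> j))"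
proof -
  have "q (\<lambda>x. \<Sum>i\<in>UNIV. P $ i $ k * \<phi> i x) (\<lambda>x. \<Sum>i\<in>UNIV. P $ i $ k * \<phi> i x) =
    (\<Sum>i\<in>UNIV. \<Sum>j\<in>UNIV. P $ i $ k * (P $ j $ k * q (\<phi> i) (\<phi> j)))" for k
    by (simp add: bilinear_sum_left[OF q] bilinear_sum_right[OF q] \<phi> H_sum sum_distrib_left)
  then have "(\<Sum>k\<in>UNIV. e k * q (\<lambda>x. \<Sum>i\<in>UNIV. P $ i $ k * \<phi> i x) (\<lambda>x. \<Sum>i\<in>UNIV. P $ i $ k * \<phi> i x)) =
     (\<Sum>k\<in>UNIV. \<Sum>i\<in>UNIV. \<Sum>j\<in>UNIV. P $ i $ k * e k * P $ j $ k * q (\<phi> i) (\<phi> j))"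
    by (simp add: sum_distrib_left mult_ac)
  also have "\<dots> = (\<Sum>i\<in>UNIV. \<Sum>k\<in>UNIV. \<Sum>j\<in>UNIV. P $ i $ k * e k * P $ j $ k * q (\<phi> i) (\<phi> j))" by (rule sum.swap)
  also have "\<dots> = (\<Sum>i\<in>UNIV. \<Sum>j\<in>UNIV. \<Sum>k\<in>UNIV. P $ i $ k * e k * P $ j $ k * q (\<phi> i) (\<phi> j))"
    by (intro sum.cong refl sum.swap)
  finally show ?thesis by (simp add: sum_distrib_right)
qed

text \<open>Along the line the energy is a polynomial of degree four in t, all of whose coefficients
  are finite integrals; the second derivative at 0 is twice the quadratic coefficient.\<close>

lemma second_variation_integrals:
  fixes A :: "real^'n::finite^'n" and u \<phi> :: "'n \<Rightarrow> 'a \<Rightarrow> real"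
  assumes u: "\<And>i. u i \<in> H \<Omega>" and \<phi>: "\<And>i. \<phi> i \<in> H \<Omega>"
  shows "second_variation \<Omega> lam A u \<phi> = (\<Sum>i\<in>UNIV. energy_form \<Omega> lam (\<phi> i) (\<phi> i)) -
    (\<Sum>i\<in>UNIV. \<Sum>j\<in>UNIV. A $ i $ j * ((LINT x|M. u j x * u j x * \<phi> i x * \<phi> i x) +
       4 * (LINT x|M. u i x * u j x * \<phi> i x * \<phi> j x) + (LINT x|M. u i x * u i x * \<phi> j x * \<phi> j x))) / 2"
proof -
  \<comment> \<open>The coefficient of the k-th power of t in the product of the squares of
    \<open>u i x + t * \<phi> i x\<close> and \<open>u j x + t * \<phi> j x\<close>.\<close>
  define p where "p k i j x = (if k = 0 then u i x * u i x * u j x * u j x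
    else if k = 1 then 2 * (u i x * \<phi> i x * u j x * u j x) + 2 * (u i x * u i x * u j x * \<phi> j x)
    else if k = 2 then u j x * u j x * \<phi> i x * \<phi> i x + 4 * (u i x * u j x * \<phi> i x * \<phi> j x) + u i x * u i x * \<phi> j x * \<phi> j x
    else if k = 3 then 2 * (\<phi> i x * \<phi> i x * u j x * \<phi> j x) + 2 * (u i x * \<phi> i x * \<phi> j x * \<phi> j x)
    else \<phi> i x * \<phi> i x * \<phi> j x * \<phi> j x)" for k :: nat and i j x
  have pi: "integrable M (p k i j)" for k i j
    unfolding p_def[abs_def]
    by (cases "k = 0"; cases "k = 1"; cases "k = 2"; cases "k = 3"; simp add: H_integrable_mult4 u \<phi>)
  define S where "S k x = (\<Sum>i\<in>UNIV. \<Sum>j\<in>UNIV. A $ i $ j * p k i j x)" for k x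
  have Si: "integrable M (S k)" for k
    unfolding S_def[abs_def] by (intro Bochner_Integration.integrable_sum integrable_mult_right pi)
  define J where "J k = (LINT x|M. S k x)" for k
  have line: "(u + t *\<^sub>R \<phi>) i = (\<lambda>x. u i x + t * \<phi> i x)" for t i
    by (simp add: fun_eq_iff scaleR_fun_def)
  have expand: "A $ i $ j * (u i x + t * \<phi> i x)\<^sup>2 * (u j x + t * \<phi> j x)\<^sup>2 =
    A $ i $ j * p 0 i j x + t * (A $ i $ j * p 1 i j x) + t\<^sup>2 * (A $ i $ j * p 2 i j x) + t^3 * (A $ i $ j * p 3 i j x) + t^4 * (A $ i $ j * p 4 i j x)"
    for i j x t
    unfolding p_def by (simp add: power2_eq_square power3_eq_cube power4_eq_xxxx algebra_simps)
  have quart: "(LINT x|M. (\<Sum>i\<in>UNIV. \<Sum>j\<in>UNIV. A $ i $ j * ((u + t *\<^sub>R \<phi>) i x)\<^sup>2 * ((u + t *\<^sub>R \<phi>) j x)\<^sup>2)) =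
    J 0 + J 1 * t + J 2 * t\<^sup>2 + J 3 * t^3 + J 4 * t^4" for t
  proof -
    have "(LINT x|M. (\<Sum>i\<in>UNIV. \<Sum>j\<in>UNIV. A $ i $ j * ((u + t *\<^sub>R \<phi>) i x)\<^sup>2 * ((u + t *\<^sub>R \<phi>) j x)\<^sup>2)) =
      (LINT x|M. S 0 x + t * S 1 x + t\<^sup>2 * S 2 x + t^3 * S 3 x + t^4 * S 4 x)"
      by (simp only: line expand S_def sum.distrib sum_distrib_left)
    also have "\<dots> = J 0 + J 1 * t + J 2 * t\<^sup>2 + J 3 * t^3 + J 4 * t^4"
      by (simp add: J_def Si mult.commute)
    finally show ?thesis .
  qed
  have "energy \<Omega> lam A (u + t *\<^sub>R \<phi>) =
    ((\<Sum>i\<in>UNIV. energy_form \<Omega> lam (u i) (u i)) / 2 - J 0 / 4) + ((\<Sum>i\<in>UNIV. energy_form \<Omega> lam (u i) (\<phi> i)) - J 1 / 4) * t +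
    ((\<Sum>i\<in>UNIV. energy_form \<Omega> lam (\<phi> i) (\<phi> i)) / 2 - J 2 / 4) * t\<^sup>2 + (- J 3 / 4) * t^3 + (- J 4 / 4) * t^4" for t
  proof -
    have "(\<Sum>i\<in>UNIV. (LINT x|M. (norm (wgrad \<Omega> ((u + t *\<^sub>R \<phi>) i) x))\<^sup>2 + lam * ((u + t *\<^sub>R \<phi>) i x)\<^sup>2)) =
      (\<Sum>i\<in>UNIV. energy_form \<Omega> lam (u i) (u i) + 2 * energy_form \<Omega> lam (u i) (\<phi> i) * t + energy_form \<Omega> lam (\<phi> i) (\<phi> i) * t\<^sup>2)"
      by (simp only: line energy_form_self[symmetric] energy_form_line[OF open_\<Omega> H_H1[OF u] H_H1[OF \<phi>]])
    then show ?thesis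
      unfolding energy_def quart
      by (simp add: sum.distrib sum_distrib_left[symmetric] sum_distrib_right[symmetric] algebra_simps)
  qed
  then have "second_variation \<Omega> lam A u \<phi> = 2 * ((\<Sum>i\<in>UNIV. energy_form \<Omega> lam (\<phi> i) (\<phi> i)) / 2 - J 2 / 4)"
    unfolding second_variation_def by (simp only: second_deriv_quartic)
  moreover have "J 2 = (\<Sum>i\<in>UNIV. \<Sum>j\<in>UNIV. A $ i $ j * (LINT x|M. p 2 i j x))"
    unfolding J_def S_def by (simp add: Bochner_Integration.integral_sum pi)
  moreover have "(LINT x|M. p 2 i j x) = (LINT x|M. u j x * u j x * \<phi> i x * \<phi> i x) +
       4 * (LINT x|M. u i x * u j x * \<phi> i x * \<phi> j x) + (LINT x|M. u i x * u i x * \<phi> j x * \<phi> j x)" for i j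
    unfolding p_def using H_integrable_mult4[OF u u \<phi> \<phi>] by simp
  ultimately show ?thesis by (simp add: right_diff_distrib)
qed

text \<open>Substituting multiples of \<open>U\<close> turns the i-th equation into a multiple of
  the scalar one. One test function with \<integral> U^3 \<phi> \<noteq> 0 suffices to compare the
  factors.\<close>

lemma component_equation:
  fixes A :: "real^'n::finite^'n"
  assumes u: "vector_solution \<Omega> lam A u" and uc: "\<And>i. AE x in M. u i x = c i * U x" and c: "\<And>i. c i > 0"
  shows "(\<Sum>j\<in>UNIV. A $ i $ j * (c j)\<^sup>2) = 1"
proof -
  have uH: "u i \<in> H \<Omega>" for i using u by (auto simp: vector_solution_def Hvec_def)
  have Ua: "approximable \<Omega> U" by (rule H_approximable[OF open_\<Omega> U_H])
  \<comment> \<open>The constant of \<open>cubic_bound\<close>. If \<phi> is so close to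
    \<open>U\<close> that C times the squared error is below the square of K, then T = 0 is
    impossible, since it would make \<integral> U^3 (U - \<phi>) equal to K.\<close>
  define C where "C = K * (4 * sqrt K)"
  have C: "C > 0" using K_pos by (simp add: C_def)
  have "K\<^sup>2 / C > 0" using K_pos C by simp
  then obtain \<phi> where \<phi>: "test_function \<Omega> \<phi>" "energy_form \<Omega> 1 (\<lambda>x. U x - \<phi> x) (\<lambda>x. U x - \<phi> x) < K\<^sup>2 / C"
    using Ua unfolding approximable_def by blast
  note \<phi>a = approximable_test[OF open_\<Omega> \<phi>(1)]
  define T where "T = (LINT x|M. U x * U x * U x * \<phi> x)"
  have "T \<noteq> 0"
  proof
    assume "T = 0"
    have "(LINT x|M. U x * U x * U x * (U x - \<phi> x)) = K - T"
      unfolding right_diff_distrib T_def K_def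
      by (subst Bochner_Integration.integral_diff[OF H_integrable_mult4[OF U_H U_H U_H U_H] approximable_integrable_mult4(1)[OF \<phi>a]])
         (simp add: power4_eq_xxxx)
    then have "K\<^sup>2 \<le> C * energy_form \<Omega> 1 (\<lambda>x. U x - \<phi> x) (\<lambda>x. U x - \<phi> x)"
      using cubic_bound[OF approximable_diff[OF open_\<Omega> Ua \<phi>a]] by (simp add: \<open>T = 0\<close> C_def mult.assoc)
    also have "\<dots> < C * (K\<^sup>2 / C)" by (rule mult_strict_left_mono[OF \<phi>(2) C])
    also have "\<dots> = K\<^sup>2" using C by simp
    finally show False by simp
  qed
  have "energy_form \<Omega> lam (u i) \<phi> = (LINT x|M. (\<Sum>j\<in>UNIV. A $ i $ j * u i x * (u j x)\<^sup>2) * \<phi> x)"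
    unfolding energy_form_test[OF open_\<Omega> H_H1[OF uH] \<phi>(1)]
    using u \<phi>(1) unfolding vector_solution_def weakly_solves_def by blast
  also have "\<dots> = (LINT x|M. (c i * (\<Sum>j\<in>UNIV. A $ i $ j * (c j)\<^sup>2)) * (U x * U x * U x * \<phi> x))"
  proof (rule integral_cong_AE)
    have "AE x in M. \<forall>j\<in>UNIV. u j x = c j * U x"
      using uc by (subst AE_ball_countable) (auto intro: countable_finite)
    then show "AE x in M. (\<Sum>j\<in>UNIV. A $ i $ j * u i x * (u j x)\<^sup>2) * \<phi> x =
      (c i * (\<Sum>j\<in>UNIV. A $ i $ j * (c j)\<^sup>2)) * (U x * U x * U x * \<phi> x)"
      by eventually_elim (simp add: sum_distrib_left sum_distrib_right power2_eq_square mult_ac)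
  qed (use H_measurable[OF uH] H_measurable[OF U_H] H1_measurable(1)[OF approximable_H1[OF \<phi>a]] in measurable)
  also have "\<dots> = c i * (\<Sum>j\<in>UNIV. A $ i $ j * (c j)\<^sup>2) * T" by (simp add: T_def)
  finally have 1: "energy_form \<Omega> lam (u i) \<phi> = c i * (\<Sum>j\<in>UNIV. A $ i $ j * (c j)\<^sup>2) * T" .
  have "energy_form \<Omega> lam (u i) \<phi> = energy_form \<Omega> lam (\<lambda>x. c i * U x) \<phi>"
    by (rule energy_form_cong[OF open_\<Omega> H_H1[OF uH] H1_cmult[OF H_H1[OF U_H]] approximable_H1[OF \<phi>a] uc])
  also have "\<dots> = c i * energy_form \<Omega> lam U \<phi>"
    by (rule energy_form_cmult_left[OF open_\<Omega> H_H1[OF U_H] approximable_H1[OF \<phi>a]])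
  also have "\<dots> = c i * T" by (simp add: weak_equation_test[OF \<phi>(1)] T_def)
  finally show ?thesis using 1 \<open>T \<noteq> 0\<close> c[of i] by simp
qed

text \<open>In \<open>second_variation_integrals\<close> the two pure terms each contribute one half
  of \<integral> U^2 \<phi>^2, by the row sums and by symmetry, which gives the 1. The mixed term
  contributes 4 / 2 times the matrix with entries \<open>A $ i $ j * c i * c j\<close>, which P
  diagonalizes, giving the 2 d.\<close>

lemma second_variation_diagonal:
  fixes A P :: "real^'n::finite^'n" and d :: "'n \<Rightarrow> real"
  assumes u: "\<And>i. u i \<in> H \<Omega>" and uc: "\<And>i. AE x in M. u i x = c i * U x"
    and sym: "\<And>i j. A $ i $ j = A $ j $ i" and Ac: "\<And>i. (\<Sum>j\<in>UNIV. A $ i $ j * (c j)\<^sup>2) = 1"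
    and P: "orthogonal_matrix P" and AP: "\<And>i j. A $ i $ j * c i * c j = (\<Sum>k\<in>UNIV. P $ i $ k * d k * P $ j $ k)"
    and \<phi>: "\<And>i. \<phi> i \<in> H \<Omega>"
  defines "\<psi> \<equiv> \<lambda>k x. \<Sum>i\<in>UNIV. P $ i $ k * \<phi> i x"
  shows "second_variation \<Omega> lam A u \<phi> =
    (\<Sum>k\<in>UNIV. energy_form \<Omega> lam (\<psi> k) (\<psi> k) - (1 + 2 * d k) * b (\<psi> k) (\<psi> k))"
proof -
  have I: "(LINT x|M. u i x * u j x * v x * w x) = c i * c j * b v w" if "v \<in> H \<Omega>" "w \<in> H \<Omega>" for i j v w
  proof -
    have "(LINT x|M. u i x * u j x * v x * w x) = (LINT x|M. c i * c j * (U x * U x * v x * w x))"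
    proof (rule integral_cong_AE)
      show "AE x in M. u i x * u j x * v x * w x = c i * c j * (U x * U x * v x * w x)"
        using uc[of i] uc[of j] by eventually_elim simp
    qed (use H_measurable[OF u] H_measurable[OF U_H] that[THEN H_measurable] in measurable)
    then show ?thesis by (simp add: b_def)
  qed
  have PPt: "(\<Sum>k\<in>UNIV. P $ i $ k * 1 * P $ j $ k) = (if i = j then 1 else 0)" for i j
    using orthogonal_matrix_sums(2)[OF P, of i j] by simp
  have diag: "(\<Sum>i\<in>UNIV. q (\<phi> i) (\<phi> i)) = (\<Sum>k\<in>UNIV. q (\<psi> k) (\<psi> k))" if "bilinear_on_H q" for q
    using bilinear_diagonalize[OF that \<phi>, of "\<lambda>_. 1" P] unfolding PPt \<psi>_def
    by (simp add: if_distrib[of "\<lambda>x. x * _"] cong: if_cong)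
  have offdiag: "(\<Sum>i\<in>UNIV. \<Sum>j\<in>UNIV. A $ i $ j * c i * c j * b (\<phi> i) (\<phi> j)) = (\<Sum>k\<in>UNIV. d k * b (\<psi> k) (\<psi> k))"
    using bilinear_diagonalize[OF bilinear_b \<phi>, of d P] unfolding \<psi>_def AP by simp
  have s1: "(\<Sum>i\<in>UNIV. \<Sum>j\<in>UNIV. A $ i $ j * (c j * c j * b (\<phi> i) (\<phi> i))) = (\<Sum>i\<in>UNIV. b (\<phi> i) (\<phi> i))"
  proof (rule sum.cong[OF refl])
    fix i
    have "(\<Sum>j\<in>UNIV. A $ i $ j * (c j * c j * b (\<phi> i) (\<phi> i))) = (\<Sum>j\<in>UNIV. A $ i $ j * (c j)\<^sup>2) * b (\<phi> i) (\<phi> i)"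
      by (simp only: sum_distrib_right power2_eq_square mult.assoc)
    then show "(\<Sum>j\<in>UNIV. A $ i $ j * (c j * c j * b (\<phi> i) (\<phi> i))) = b (\<phi> i) (\<phi> i)" by (simp add: Ac)
  qed
  have s2: "(\<Sum>i\<in>UNIV. \<Sum>j\<in>UNIV. A $ i $ j * (c i * c i * b (\<phi> j) (\<phi> j))) = (\<Sum>i\<in>UNIV. b (\<phi> i) (\<phi> i))"
  proof -
    have "A $ i $ j * (c i * c i * b (\<phi> j) (\<phi> j)) = A $ j $ i * (c i * c i * b (\<phi> j) (\<phi> j))" for i j
      using sym[of i j] by simp
    then show ?thesis by (subst sum.swap) (simp only: s1)
  qed
  have "second_variation \<Omega> lam A u \<phi> = (\<Sum>i\<in>UNIV. energy_form \<Omega> lam (\<phi> i) (\<phi> i)) -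
    (\<Sum>i\<in>UNIV. \<Sum>j\<in>UNIV. A $ i $ j * (c j * c j * b (\<phi> i) (\<phi> i)) + 4 * (A $ i $ j * c i * c j * b (\<phi> i) (\<phi> j)) +
       A $ i $ j * (c i * c i * b (\<phi> j) (\<phi> j))) / 2"
    unfolding second_variation_integrals[OF u \<phi>] I[OF \<phi> \<phi>] by (simp add: distrib_left mult_ac)
  also have "\<dots> = (\<Sum>i\<in>UNIV. energy_form \<Omega> lam (\<phi> i) (\<phi> i)) - (\<Sum>i\<in>UNIV. b (\<phi> i) (\<phi> i)) -
     2 * (\<Sum>i\<in>UNIV. \<Sum>j\<in>UNIV. A $ i $ j * c i * c j * b (\<phi> i) (\<phi> j))"
    by (simp only: sum.distrib s1 s2 sum_distrib_left[symmetric]) (simp add: field_simps)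
  also have "\<dots> = (\<Sum>k\<in>UNIV. energy_form \<Omega> lam (\<psi> k) (\<psi> k) - (1 + 2 * d k) * b (\<psi> k) (\<psi> k))"
    unfolding diag[OF bilinear_energy_form] diag[OF bilinear_b] offdiag
    by (simp add: sum_subtractf sum_distrib_left distrib_right sum.distrib mult.assoc)
  finally show ?thesis .
qed

text \<open>Below: multiples of \<open>U\<close> along the eigenvectors with positive eigenvalue
  span a negative space. Above: in a larger space, one linear condition for each positive eigenvalue
  leaves a nonzero element on which every summand of the form is nonnegative.\<close>

lemma morse_index_eq_card:
  fixes A P :: "real^'n::finite^'n" and d :: "'n \<Rightarrow> real"
  assumes u: "\<And>i. u i \<in> H \<Omega>" and uc: "\<And>i. AE x in M. u i x = c i * U x"
    and sym: "\<And>i j. A $ i $ j = A $ j $ i" and Ac: "\<And>i. (\<Sum>j\<in>UNIV. A $ i $ j * (c j)\<^sup>2) = 1"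
    and P: "orthogonal_matrix P" and AP: "\<And>i j. A $ i $ j * c i * c j = (\<Sum>k\<in>UNIV. P $ i $ k * d k * P $ j $ k)"
    and d1: "\<And>k. d k \<le> 1"
  shows "morse_index \<Omega> lam A u = enat (card {k. d k > 0})"
proof -
  define \<psi> where "\<psi> \<phi> k x = (\<Sum>i\<in>UNIV. P $ i $ k * \<phi> i x)" for \<phi> :: "'n \<Rightarrow> 'a \<Rightarrow> real" and k x
  have sv: "second_variation \<Omega> lam A u \<phi> = (\<Sum>k\<in>UNIV. energy_form \<Omega> lam (\<psi> \<phi> k) (\<psi> \<phi> k) - (1 + 2 * d k) * b (\<psi> \<phi> k) (\<psi> \<phi> k))"
    if "\<phi> \<in> Hvec \<Omega>" for \<phi>
    using second_variation_diagonal[OF u uc sym Ac P AP, of \<phi>] that unfolding \<psi>_def[abs_def] by (simp add: Hvec_def)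
  note PtP = orthogonal_matrix_sums(1)[OF P]
  define pos where "pos = {k. d k > 0}"
  \<comment> \<open>T y is (P y) U, chosen so that its k-th diagonal coordinate is
    \<open>y $ k\<close> times \<open>U\<close>.\<close>
  define T :: "real^'n \<Rightarrow> 'n \<Rightarrow> 'a \<Rightarrow> real" where "T y i x = (\<Sum>k\<in>UNIV. P $ i $ k * y $ k) * U x" for y i x
  have TH: "T y \<in> Hvec \<Omega>" for y
    unfolding Hvec_def T_def[abs_def] using H_cmult[OF open_\<Omega> U_H] by simp
  have Tlin: "linear T"
    by (rule linearI) (simp_all add: fun_eq_iff T_def scaleR_fun_def sum.distrib sum_distrib_left algebra_simps)
  \<comment> \<open>Both forms take the value K at \<open>U\<close>, so the k-th summand is K - (1 +
    2 d k) K = - 2 K d k times the square of \<open>y $ k\<close>.\<close>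
  have svT: "second_variation \<Omega> lam A u (T y) = - 2 * K * (\<Sum>k\<in>UNIV. d k * (y $ k)\<^sup>2)" for y
  proof -
    have "\<psi> (T y) k = (\<lambda>x. y $ k * U x)" for k
    proof
      fix x
      have "\<psi> (T y) k x = (\<Sum>i\<in>UNIV. \<Sum>l\<in>UNIV. P $ i $ k * P $ i $ l * y $ l) * U x"
        by (simp add: \<psi>_def T_def sum_distrib_left sum_distrib_right mult_ac)
      also have "(\<Sum>i\<in>UNIV. \<Sum>l\<in>UNIV. P $ i $ k * P $ i $ l * y $ l) = (\<Sum>l\<in>UNIV. (\<Sum>i\<in>UNIV. P $ i $ k * P $ i $ l) * y $ l)"
        unfolding sum_distrib_right by (rule sum.swap)
      also have "\<dots> = y $ k" by (simp add: PtP if_distrib[of "\<lambda>x. x * _"] cong: if_cong)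
      finally show "\<psi> (T y) k x = y $ k * U x" .
    qed
    moreover have "energy_form \<Omega> lam (\<lambda>x. r * U x) (\<lambda>x. r * U x) = r\<^sup>2 * K" "b (\<lambda>x. r * U x) (\<lambda>x. r * U x) = r\<^sup>2 * K" for r
      using energy_form_line[OF open_\<Omega> H1_cmult[OF H_H1[OF U_H], of 0] H_H1[OF U_H], of lam r]
        energy_form_cmult_left[OF open_\<Omega> H_H1[OF U_H] H1_cmult[OF H_H1[OF U_H], of 0], of lam 0]
        energy_form_cmult_left[OF open_\<Omega> H_H1[OF U_H] H_H1[OF U_H], of lam 0]
        bilinear_on_HD(2)[OF bilinear_b U_H U_H H_cmult[OF open_\<Omega> U_H], of r r]
        bilinear_on_HD(2)[OF bilinear_b U_H U_H U_H, of r] bilinear_on_H_commute[OF bilinear_b, of U "\<lambda>x. r * U x"]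
      by (simp_all add: energy_form_UU b_UU power2_eq_square)
    ultimately have "energy_form \<Omega> lam (\<psi> (T y) k) (\<psi> (T y) k) - (1 + 2 * d k) * b (\<psi> (T y) k) (\<psi> (T y) k) =
      - 2 * K * (d k * (y $ k)\<^sup>2)" for k
      by (simp only:) (simp add: algebra_simps)
    then show ?thesis unfolding sv[OF TH] by (simp only: sum_distrib_left)
  qed
  show ?thesis
    unfolding morse_index_def
  proof (rule antisym)
    show "Sup {enat (dim W) |W. W \<subseteq> Hvec \<Omega> \<and> subspace W \<and> (\<exists>B. finite B \<and> W = span B) \<and>
        (\<forall>\<phi>\<in>W - {0}. second_variation \<Omega> lam A u \<phi> < 0)} \<le> enat (card {k. d k > 0})"
    proof (rule Sup_least, clarify)
      fix B :: "('n \<Rightarrow> 'a \<Rightarrow> real) set"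
      assume W: "span B \<subseteq> Hvec \<Omega>" "\<forall>\<phi>\<in>span B - {0}. second_variation \<Omega> lam A u \<phi> < 0" and B: "finite B"
      show "enat (dim (span B)) \<le> enat (card {k. d k > 0})"
      proof (rule ccontr)
        assume "\<not> ?thesis"
        then have big: "card pos < dim (span B)" by (simp add: pos_def)
        \<comment> \<open>A basis inside B turns the dimension into a cardinality and guarantees
          that a nontrivial combination is nonzero.\<close>
        obtain E where E: "E \<subseteq> B" "independent E" "span E = span B"
          using maximal_independent_subset[of B] span_mono[of _ B] span_minimal[OF _ subspace_span] by (metis subset_antisym)
        have finE: "finite E" using E(1) B by (rule finite_subset)
        have "dim (span B) = card E" using dim_span_eq_card_independent[OF E(2)] E(3) by simp
        with big have "card pos < card E" by simp
        \<comment> \<open>The conditions say that the k-th diagonal coordinate is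
          \<open>b\<close>-orthogonal to \<open>U\<close>; there is one for each positive
          eigenvalue, fewer than card E.\<close>
        from nontrivial_relation[OF finE this, of "\<lambda>v k. b U (\<psi> v k)"]
        obtain a where a: "\<exists>v\<in>E. a v \<noteq> 0" "\<And>k. k \<in> pos \<Longrightarrow> (\<Sum>v\<in>E. a v * b U (\<psi> v k)) = 0" by blast
        define \<phi> where "\<phi> = (\<Sum>v\<in>E. a v *\<^sub>R v)"
        have \<phi>W: "\<phi> \<in> span B" unfolding \<phi>_def using E(3) by (auto intro!: span_sum span_scale intro: span_base)
        have "\<phi> \<noteq> 0" using E(2) a(1) dependent_finite[OF finE] unfolding \<phi>_def by blast
        then have neg: "second_variation \<Omega> lam A u \<phi> < 0" using W(2) \<phi>W by blast
        have \<phi>H: "\<phi> \<in> Hvec \<Omega>" using W(1) \<phi>W by blast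
        have EH: "v i \<in> H \<Omega>" if "v \<in> E" for v i
          using that E W(1) span_base[of v B] by (auto simp: Hvec_def)
        have \<psi>H: "\<psi> v k \<in> H \<Omega>" if "v \<in> Hvec \<Omega>" for v k
          unfolding \<psi>_def[abs_def] using that by (intro H_sum) (auto simp: Hvec_def)
        have \<psi>\<phi>: "\<psi> \<phi> k = (\<lambda>x. \<Sum>v\<in>E. a v * \<psi> v k x)" for k
        proof
          fix x
          have "\<psi> \<phi> k x = (\<Sum>i\<in>UNIV. \<Sum>v\<in>E. P $ i $ k * (a v * v i x))"
            by (simp add: \<psi>_def \<phi>_def fun_sum_apply[of a "\<lambda>v. v"] sum_distrib_left)
          also have "\<dots> = (\<Sum>v\<in>E. \<Sum>i\<in>UNIV. P $ i $ k * (a v * v i x))" by (rule sum.swap)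
          finally show "\<psi> \<phi> k x = (\<Sum>v\<in>E. a v * \<psi> v k x)" by (simp add: \<psi>_def sum_distrib_left mult_ac)
        qed
        have orth: "b U (\<psi> \<phi> k) = 0" if "k \<in> pos" for k
          unfolding \<psi>\<phi> using a(2)[OF that] EH
          by (subst bilinear_sum_right[OF bilinear_b finE _ U_H]) (auto intro!: \<psi>H simp: Hvec_def)
        have "second_variation \<Omega> lam A u \<phi> \<ge> 0"
          unfolding sv[OF \<phi>H]
        proof (rule sum_nonneg)
          fix k
          have h: "\<psi> \<phi> k \<in> H \<Omega>" by (rule \<psi>H[OF \<phi>H])
          show "0 \<le> energy_form \<Omega> lam (\<psi> \<phi> k) (\<psi> \<phi> k) - (1 + 2 * d k) * b (\<psi> \<phi> k) (\<psi> \<phi> k)"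
          \<comment> \<open>Orthogonality permits the weight 3, which covers 1 + 2 d k because d k
            \<le> 1; for d k \<le> 0 the weight is at most 1 and no orthogonality is
            required.\<close>
          proof (cases "k \<in> pos")
            case True
            have "(1 + 2 * d k) * b (\<psi> \<phi> k) (\<psi> \<phi> k) \<le> 3 * b (\<psi> \<phi> k) (\<psi> \<phi> k)"
              using d1[of k] by (intro mult_right_mono b_nonneg) simp
            also have "\<dots> \<le> energy_form \<Omega> lam (\<psi> \<phi> k) (\<psi> \<phi> k)" by (rule three_b_le_energy_form[OF h orth[OF True]])
            finally show ?thesis by simp
          next
            case False
            have "(1 + 2 * d k) * b (\<psi> \<phi> k) (\<psi> \<phi> k) \<le> 1 * b (\<psi> \<phi> k) (\<psi> \<phi> k)"
              using False by (intro mult_right_mono b_nonneg) (simp add: pos_def)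
            also have "\<dots> \<le> energy_form \<Omega> lam (\<psi> \<phi> k) (\<psi> \<phi> k)" using b_le_energy_form[OF h] by simp
            finally show ?thesis by simp
          qed
        qed
        then show False using neg by simp
      qed
    qed
    show "enat (card {k. d k > 0}) \<le> Sup {enat (dim W) |W. W \<subseteq> Hvec \<Omega> \<and> subspace W \<and> (\<exists>B. finite B \<and> W = span B) \<and>
        (\<forall>\<phi>\<in>W - {0}. second_variation \<Omega> lam A u \<phi> < 0)}"
    proof (rule Sup_upper, rule CollectI, intro exI conjI)
      define e :: "'n \<Rightarrow> real^'n" where "e k = axis k 1" for k
      have inje: "inj_on e pos" by (auto simp: inj_on_def e_def axis_eq_axis)
      have inde: "independent (e ` pos)"
        by (rule independent_mono[OF independent_Basis]) (auto simp: e_def Basis_vec_def)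
      have spane: "y $ k = 0" if "y \<in> span (e ` pos)" "k \<notin> pos" for y k
        using that
      proof (induction rule: span_induct_alt)
        case (step c x y)
        then show ?case by (auto simp: e_def axis_def split: if_splits)
      qed simp
      have negT: "second_variation \<Omega> lam A u (T y) < 0" if y: "y \<in> span (e ` pos)" "y \<noteq> 0" for y
      proof -
        obtain k where k: "y $ k \<noteq> 0" using y(2) by (auto simp: vec_eq_iff)
        have "k \<in> pos" using spane[OF y(1), of k] k by blast
        then have "d k * (y $ k)\<^sup>2 > 0" using k by (simp add: pos_def)
        also have "d k * (y $ k)\<^sup>2 \<le> (\<Sum>k\<in>UNIV. d k * (y $ k)\<^sup>2)"
        proof (rule member_le_sum)
          fix j assume "j \<in> UNIV - {k}"
          show "0 \<le> d j * (y $ j)\<^sup>2" using spane[OF y(1), of j] by (cases "j \<in> pos") (auto simp: pos_def)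
        qed auto
        finally show ?thesis unfolding svT using K_pos by (simp add: mult_less_0_iff)
      qed
      \<comment> \<open>If T identified two points, the second variation at T 0, which is 0, would
        be negative.\<close>
      have injT: "inj_on T (span (e ` pos))"
      proof (rule inj_onI)
        fix y z assume yz: "y \<in> span (e ` pos)" "z \<in> span (e ` pos)" "T y = T z"
        have m: "y - z \<in> span (e ` pos)" by (rule span_diff[OF yz(1,2)])
        have T0: "T (y - z) = T 0" using yz(3) by (simp add: linear_diff[OF Tlin] linear_0[OF Tlin])
        show "y = z"
        proof (rule ccontr)
          assume "y \<noteq> z"
          then have "second_variation \<Omega> lam A u (T (y - z)) < 0" by (intro negT[OF m]) simp
          then show False unfolding T0 svT by simp
        qed
      qed
      have spanT: "span (T ` e ` pos) = T ` span (e ` pos)" by (rule linear_span_image[OF Tlin])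
      have indT: "independent (T ` e ` pos)"
        by (rule linear_independent_injective_image[OF Tlin inde injT])
      have "card (T ` e ` pos) = card pos"
        using card_image[OF inj_on_subset[OF injT span_superset]] card_image[OF inje] by simp
      then show "enat (card {k. d k > 0}) = enat (dim (span (T ` e ` pos)))"
        using dim_span_eq_card_independent[OF indT] by (simp add: pos_def)
      show "span (T ` e ` pos) \<subseteq> Hvec \<Omega>" unfolding spanT using TH by blast
      show "subspace (span (T ` e ` pos))" by (rule subspace_span)
      show "finite (T ` e ` pos)" by simp
      show "span (T ` e ` pos) = span (T ` e ` pos)" ..
      show "\<forall>\<phi>\<in>span (T ` e ` pos) - {0}. second_variation \<Omega> lam A u \<phi> < 0"
      proof
        fix \<phi> assume "\<phi> \<in> span (T ` e ` pos) - {0}"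
        then obtain y where y: "y \<in> span (e ` pos)" "\<phi> = T y" "T y \<noteq> 0" unfolding spanT by blast
        then have "y \<noteq> 0" using linear_0[OF Tlin] by auto
        then show "second_variation \<Omega> lam A u \<phi> < 0" unfolding y(2) by (rule negT[OF y(1)])
      qed
    qed
  qed
qed

end

theorem theorem3p2:
  fixes \<Omega> :: "'a::euclidean_space set" and lam :: real and U :: "'a \<Rightarrow> real"
    and A :: "real^'n::finite^'n" and u :: "'n \<Rightarrow> 'a \<Rightarrow> real"
  assumes "DIM('a) \<le> 3"
    and "open \<Omega>" and "connected \<Omega>" and "\<Omega> \<noteq> {}"
    and "lam > 0"
    and "least_energy_positive_solution \<Omega> lam U"
    and "CARD('n) \<ge> 3"
    and "\<forall>i j. A $ i $ j = A $ j $ i \<and> A $ i $ j \<ge> 0" and "\<forall>i. A $ i $ i = 0"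
    and "positive_vector_solution \<Omega> lam A u" and "u \<in> multiples \<Omega> U"
  shows "(det A > 0 \<longrightarrow> (\<exists>m l::nat. morse_index \<Omega> lam A u = enat m \<and>
            int m = int CARD('n) - 2 - 2 * int l)) \<and>
         (det A < 0 \<longrightarrow> (\<exists>m l::nat. morse_index \<Omega> lam A u = enat m \<and>
            int m = int CARD('n) - 3 - 2 * int l))"
proof -
  interpret ground_state \<Omega> lam U
    using assms(1,2,4-6) by unfold_locales
  obtain c :: "real^'n" where uc: "\<And>i. AE x in M. u i x = c $ i * U x"
    using assms(11) unfolding multiples_def by blast
  have sol: "vector_solution \<Omega> lam A u" and up: "\<And>i. AE x in M. u i x > 0"
    using assms(10) by (auto simp: positive_vector_solution_def)
  have uH: "u i \<in> H \<Omega>" for i using sol by (auto simp: vector_solution_def Hvec_def)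
  have c: "c $ i > 0" for i
  proof (rule ccontr)
    assume n: "\<not> c $ i > 0"
    \<comment> \<open>If c were not positive, \<open>u i\<close> and \<open>U\<close> could not both
      be positive at almost every point.\<close>
    have "AE x in M. False"
      using uc[of i] up[of i] U_pos by eventually_elim (use n in \<open>simp add: zero_less_mult_iff\<close>)
    then show False using not_AE_False by simp
  qed
  have sym: "A $ i $ j = A $ j $ i" and nn: "A $ i $ j \<ge> 0" for i j using assms(8) by auto
  have diag: "A $ i $ i = 0" for i using assms(9) by simp
  note Ac = component_equation[OF sol uc c]
  obtain P :: "real^'n^'n" and d where P: "orthogonal_matrix P"
    "\<And>i j. A $ i $ j * c $ i * c $ j = (\<Sum>k\<in>UNIV. P $ i $ k * d k * P $ j $ k)" "\<And>k. d k \<le> 1"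
    "det A > 0 \<Longrightarrow> \<exists>l::nat. int (card {k. d k > 0}) = int CARD('n) - 2 - 2 * int l"
    "det A < 0 \<Longrightarrow> \<exists>l::nat. int (card {k. d k > 0}) = int CARD('n) - 3 - 2 * int l"
    using coupling_matrix_spectrum[OF assms(7) sym nn diag c Ac] by blast
  show ?thesis
    unfolding morse_index_eq_card[OF uH uc sym Ac P(1-3)] using P(4,5) by blast
qed

end
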